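(* Let $M,N\ge0$ be integers and let $\phi\in\mathcal{D}_N^M$ with $\widehat\phi(0)\ne0$. Then $\phi$ generates a multiresolution analysis (i.e. the spaces $V_j=\overline{\operatorname{span}\{\phi(p^{-j}x-a):\ a\in I_p\}}$, $j\in\mathbb{Z}$, form an MRA) if and only if (1) $\phi$ is refinable, and (2) there exist at most $p^N$ integers $l$ such that $0\le l<p^{M+N}$ and $\widehat\phi\big(\frac{l}{p^M}\big)\ne0$.
   Context: $p$ is a prime, $\mathbb{Q}_p$ the field of $p$-adic numbers with norm $|\cdot|_p$. The fractional part of $x=p^{\gamma}\sum_{j\ge0}x_jp^j$ ($x_j\in\{0,\dots,p-1\}$, $x_0\ne0$) is $\{x\}_p=p^{\gamma}\sum_{j=0}^{-\gamma-1}x_jp^j$, $\{0\}_p=0$; $\chi_p(x)=e^{2\pi i\{x\}_p}$; $I_p=\{a\in\mathbb{Q}_p:\{a\}_p=a\}$; $B_\gamma(a)=\{x:|x-a|_p\le p^\gamma\}$. $dx$ is Haar measure with $B_0(0)$ of measure $1$; $\widehat f(\xi)=\int\chi_p(\xi x)f(x)\,dx$. A test function is a locally constant compactly supported complex function. $\mathcal{D}_N^M$ is the set of test functions $\phi$ that are $p^M$-periodic ($\phi(x+p^M)=\phi(x)$) and supported in $B_N(0)$; equivalently, locally constant $\phi$ with $\operatorname{supp}\phi\subset B_N(0)$, $\operatorname{supp}\widehat\phi\subset B_M(0)$. A function $\phi\in L^2(\mathbb{Q}_p)$ is refinable if $\phi(x)=\sum_{a\in I_p}\alpha_a\phi(p^{-1}x-a)$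 for some complex $\alpha_a$ (convergence in $L^2$). Closures are in $L^2(\mathbb{Q}_p)$. A collection of closed subspaces $V_j\subset L^2(\mathbb{Q}_p)$, $j\in\mathbb{Z}$, is an MRA if: (a) $V_j\subset V_{j+1}$; (b) $\bigcup_jV_j$ is dense in $L^2(\mathbb{Q}_p)$; (c) $\bigcap_jV_j=\{0\}$; (d) $f(\cdot)\in V_j\iff f(p^{-1}\cdot)\in V_{j+1}$; (e) there is $\phi\in V_0$ with $V_0=\overline{\operatorname{span}\{\phi(x-a):a\in I_p\}}$. *)

theory Defs
  imports "HOL-Analysis.Analysis" "HOL-Computational_Algebra.Primes"
begin

class prime_card = finite +
  assumes prime_card: "prime CARD('a)"

text \<open>An element x = sum over j of x_j p^j is represented by its digit function
  (digits in 0..p-1, zero for all sufficiently negative indices).\<close>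

typedef ('p::prime_card) padic =
  "{d :: int \<Rightarrow> nat. (\<forall>k. d k < CARD('p)) \<and> (\<exists>K. \<forall>k<K. d k = 0)}"
  morphisms digit Abs_padic
  by (rule exI[of _ "\<lambda>_. 0"]) auto

definition ptrunc :: "'p::prime_card padic \<Rightarrow> int \<Rightarrow> real" where
  "ptrunc x k = (\<Sum>j\<in>{j. j \<le> k \<and> digit x j \<noteq> 0}. real (digit x j) * real CARD('p) powi j)"

text \<open>Build a p-adic number from a family of approximations f k congruent to it
  modulo p^(k+1): digit k is floor(f k / p^k) mod p.\<close>
definition pmk :: "(int \<Rightarrow> real) \<Rightarrow> 'p::prime_card padic" where
  "pmk f = Abs_padic (\<lambda>k. nat (\<lfloor>f k / real CARD('p) powi k\<rfloor> mod int CARD('p)))"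

definition pzero :: "'p::prime_card padic" where
  "pzero = Abs_padic (\<lambda>_. 0)"

definition padd :: "'p::prime_card padic \<Rightarrow> 'p padic \<Rightarrow> 'p padic" where
  "padd x y = pmk (\<lambda>k. ptrunc x k + ptrunc y k)"

definition psub :: "'p::prime_card padic \<Rightarrow> 'p padic \<Rightarrow> 'p padic" where
  "psub x y = pmk (\<lambda>k. ptrunc x k - ptrunc y k)"

definition pval :: "'p::prime_card padic \<Rightarrow> int" where
  "pval x = (LEAST k. digit x k \<noteq> 0)"

definition pmul :: "'p::prime_card padic \<Rightarrow> 'p padic \<Rightarrow> 'p padic" where
  "pmul x y = pmk (\<lambda>k. ptrunc x (k - pval y) * ptrunc y (k - pval x))"

text \<open>pscale k x = p^k * x (shift of digits).\<close>
definition pscale :: "int \<Rightarrow> 'p::prime_card padic \<Rightarrow> 'p padic" where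
  "pscale k x = Abs_padic (\<lambda>i. digit x (i - k))"

definition pnat :: "nat \<Rightarrow> 'p::prime_card padic" where
  "pnat n = Abs_padic (\<lambda>k. if k < 0 then 0 else (n div CARD('p) ^ nat k) mod CARD('p))"

definition pfrac :: "'p::prime_card padic \<Rightarrow> real" where
  "pfrac x = (\<Sum>j\<in>{j. j < 0 \<and> digit x j \<noteq> 0}. real (digit x j) * real CARD('p) powi j)"

definition pchi :: "'p::prime_card padic \<Rightarrow> complex" where
  "pchi x = cis (2 * pi * pfrac x)"

definition Ip :: "'p::prime_card padic set" where
  "Ip = {a. \<forall>k\<ge>0. digit a k = 0}"

text \<open>Ball B_gamma(a) = {x. |x - a|_p \<le> p^gamma}.\<close>
definition pball :: "int \<Rightarrow> 'p::prime_card padic \<Rightarrow> 'p padic set" where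
  "pball g a = {x. \<forall>k < -g. digit (psub x a) k = 0}"

text \<open>The translation-invariant measure on the Borel sets (generated by the balls),
  normalised by measure 1 for B_0(0); it exists and is unique.\<close>
definition haar :: "'p::prime_card padic measure" where
  "haar = (SOME M. space M = UNIV
      \<and> sets M = sigma_sets UNIV (range (\<lambda>(g, a). pball g a))
      \<and> (\<forall>A\<in>sets M. \<forall>a. emeasure M ((\<lambda>x. padd x a) ` A) = emeasure M A)
      \<and> emeasure M (pball 0 pzero) = 1)"

definition L2 :: "('p::prime_card padic \<Rightarrow> complex) set" where
  "L2 = {f. f \<in> borel_measurable haar \<and> integrable haar (\<lambda>x. (cmod (f x))\<^sup>2)}"

definition l2norm :: "('p::prime_card padic \<Rightarrow> complex) \<Rightarrow> real" where
  "l2norm f = sqrt (LINT x|haar. (cmod (f x))\<^sup>2)"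

text \<open>Closure in L^2 (as a set of functions; automatically saturated under a.e. equality).\<close>
definition l2_closure :: "('p::prime_card padic \<Rightarrow> complex) set \<Rightarrow> ('p padic \<Rightarrow> complex) set" where
  "l2_closure S = {f \<in> L2. \<forall>e>0. \<exists>g\<in>S. l2norm (\<lambda>x. f x - g x) < e}"

definition fspan :: "('a \<Rightarrow> complex) set \<Rightarrow> ('a \<Rightarrow> complex) set" where
  "fspan S = {f. \<exists>F c. finite F \<and> F \<subseteq> S \<and> f = (\<lambda>x. \<Sum>g\<in>F. c g * g x)}"

definition l2_closed_subspace :: "('p::prime_card padic \<Rightarrow> complex) set \<Rightarrow> bool" where
  "l2_closed_subspace V \<longleftrightarrow> V \<subseteq> L2 \<and> (\<lambda>x. 0) \<in> V
     \<and> (\<forall>f\<in>V. \<forall>g\<in>V. (\<lambda>x. f x + g x) \<in> V)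
     \<and> (\<forall>c. \<forall>f\<in>V. (\<lambda>x. c * f x) \<in> V)
     \<and> l2_closure V = V"

definition pfourier :: "('p::prime_card padic \<Rightarrow> complex) \<Rightarrow> 'p padic \<Rightarrow> complex" where
  "pfourier f \<xi> = (LINT x|haar. pchi (pmul \<xi> x) * f x)"

definition test_function :: "('p::prime_card padic \<Rightarrow> complex) \<Rightarrow> bool" where
  "test_function f \<longleftrightarrow> (\<forall>x. \<exists>g. \<forall>y\<in>pball g x. f y = f x)
     \<and> (\<exists>g. \<forall>x. x \<notin> pball g pzero \<longrightarrow> f x = 0)"

definition DNM :: "nat \<Rightarrow> nat \<Rightarrow> ('p::prime_card padic \<Rightarrow> complex) set" where
  "DNM N M = {f. test_function f
      \<and> (\<forall>x. f (padd x (pnat (CARD('p) ^ M))) = f x)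
      \<and> (\<forall>x. x \<notin> pball (int N) pzero \<longrightarrow> f x = 0)}"

text \<open>Refinable: f = sum over a in I_p of alpha_a f(p^{-1} x - a), the series converging
  (unconditionally) in L^2.\<close>
definition refinable :: "('p::prime_card padic \<Rightarrow> complex) \<Rightarrow> bool" where
  "refinable f \<longleftrightarrow> f \<in> L2 \<and> (\<exists>\<alpha>. \<forall>e>0. \<exists>F0. finite F0 \<and> F0 \<subseteq> Ip \<and>
      (\<forall>F. finite F \<and> F0 \<subseteq> F \<and> F \<subseteq> Ip \<longrightarrow>
         l2norm (\<lambda>x. f x - (\<Sum>a\<in>F. \<alpha> a * f (psub (pscale (-1) x) a))) < e))"

definition is_MRA :: "(int \<Rightarrow> ('p::prime_card padic \<Rightarrow> complex) set) \<Rightarrow> bool" where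
  "is_MRA V \<longleftrightarrow> (\<forall>j. l2_closed_subspace (V j))
     \<and> (\<forall>j. V j \<subseteq> V (j + 1))
     \<and> l2_closure (\<Union>j. V j) = L2
     \<and> (\<Inter>j. V j) = {f \<in> L2. AE x in haar. f x = 0}
     \<and> (\<forall>j f. f \<in> V j \<longleftrightarrow> (\<lambda>x. f (pscale (-1) x)) \<in> V (j + 1))
     \<and> (\<exists>\<phi>\<in>V 0. V 0 = l2_closure (fspan {(\<lambda>x. \<phi> (psub x a)) | a. a \<in> Ip}))"

definition Vgen :: "('p::prime_card padic \<Rightarrow> complex) \<Rightarrow> int \<Rightarrow> ('p padic \<Rightarrow> complex) set" where
  "Vgen \<phi> j = l2_closure (fspan {(\<lambda>x. \<phi> (psub (pscale (-j) x) a)) | a. a \<in> Ip})"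

end

(*
Put P = p^(N+M). A function that is p^M-periodic and supported in B_N(0) is determined by its P values
at the points n/p^N, and its Fourier transform at l/p^M is, up to a factor, the discrete Fourier
transform of length P of these values. Let L be the set of frequencies where that of phi is nonzero.

If card L <= p^N, Lagrange interpolation on the roots of unity indexed by L shows that every such
function with frequencies in L is a combination of the p^N translates phi(x - k/p^N), 0 <= k < p^N.
This applies to all translates of phi by elements of B_N(0), so V_0 is invariant under all
translations, and refinability gives V_0 in V_1. It also applies to the indicator of B_N(0), whose only
frequency is 0, so the V_j contain the indicators of all balls, and their union is dense. An element of
all V_j is invariant under all translations, hence zero, because a ball has infinitely many disjoint
translates.

Conversely V_0 in V_j makes phi a finite combination of the functions phi(p^(-j) x - k/p^(N+j)),
0 <= k < p^(N+j). For j = N + M, every nonzero element of L accounts for P zeros of the polynomial of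
degree less than p^N P formed from the coefficients, so card L - 1 < p^N.
*)
theory Submission
  imports Defs "HOL-Library.Real_Mod"
begin

section \<open>Truncations and the additive group\<close>

text \<open>The set I_p is not a group: a sum of two of its elements may carry past the radix point.
  So the span of the translates of phi by I_p is not visibly translation invariant, and refinability
  of phi alone says nothing about phi(x - a). The bound on card L supplies this invariance. In the
  converse, the inclusion of V_0 in V_j concerns closures. It becomes exact because all functions
  involved are constant on balls of one radius, so that approximation in norm controls finitely many
  values. The exponent j = N + M arises as follows. In transforms of length P p^j, the P-periodic
  samples of phi have transform 0 at every l not divisible by p^j, while this transform is a
  polynomial value times the transform of the dilated samples. A frequency r in L has p^j
  representatives modulo P p^j. With p^j = P no r other than 0 is divisible by p^j, so every such
  representative is a zero of the polynomial; only r = 0 is lost, hence card L - 1. Products of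
  p-adic numbers occur only inside the character, so an additive group suffices as
  structure.\<close>

lemma card_gt_1: "1 < CARD('p::prime_card)"
  by (rule prime_gt_1_nat[OF prime_card])

lemma base_pos [simp]: "0 < real CARD('p::prime_card)"
  using card_gt_1[where ?'p='p] by simp

lemma base_gt_1 [simp]: "1 < real CARD('p::prime_card)"
  using card_gt_1[where ?'p='p] by simp

lemma base_powi_pos [simp]: "0 < real CARD('p::prime_card) powi k"
  by (rule zero_less_power_int) (rule base_pos)

lemma base_powi_Suc:
  "real CARD('p::prime_card) powi (k + 1) = real CARD('p) * real CARD('p) powi k"
  by (subst power_int_add_1') (simp_all del: of_nat_0_less_iff)

lemma base_powi_add:
  "real CARD('p::prime_card) powi (i + j) = real CARD('p) powi i * real CARD('p) powi j"
  by (rule power_int_add) simp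

lemma rcong_powi_mono:
  assumes "[a = b] (rmod real CARD('p::prime_card) powi j)" "i \<le> j"
  shows "[a = b] (rmod real CARD('p) powi i)"
proof -
  obtain z where z: "b = a + of_int z * real CARD('p) powi j"
    using assms(1) unfolding rcong_altdef by blast
  have "real CARD('p) powi j = real CARD('p) powi (j - i) * real CARD('p) powi i"
    by (simp flip: base_powi_add)
  also have "real CARD('p) powi (j - i) = of_int (int CARD('p) ^ nat (j - i))"
    using assms(2) by (simp add: power_int_nonneg_exp)
  finally have "b = a + of_int (z * int CARD('p) ^ nat (j - i)) * real CARD('p) powi i"
    using z by simp
  then show ?thesis
    unfolding rcong_altdef by blast
qed

lemma rcong_mult_left:
  assumes "[a = b] (rmod m)"
  shows "[c * a = c * b] (rmod (c * m))"
proof -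
  obtain z where "b = a + of_int z * m"
    using assms unfolding rcong_altdef by blast
  then have "c * b = c * a + of_int z * (c * m)"
    by (simp add: algebra_simps)
  then show ?thesis
    unfolding rcong_altdef by blast
qed

section \<open>Digit functions and their truncations\<close>

lemma digit_less: "digit (x::'p::prime_card padic) k < CARD('p)"
  using digit[of x] by auto

lemma digit_low: "\<exists>K. \<forall>k<K. digit x k = 0"
  using digit[of x] by auto

lemma padic_eq_iff: "x = y \<longleftrightarrow> (\<forall>k. digit x k = digit y k)"
  by (metis digit_inject ext)

lemma digit_Abs:
  assumes "\<And>k. d k < CARD('p::prime_card)" "\<And>k. k < K \<Longrightarrow> d k = 0"
  shows "digit (Abs_padic d :: 'p padic) k = d k"
  by (subst Abs_padic_inverse) (use assms in auto)

lemma digit_pzero [simp]: "digit pzero k = 0"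
  unfolding pzero_def by (rule digit_Abs) (use card_gt_1 in auto)

lemma finite_digits: "finite {j. j \<le> k \<and> digit x j \<noteq> 0}"
proof -
  obtain K where K: "\<forall>k<K. digit x k = 0"
    using digit_low by blast
  have "{j. j \<le> k \<and> digit x j \<noteq> 0} \<subseteq> {K..k}"
    using K by (auto simp flip: not_less)
  then show ?thesis
    by (rule finite_subset) simp
qed

lemma ptrunc_step:
  "ptrunc (x::'p::prime_card padic) (k + 1) =
     ptrunc x k + real (digit x (k + 1)) * real CARD('p) powi (k + 1)"
proof (cases "digit x (k + 1) = 0")
  case True
  then have "{j. j \<le> k + 1 \<and> digit x j \<noteq> 0} = {j. j \<le> k \<and> digit x j \<noteq> 0}"
    by (auto simp: order_le_less zless_add1_eq)
  then show ?thesis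
    using True by (simp add: ptrunc_def)
next
  case False
  then have "{j. j \<le> k + 1 \<and> digit x j \<noteq> 0} = insert (k + 1) {j. j \<le> k \<and> digit x j \<noteq> 0}"
    by (auto simp: order_le_less zless_add1_eq)
  then show ?thesis
    using finite_digits[of k x] by (simp add: ptrunc_def)
qed

lemma ptrunc_low:
  assumes "\<And>j. j \<le> k \<Longrightarrow> digit x j = 0"
  shows "ptrunc x k = 0"
proof -
  have "{j. j \<le> k \<and> digit x j \<noteq> 0} = {}"
    using assms by auto
  then show ?thesis
    unfolding ptrunc_def by simp
qed

text \<open>Digits vanish below some index, so statements on truncations are trivial far down and
  can be carried upwards one index at a time, although the integers have no least element.\<close>

lemma int_induct_from_low:
  fixes P :: "int \<Rightarrow> bool"
  assumes "\<And>k. k < K \<Longrightarrow> P k" "\<And>k. P k \<Longrightarrow> P (k + 1)"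
  shows "P k"
proof (cases "k < K")
  case False
  then have "K - 1 \<le> k" by simp
  then show ?thesis
    by (induction k rule: int_ge_induct) (use assms in auto)
qed (rule assms)

lemma ptrunc_nonneg: "0 \<le> ptrunc x k"
  unfolding ptrunc_def by (intro sum_nonneg mult_nonneg_nonneg) auto

lemma ptrunc_less: "ptrunc (x::'p::prime_card padic) k < real CARD('p) powi (k + 1)"
proof -
  obtain K where K: "\<forall>k<K. digit x k = 0"
    using digit_low by blast
  show ?thesis
  proof (induction k rule: int_induct_from_low[where K=K])
    case (1 k)
    then have "ptrunc x k = 0"
      using K by (intro ptrunc_low) auto
    then show ?case by simp
  next
    case (2 k)
    have "real (digit x (k + 1)) + 1 \<le> real CARD('p)"
      using digit_less[of x "k + 1"] by linarith
    then have "(real (digit x (k + 1)) + 1) * real CARD('p) powi (k + 1)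
        \<le> real CARD('p) * real CARD('p) powi (k + 1)"
      by (intro mult_right_mono) (auto intro: less_imp_le)
    also have "\<dots> = real CARD('p) powi (k + 1 + 1)"
      by (simp only: base_powi_Suc[of "k + 1"])
    finally have "(real (digit x (k + 1)) + 1) * real CARD('p) powi (k + 1)
        \<le> real CARD('p) powi (k + 1 + 1)" .
    then show ?case
      unfolding ptrunc_step using 2 by (simp add: distrib_right)
  qed
qed

text \<open>The conditions under which \<open>pmk f\<close> represents the family: consecutive
  members agree modulo p^(k+1), so they fix one sequence of digits, and members of low index vanish
  modulo p^(k+1), so the digits end far down. The argument of type \<open>itself\<close> fixes the
  prime.\<close>

definition coherent :: "'p::prime_card itself \<Rightarrow> (int \<Rightarrow> real) \<Rightarrow> bool" where
  "coherent _ f \<longleftrightarrow>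
     (\<exists>K. \<forall>k<K. [f k = 0] (rmod real CARD('p) powi (k + 1))) \<and>
     (\<forall>k. [f (k + 1) = f k] (rmod real CARD('p) powi (k + 1)))"

lemma coherent_ptrunc: "coherent TYPE('p) (ptrunc (x::'p::prime_card padic))"
  unfolding coherent_def
proof
  obtain K where K: "\<forall>k<K. digit x k = 0"
    using digit_low by blast
  show "\<exists>K. \<forall>k<K. [ptrunc x k = 0] (rmod real CARD('p) powi (k + 1))"
  proof (intro exI[of _ K] allI impI)
    fix k assume "k < K"
    then have "ptrunc x k = 0"
      using K by (intro ptrunc_low) auto
    then show "[ptrunc x k = 0] (rmod real CARD('p) powi (k + 1))"
      by simp
  qed
  show "\<forall>k. [ptrunc x (k + 1) = ptrunc x k] (rmod real CARD('p) powi (k + 1))"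
    unfolding ptrunc_step rcong_altdef
    by (intro allI exI[of _ "- int (digit x (_ + 1))"]) simp
qed

lemma coherent_add:
  assumes "coherent TYPE('p::prime_card) f" "coherent TYPE('p) g"
  shows "coherent TYPE('p) (\<lambda>k. f k + g k)"
proof -
  obtain K K' where
    "\<forall>k<K. [f k = 0] (rmod real CARD('p) powi (k + 1))"
    "\<forall>k<K'. [g k = 0] (rmod real CARD('p) powi (k + 1))"
    using assms unfolding coherent_def by blast
  then have "\<forall>k<min K K'. [f k + g k = 0 + 0] (rmod real CARD('p) powi (k + 1))"
    by (auto intro!: rcong_add[where b=0 and d=0, simplified])
  then have "\<exists>K. \<forall>k<K. [f k + g k = 0] (rmod real CARD('p) powi (k + 1))"
    unfolding add_0_right by blast
  with assms show ?thesis
    unfolding coherent_def by (auto intro: rcong_add)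
qed

lemma coherent_uminus:
  assumes "coherent TYPE('p::prime_card) f"
  shows "coherent TYPE('p) (\<lambda>k. - f k)"
  using assms unfolding coherent_def
  by (metis minus_zero rcong_uminus_uminus_iff)

lemma coherent_diff:
  assumes "coherent TYPE('p::prime_card) f" "coherent TYPE('p) g"
  shows "coherent TYPE('p) (\<lambda>k. f k - g k)"
  using coherent_add[OF assms(1) coherent_uminus[OF assms(2)]] by simp

lemma digit_pmk:
  assumes "coherent TYPE('p::prime_card) f"
  shows "digit (pmk f :: 'p padic) k = nat (\<lfloor>f k / real CARD('p) powi k\<rfloor> mod int CARD('p))"
proof -
  obtain K where K: "\<forall>k<K. [f k = 0] (rmod real CARD('p) powi (k + 1))"
    using assms unfolding coherent_def by blast
  show ?thesis
    unfolding pmk_def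
  proof (rule digit_Abs)
    fix k
    have "\<lfloor>f k / real CARD('p) powi k\<rfloor> mod int CARD('p) < int CARD('p)"
      using card_gt_1[where ?'p='p] by simp
    then show "nat (\<lfloor>f k / real CARD('p) powi k\<rfloor> mod int CARD('p)) < CARD('p)"
      using card_gt_1[where ?'p='p] by (simp add: nat_less_iff)
  next
    fix k assume "k < K"
    then obtain z where z: "f k = of_int z * real CARD('p) powi (k + 1)"
      using K by (metis rcong_altdef rcong_sym add_0)
    have "f k / real CARD('p) powi k = of_int (z * int CARD('p))"
      unfolding z base_powi_Suc by simp
    then show "nat (\<lfloor>f k / real CARD('p) powi k\<rfloor> mod int CARD('p)) = 0"
      by (simp only: floor_of_int) simp
  qed
qed

text \<open>Going up one index, f (k+1) is the truncation at k plus z p^(k+1), up to nothing else.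
  The truncation lies in [0, p^(k+1)), so the floor taken by \<open>pmk\<close> is exactly z, and
  reducing z modulo p changes the value by a multiple of p^(k+2).\<close>

lemma ptrunc_pmk:
  assumes "coherent TYPE('p::prime_card) f"
  shows "[ptrunc (pmk f :: 'p padic) k = f k] (rmod real CARD('p) powi (k + 1))"
proof -
  let ?x = "pmk f :: 'p padic"
  obtain K where K: "\<forall>k<K. [f k = 0] (rmod real CARD('p) powi (k + 1))"
    using assms unfolding coherent_def by blast
  obtain K' where K': "\<forall>k<K'. digit ?x k = 0"
    using digit_low by blast
  show ?thesis
  proof (induction k rule: int_induct_from_low[where K="min K K'"])
    case (1 k)
    then have "ptrunc ?x k = 0"
      using K' by (intro ptrunc_low) auto
    then show ?case
      using K 1 by (simp add: rcong_sym)
  next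
    case (2 k)
    let ?q = "real CARD('p) powi (k + 1)"
    have "[ptrunc ?x k = f (k + 1)] (rmod ?q)"
    proof (rule rcong_trans[OF 2 rcong_sym])
      show "[f (k + 1) = f k] (rmod ?q)"
        using assms unfolding coherent_def by blast
    qed
    then obtain z where z: "f (k + 1) = ptrunc ?x k + of_int z * ?q"
      unfolding rcong_altdef by blast
    have "ptrunc ?x k / ?q < 1" "0 \<le> ptrunc ?x k / ?q"
      using ptrunc_less[of ?x k] ptrunc_nonneg[of ?x k]
      by (simp_all add: divide_less_eq)
    moreover have "f (k + 1) / ?q = ptrunc ?x k / ?q + of_int z"
      unfolding z using base_powi_pos[of "k + 1", where ?'p='p]
      by (simp add: add_divide_distrib del: base_powi_pos)
    ultimately have "\<lfloor>f (k + 1) / ?q\<rfloor> = z"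
      by linarith
    then have d: "real (digit ?x (k + 1)) = of_int (z mod int CARD('p))"
      unfolding digit_pmk[OF assms] using card_gt_1[where ?'p='p] by simp
    have "of_int z * ?q = of_int (z mod int CARD('p)) * ?q
        + of_int (z div int CARD('p)) * (real CARD('p) * ?q)"
    proof -
      have "real_of_int z = of_int (z mod int CARD('p)) + of_int (z div int CARD('p)) * real CARD('p)"
        using arg_cong[OF mod_mult_div_eq[of z "int CARD('p)"], of real_of_int]
        unfolding of_int_add of_int_mult of_int_of_nat_eq by (simp only: mult.commute)
      then show ?thesis
        by (simp add: algebra_simps)
    qed
    then have "f (k + 1) = ptrunc ?x (k + 1) + of_int (z div int CARD('p)) * real CARD('p) powi (k + 1 + 1)"
      unfolding base_powi_Suc[of "k + 1"] ptrunc_step d z by simp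
    then show ?case
      unfolding rcong_altdef by blast
  qed
qed

lemma digit_conv_ptrunc:
  "digit (x::'p::prime_card padic) k = nat \<lfloor>ptrunc x k / real CARD('p) powi k\<rfloor>"
proof -
  let ?q = "real CARD('p) powi k"
  have "ptrunc x k = ptrunc x (k - 1) + real (digit x k) * ?q"
    using ptrunc_step[of x "k - 1"] by simp
  moreover have "0 \<le> ptrunc x (k - 1)" "ptrunc x (k - 1) < ?q"
    using ptrunc_nonneg ptrunc_less[of x "k - 1"] by auto
  ultimately have "\<lfloor>ptrunc x k / ?q\<rfloor> = int (digit x k)"
    by (simp add: floor_eq_iff add_divide_distrib divide_less_eq)
  then show ?thesis by simp
qed

lemma rcong_range_imp_eq:
  assumes "[a = b] (rmod m)" "0 \<le> a" "a < m" "0 \<le> b" "b < m"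
  shows "a = b"
  by (rule rcong_imp_eq[OF assms(1)]) (use assms(2-) in auto)

text \<open>A truncation is the representative of its class in [0, p^(k+1)). Identities between
  p-adic numbers can therefore be verified as real congruences, and exactness comes for
  free.\<close>

lemma ptrunc_eq_iff_rcong:
  "ptrunc (x::'p::prime_card padic) k = ptrunc y k \<longleftrightarrow>
     [ptrunc x k = ptrunc (y::'p padic) k] (rmod real CARD('p) powi (k + 1))"
  using rcong_range_imp_eq[OF _ ptrunc_nonneg ptrunc_less ptrunc_nonneg ptrunc_less, of x k y] by auto

lemma padic_eqI:
  assumes "\<And>k. [ptrunc x k = ptrunc y k] (rmod real CARD('p) powi (k + 1))"
  shows "x = (y :: 'p::prime_card padic)"
  using assms unfolding padic_eq_iff digit_conv_ptrunc
  by (metis ptrunc_eq_iff_rcong)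

lemma ptrunc_eq_iff_digit:
  "ptrunc x k = ptrunc y k \<longleftrightarrow> (\<forall>j\<le>k. digit x j = digit y j)"
  for x y :: "'p::prime_card padic"
proof
  assume "\<forall>j\<le>k. digit x j = digit y j"
  then show "ptrunc x k = ptrunc y k"
    unfolding ptrunc_def by (intro sum.cong) auto
next
  assume eq: "ptrunc x k = ptrunc y k"
  show "\<forall>j\<le>k. digit x j = digit y j"
  proof (intro allI impI)
    fix j assume "j \<le> k"
    have "ptrunc x j = ptrunc y j"
      using \<open>j \<le> k\<close>
    proof (induction j rule: int_le_induct)
      case base then show ?case by (rule eq)
    next
      case (step i)
      have step_cong: "[ptrunc z (i - 1 + 1) = ptrunc z (i - 1)] (rmod real CARD('p) powi (i - 1 + 1))"
        for z :: "'p padic"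
        using coherent_ptrunc[of z] unfolding coherent_def by blast
      show ?case
        unfolding ptrunc_eq_iff_rcong[of x "i - 1" y]
        using rcong_trans[OF rcong_sym[OF step_cong[of x]]] step_cong[of y] step.IH
        by simp
    qed
    then show "digit x j = digit y j"
      by (simp add: digit_conv_ptrunc)
  qed
qed

lemma ptrunc_pzero [simp]: "ptrunc pzero k = 0"
  by (rule ptrunc_low) simp

lemma ptrunc_padd:
  "[ptrunc (padd x y) k = ptrunc x k + ptrunc (y::'p::prime_card padic) k] (rmod real CARD('p) powi (k + 1))"
  unfolding padd_def by (intro ptrunc_pmk coherent_add coherent_ptrunc)

lemma ptrunc_psub:
  "[ptrunc (psub x y) k = ptrunc x k - ptrunc (y::'p::prime_card padic) k] (rmod real CARD('p) powi (k + 1))"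
  unfolding psub_def by (intro ptrunc_pmk coherent_diff coherent_ptrunc)

instantiation padic :: (prime_card) ab_group_add
begin

definition zero_padic_def: "0 = pzero"
definition plus_padic_def: "x + y = padd x y"
definition minus_padic_def: "x - y = psub x y"
definition uminus_padic_def: "- (x::'a padic) = psub pzero x"

instance
proof
  fix x y z :: "'a padic"
  show "x + y + z = x + (y + z)"
    unfolding plus_padic_def
  proof (rule padic_eqI)
    fix k
    have "[ptrunc (padd (padd x y) z) k = ptrunc x k + ptrunc y k + ptrunc z k] (rmod real CARD('a) powi (k + 1))"
      by (rule rcong_trans[OF ptrunc_padd]) (intro rcong_add ptrunc_padd rcong_refl)
    also have "[ptrunc x k + ptrunc y k + ptrunc z k = ptrunc x k + ptrunc (padd y z) k] (rmod real CARD('a) powi (k + 1))"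
      unfolding add.assoc by (intro rcong_add rcong_sym[OF ptrunc_padd] rcong_refl)
    also have "[ptrunc x k + ptrunc (padd y z) k = ptrunc (padd x (padd y z)) k] (rmod real CARD('a) powi (k + 1))"
      by (rule rcong_sym[OF ptrunc_padd])
    finally show "[ptrunc (padd (padd x y) z) k = ptrunc (padd x (padd y z)) k] (rmod real CARD('a) powi (k + 1))" .
  qed
  show "x + y = y + x"
    unfolding plus_padic_def padd_def by (simp add: add.commute)
  show "0 + x = x"
    unfolding plus_padic_def zero_padic_def
    by (rule padic_eqI) (use ptrunc_padd[of pzero x] in simp)
  show "- x + x = 0"
    unfolding plus_padic_def zero_padic_def uminus_padic_def
  proof (rule padic_eqI)
    fix k
    have "[ptrunc (padd (psub pzero x) x) k = ptrunc (psub pzero x) k + ptrunc x k] (rmod real CARD('a) powi (k + 1))"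
      by (rule ptrunc_padd)
    also have "[ptrunc (psub pzero x) k + ptrunc x k = (ptrunc (pzero::'a padic) k - ptrunc x k) + ptrunc x k] (rmod real CARD('a) powi (k + 1))"
      by (rule rcong_add[OF ptrunc_psub rcong_refl])
    finally show "[ptrunc (padd (psub pzero x) x) k = ptrunc (pzero::'a padic) k] (rmod real CARD('a) powi (k + 1))"
      by simp
  qed
  show "x - y = x + - y"
    unfolding plus_padic_def uminus_padic_def minus_padic_def
  proof (rule padic_eqI)
    fix k
    have "[ptrunc (padd x (psub pzero y)) k = ptrunc x k + ptrunc (psub pzero y) k] (rmod real CARD('a) powi (k + 1))"
      by (rule ptrunc_padd)
    also have "[ptrunc x k + ptrunc (psub pzero y) k = ptrunc x k + (ptrunc (pzero::'a padic) k - ptrunc y k)] (rmod real CARD('a) powi (k + 1))"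
      by (intro rcong_add ptrunc_psub rcong_refl)
    also have "[ptrunc x k + (ptrunc (pzero::'a padic) k - ptrunc y k) = ptrunc (psub x y) k] (rmod real CARD('a) powi (k + 1))"
      using rcong_sym[OF ptrunc_psub[of x y k]] by simp
    finally show "[ptrunc (psub x y) k = ptrunc (padd x (psub pzero y)) k] (rmod real CARD('a) powi (k + 1))"
      by (rule rcong_sym)
  qed
qed

end

lemmas ptrunc_add = ptrunc_padd[folded plus_padic_def]
lemmas ptrunc_diff = ptrunc_psub[folded minus_padic_def]

lemma padic_group_folds [simp]:
  "padd x y = x + y" "psub x y = x - y" "pzero = (0 :: 'p::prime_card padic)"
  by (simp_all add: plus_padic_def minus_padic_def zero_padic_def)

lemma digit_zero [simp]: "digit (0 :: 'p::prime_card padic) k = 0"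
  unfolding zero_padic_def by (rule digit_pzero)

lemma ptrunc_zero [simp]: "ptrunc (0::'p::prime_card padic) k = 0"
  by (rule ptrunc_low) simp

lemma digit_pscale [simp]: "digit (pscale s x) k = digit (x::'p::prime_card padic) (k - s)"
proof -
  obtain K where K: "\<forall>k<K. digit x k = 0"
    using digit_low by blast
  show ?thesis
    unfolding pscale_def by (rule digit_Abs[where K="K + s"]) (use K digit_less in auto)
qed

lemma ptrunc_pscale:
  "ptrunc (pscale s x) k = real CARD('p) powi s * ptrunc (x::'p::prime_card padic) (k - s)"
proof -
  have eq: "{j. j \<le> k \<and> digit (pscale s x) j \<noteq> 0} = (\<lambda>j. j + s) ` {j. j \<le> k - s \<and> digit x j \<noteq> 0}"
    by (auto simp: image_iff intro!: exI[of _ "_ - s"])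
  have "inj_on (\<lambda>j. j + s) {j. j \<le> k - s \<and> digit x j \<noteq> 0}"
    by (auto simp: inj_on_def)
  then show ?thesis
    unfolding ptrunc_def eq
    by (simp add: sum.reindex sum_distrib_left base_powi_add mult_ac)
qed

lemma pscale_add: "pscale s (x + y) = pscale s x + pscale s (y::'p::prime_card padic)"
proof (rule padic_eqI)
  fix k
  let ?q = "\<lambda>k. real CARD('p) powi k"
  have m: "?q (k + 1) = ?q s * ?q (k - s + 1)"
    by (simp flip: base_powi_add add: algebra_simps)
  have "[ptrunc (pscale s (x + y)) k = ?q s * (ptrunc x (k - s) + ptrunc y (k - s))] (rmod ?q (k + 1))"
    unfolding ptrunc_pscale m by (intro rcong_mult_left ptrunc_add)
  also have "[?q s * (ptrunc x (k - s) + ptrunc y (k - s)) = ptrunc (pscale s x + pscale s y) k] (rmod ?q (k + 1))"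
    using rcong_sym[OF ptrunc_add[of "pscale s x" "pscale s y" k]]
    by (simp add: ptrunc_pscale distrib_left)
  finally show "[ptrunc (pscale s (x + y)) k = ptrunc (pscale s x + pscale s y) k] (rmod ?q (k + 1))" .
qed

lemma pscale_zero [simp]: "pscale s 0 = (0::'p::prime_card padic)"
  by (simp add: padic_eq_iff)

lemma pscale_0_left [simp]: "pscale 0 x = (x::'p::prime_card padic)"
  by (simp add: padic_eq_iff)

lemma pscale_pscale [simp]: "pscale s (pscale t x) = pscale (s + t) (x::'p::prime_card padic)"
  by (simp add: padic_eq_iff diff_diff_eq)

lemma pscale_diff: "pscale s (x - y) = pscale s x - pscale s (y::'p::prime_card padic)"
  using pscale_add[of s "x - y" y] by (simp add: algebra_simps)

text \<open>The p-adic number i / p^K. One notation serves for the sample points n / p^N, the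
  frequencies l / p^M, the translations k / p^N and, with negative K, the period p^M.\<close>

definition pgrid :: "int \<Rightarrow> int \<Rightarrow> 'p::prime_card padic" where
  "pgrid K i = pmk (\<lambda>_. of_int i * real CARD('p) powi (- K))"

lemma coherent_const: "coherent TYPE('p::prime_card) (\<lambda>_. of_int i * real CARD('p) powi K)"
proof -
  have "[of_int i * real CARD('p) powi K = 0] (rmod real CARD('p) powi (k + 1))" if "k < K" for k
    by (rule rcong_powi_mono[where j=K]) (use that in \<open>auto intro: rcong_intros\<close>)
  then show ?thesis
    unfolding coherent_def by auto
qed

lemma ptrunc_pgrid:
  "[ptrunc (pgrid K i :: 'p::prime_card padic) k = of_int i * real CARD('p) powi (- K)]
     (rmod real CARD('p) powi (k + 1))"
  unfolding pgrid_def by (intro ptrunc_pmk coherent_const)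

lemma pgrid_eqI:
  assumes "\<And>k. [ptrunc x k = of_int i * real CARD('p) powi (- K)] (rmod real CARD('p) powi (k + 1))"
  shows "x = (pgrid K i :: 'p::prime_card padic)"
  by (intro padic_eqI rcong_trans[OF assms rcong_sym[OF ptrunc_pgrid]])

lemma pgrid_add: "pgrid K (i + j) = pgrid K i + (pgrid K j :: 'p::prime_card padic)"
  by (rule pgrid_eqI[symmetric])
    (simp add: distrib_right, intro rcong_trans[OF ptrunc_add] rcong_add ptrunc_pgrid)

lemma pgrid_0 [simp]: "pgrid K 0 = (0::'p::prime_card padic)"
  by (rule pgrid_eqI[symmetric]) simp

lemma pgrid_diff: "pgrid K (i - j) = pgrid K i - (pgrid K j :: 'p::prime_card padic)"
  using pgrid_add[of K "i - j" j, where ?'p='p] by (simp add: algebra_simps)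

lemma pscale_pgrid [simp]: "pscale s (pgrid K i) = (pgrid (K - s) i :: 'p::prime_card padic)"
proof (rule pgrid_eqI)
  fix k
  let ?q = "\<lambda>k. real CARD('p) powi k"
  have m: "?q (k + 1) = ?q s * ?q (k - s + 1)" "?q (- (K - s)) = ?q s * ?q (- K)"
    by (simp_all flip: base_powi_add add: algebra_simps)
  have "[?q s * ptrunc (pgrid K i :: 'p padic) (k - s) = ?q s * (of_int i * ?q (- K))] (rmod ?q (k + 1))"
    unfolding m(1) by (intro rcong_mult_left ptrunc_pgrid)
  then show "[ptrunc (pscale s (pgrid K i :: 'p padic)) k = of_int i * ?q (- (K - s))] (rmod ?q (k + 1))"
    unfolding ptrunc_pscale m(2) by (simp add: mult_ac)
qed

lemma pgrid_refine:
  "pgrid (K + int t) (int CARD('p) ^ t * i) = (pgrid K i :: 'p::prime_card padic)"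
proof -
  have "real CARD('p) ^ t * real CARD('p) powi (- (K + int t)) = real CARD('p) powi (- K)"
    by (simp flip: power_int_of_nat base_powi_add)
  then show ?thesis
    unfolding pgrid_def by (simp add: mult_ac)
qed

lemma floor_of_nat_div: "\<lfloor>real n / real CARD('p::prime_card) ^ m\<rfloor> = int (n div CARD('p) ^ m)"
  by (metis floor_divide_of_nat_eq of_nat_power)

lemma pnat_eq_pgrid: "pnat n = (pgrid 0 (int n) :: 'p::prime_card padic)"
proof -
  have "digit (pnat n :: 'p padic) k = digit (pgrid 0 (int n) :: 'p padic) k" for k
  proof -
    have "digit (pnat n :: 'p padic) k = (if k < 0 then 0 else (n div CARD('p) ^ nat k) mod CARD('p))"
      unfolding pnat_def by (rule digit_Abs[where K=0]) (use card_gt_1[where ?'p='p] in auto)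
    moreover have "digit (pgrid 0 (int n) :: 'p padic) k = nat (\<lfloor>real n / real CARD('p) powi k\<rfloor> mod int CARD('p))"
      unfolding pgrid_def using coherent_const[of "int n" 0, where ?'p='p] by (subst digit_pmk) simp_all
    moreover have "nat (\<lfloor>real n / real CARD('p) powi k\<rfloor> mod int CARD('p)) = 0" if "k < 0"
    proof -
      have "real n / real CARD('p) powi k = real n * real CARD('p) powi (- k)"
        by (simp add: power_int_minus divide_inverse)
      also have "real CARD('p) powi (- k) = real CARD('p) powi (-k - 1) * real CARD('p)"
        by (simp add: power_int_minus_mult)
      also have "real CARD('p) powi (-k - 1) = of_int (int CARD('p) ^ nat (-k - 1))"
        using that by (simp add: power_int_nonneg_exp)
      finally have "real n / real CARD('p) powi k
          = of_int (int n * int CARD('p) ^ nat (-k - 1) * int CARD('p))"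
        by simp
      then show ?thesis
        by (simp only: floor_of_int) simp
    qed
    moreover have "nat (\<lfloor>real n / real CARD('p) powi k\<rfloor> mod int CARD('p)) = (n div CARD('p) ^ nat k) mod CARD('p)"
      if "\<not> k < 0"
      using that by (simp add: power_int_nonneg_exp floor_of_nat_div nat_mod_distrib)
    ultimately show ?thesis by simp
  qed
  then show ?thesis
    by (simp add: padic_eq_iff)
qed

section \<open>Balls\<close>

text \<open>Presents a ball as a class of an equivalence relation. This is the ultrametric property:
  every point is a centre, and balls that meet are nested.\<close>

lemma mem_pball_ptrunc: "x \<in> pball g a \<longleftrightarrow> ptrunc x (- g - 1) = ptrunc (a::'p::prime_card padic) (- g - 1)"
proof -
  have eq: "- g - 1 + 1 = - g" by simp
  have "x \<in> pball g a \<longleftrightarrow> (\<forall>k\<le>- g - 1. digit (x - a) k = digit (0::'p padic) k)"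
    by (auto simp: pball_def)
  also have "\<dots> \<longleftrightarrow> ptrunc (x - a) (- g - 1) = ptrunc (0::'p padic) (- g - 1)"
    by (rule ptrunc_eq_iff_digit[symmetric])
  also have "\<dots> \<longleftrightarrow> [ptrunc (x - a) (- g - 1) = 0] (rmod real CARD('p) powi (- g))"
    unfolding ptrunc_eq_iff_rcong eq by simp
  also have "\<dots> \<longleftrightarrow> [ptrunc x (- g - 1) - ptrunc a (- g - 1) = 0] (rmod real CARD('p) powi (- g))"
    using ptrunc_diff[of x a "- g - 1", unfolded eq] rcong_sym rcong_trans by blast
  also have "\<dots> \<longleftrightarrow> ptrunc x (- g - 1) = ptrunc a (- g - 1)"
    unfolding ptrunc_eq_iff_rcong eq
    by (metis cancel_comm_monoid_add_class.diff_cancel rcong_diff_right_cancel)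
  finally show ?thesis .
qed

lemma mem_pball: "x \<in> pball g a \<longleftrightarrow> (\<forall>k < - g. digit x k = digit (a::'p::prime_card padic) k)"
  unfolding mem_pball_ptrunc ptrunc_eq_iff_digit by auto

lemma mem_pball_iff_diff: "x \<in> pball g a \<longleftrightarrow> x - a \<in> pball g (0::'p::prime_card padic)"
  by (simp add: pball_def)

lemma pball_self [simp]: "a \<in> pball g (a::'p::prime_card padic)"
  by (simp add: mem_pball)

lemma pball_eq: "x \<in> pball g a \<Longrightarrow> pball g x = pball g (a::'p::prime_card padic)"
  by (auto simp: mem_pball)

lemma pball_mono: "g \<le> h \<Longrightarrow> pball g a \<subseteq> pball h (a::'p::prime_card padic)"
  by (auto simp: mem_pball)

lemma pball_translate [simp]: "x + c \<in> pball g (a + c) \<longleftrightarrow> x \<in> pball g (a::'p::prime_card padic)"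
  by (subst (1 2) mem_pball_iff_diff) simp

lemma pball_translate_diff: "x - c \<in> pball g a \<longleftrightarrow> x \<in> pball g (a + c::'p::prime_card padic)"
  by (subst (1 2) mem_pball_iff_diff) (simp add: algebra_simps)

lemma pball_zero_add:
  assumes "x \<in> pball g 0" "y \<in> pball g (0::'p::prime_card padic)"
  shows "x + y \<in> pball g 0"
  using pball_translate[of x y g 0] pball_eq[OF assms(2)] assms(1) by simp

lemma pball_sym: "x \<in> pball g a \<longleftrightarrow> a \<in> pball g (x::'p::prime_card padic)"
  by (auto simp: mem_pball)

lemma pball_zero_uminus: "- x \<in> pball g 0 \<longleftrightarrow> x \<in> pball g (0::'p::prime_card padic)"
  using pball_translate[of "- x" x g 0] pball_sym[of 0 g x] by simp

lemma pball_zero_diff: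
  "x \<in> pball g 0 \<Longrightarrow> y \<in> pball g 0 \<Longrightarrow> x - y \<in> pball g (0::'p::prime_card padic)"
  using pball_zero_add[of x g "- y"] by (simp add: pball_zero_uminus)

lemma pball_pscale [simp]: "pscale s x \<in> pball g (pscale s a) \<longleftrightarrow> x \<in> pball (g + s) (a::'p::prime_card padic)"
proof
  assume *: "pscale s x \<in> pball g (pscale s a)"
  show "x \<in> pball (g + s) a"
    unfolding mem_pball
  proof (intro allI impI)
    fix k assume "k < - (g + s)"
    then show "digit x k = digit a k"
      using *[unfolded mem_pball digit_pscale, rule_format, of "k + s"] by simp
  qed
qed (auto simp: mem_pball)

lemma pball_zero_pscale [simp]: "pscale s x \<in> pball g 0 \<longleftrightarrow> x \<in> pball (g + s) (0::'p::prime_card padic)"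
  using pball_pscale[of s x g 0] by simp

lemma pgrid_in_pball [simp]: "pgrid K i \<in> pball K (0::'p::prime_card padic)"
proof -
  have "[ptrunc (pgrid K i :: 'p padic) (- K - 1) = ptrunc (0 :: 'p padic) (- K - 1)]
      (rmod real CARD('p) powi (- K - 1 + 1))"
    using rcong_trans[OF ptrunc_pgrid[of K i "- K - 1", where ?'p='p], of 0]
    by (simp add: rcong_intros)
  then show ?thesis
    unfolding mem_pball_ptrunc ptrunc_eq_iff_rcong .
qed

text \<open>The dictionary between balls and divisibility. It separates the sample points and later
  decides which terms of a refinement sum survive.\<close>

lemma pgrid_in_pball_iff:
  "pgrid (g + int m) i \<in> pball g (0::'p::prime_card padic) \<longleftrightarrow> int CARD('p) ^ m dvd i"
proof
  assume "int CARD('p) ^ m dvd i"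
  then obtain j where "i = int CARD('p) ^ m * j" ..
  then show "pgrid (g + int m) i \<in> pball g (0::'p padic)"
    by (simp add: pgrid_refine)
next
  assume "pgrid (g + int m) i \<in> pball g (0::'p padic)"
  then have "ptrunc (pgrid (g + int m) i :: 'p padic) (- g - 1) = 0"
    unfolding mem_pball_ptrunc by simp
  then have "[0 = of_int i * real CARD('p) powi (- (g + int m))] (rmod real CARD('p) powi (- g))"
    using ptrunc_pgrid[of "g + int m" i "- g - 1", where ?'p='p] by simp
  then obtain z where z: "of_int i * real CARD('p) powi (- (g + int m)) = of_int z * real CARD('p) powi (- g)"
    unfolding rcong_altdef by auto
  have "of_int i = of_int i * real CARD('p) powi (- (g + int m)) * real CARD('p) powi (g + int m)"
    by (simp add: mult.assoc flip: base_powi_add)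
  also have "\<dots> = of_int z * real CARD('p) powi (int m)"
    unfolding z by (simp add: mult.assoc flip: base_powi_add)
  also have "\<dots> = of_int (int CARD('p) ^ m * z)"
    by simp
  finally show "int CARD('p) ^ m dvd i"
    by (simp only: of_int_eq_iff) simp
qed

lemma ptrunc_eq_multiple:
  assumes "\<And>j. j < K \<Longrightarrow> digit (x::'p::prime_card padic) j = 0"
  shows "\<exists>n::nat. ptrunc x k = real n * real CARD('p) powi K"
proof (induction k rule: int_induct_from_low[where K=K])
  case (1 k)
  then show ?case
    using assms by (intro exI[of _ 0]) (simp add: ptrunc_low)
next
  case (2 k)
  then obtain n where n: "ptrunc x k = real n * real CARD('p) powi K" ..
  show ?case
  proof (cases "k + 1 < K")
    case True
    then show ?thesis
      using assms by (intro exI[of _ 0]) (simp add: ptrunc_low)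
  next
    case False
    then have "real CARD('p) powi (k + 1) = real (CARD('p) ^ nat (k + 1 - K)) * real CARD('p) powi K"
      by (simp flip: power_int_nonneg_exp base_powi_add)
    then have "ptrunc x (k + 1) = real (n + digit x (k + 1) * CARD('p) ^ nat (k + 1 - K)) * real CARD('p) powi K"
      unfolding ptrunc_step n by (simp add: algebra_simps)
    then show ?thesis ..
  qed
qed

text \<open>The index n is the truncation of x below index H, measured in units of p^(-G); it is
  less than p^(G+H) because the truncation is less than p^H.\<close>

lemma pball_grid_ex:
  assumes "x \<in> pball G (0::'p::prime_card padic)" "0 \<le> G + H"
  obtains n where "n < CARD('p) ^ nat (G + H)" "x \<in> pball (- H) (pgrid G (int n))"
    "ptrunc x (H - 1) = real n * real CARD('p) powi (- G)"
proof -
  obtain n :: nat where n: "ptrunc x (H - 1) = real n * real CARD('p) powi (- G)"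
    using ptrunc_eq_multiple[of "- G" x "H - 1"] assms(1) by (auto simp: mem_pball)
  have "real n * real CARD('p) powi (- G) < real CARD('p) powi H"
    using ptrunc_less[of x "H - 1"] n by simp
  also have "real CARD('p) powi H = real (CARD('p) ^ nat (G + H)) * real CARD('p) powi (- G)"
    using assms(2) by (simp flip: power_int_nonneg_exp base_powi_add)
  finally have "real n < real (CARD('p) ^ nat (G + H))"
    by (subst (asm) mult_less_cancel_right_pos) auto
  then have "n < CARD('p) ^ nat (G + H)"
    by (simp only: of_nat_less_iff)
  moreover have "x \<in> pball (- H) (pgrid G (int n))"
    unfolding mem_pball_ptrunc ptrunc_eq_iff_rcong
    using rcong_sym[OF ptrunc_pgrid[of G "int n" "- (- H) - 1", where ?'p='p]] n by simp
  ultimately show ?thesis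
    using that n by blast
qed

section \<open>The elements of I_p as fractions n / p^K\<close>

lemma Ip_iff_ptrunc: "a \<in> Ip \<longleftrightarrow> (\<forall>k\<ge>-1. ptrunc (a::'p::prime_card padic) k = ptrunc a (-1))"
proof
  assume a: "a \<in> Ip"
  show "\<forall>k\<ge>-1. ptrunc a k = ptrunc a (-1)"
  proof (intro allI impI)
    fix k :: int assume "-1 \<le> k"
    then show "ptrunc a k = ptrunc a (-1)"
      by (induction k rule: int_ge_induct) (use a in \<open>auto simp: Ip_def ptrunc_step\<close>)
  qed
next
  assume eq: "\<forall>k\<ge>-1. ptrunc a k = ptrunc a (-1)"
  show "a \<in> Ip"
    unfolding Ip_def
  proof (intro CollectI allI impI)
    fix k :: int assume "0 \<le> k"
    then show "digit a k = 0"
      using ptrunc_step[of a "k - 1"] eq[rule_format, of k] eq[rule_format, of "k - 1"]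
      by (simp add: less_imp_neq[OF base_pos, symmetric])
  qed
qed

text \<open>A fraction in [0, 1) equals its own truncation at every index from -1 on, because the
  modulus p^(k+1) is at least 1 there.\<close>

lemma pgrid_in_Ip:
  assumes "n < CARD('p) ^ K"
  shows "pgrid (int K) (int n) \<in> (Ip :: 'p::prime_card padic set)"
proof -
  let ?r = "real n * real CARD('p) powi (- int K)"
  have "real n < real (CARD('p) ^ K)"
    using assms by (simp only: of_nat_less_iff)
  then have "?r < real (CARD('p) ^ K) * real CARD('p) powi (- int K)"
    by (intro mult_strict_right_mono) auto
  also have "\<dots> = 1"
    by (simp add: power_int_minus)
  finally have r: "0 \<le> ?r" "?r < 1"
    using less_imp_le[OF base_powi_pos[of "- int K", where ?'p='p]] by simp_all
  have "ptrunc (pgrid (int K) (int n) :: 'p padic) k = ?r" if "-1 \<le> k" for k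
  proof (rule rcong_range_imp_eq)
    show "[ptrunc (pgrid (int K) (int n) :: 'p padic) k = ?r] (rmod real CARD('p) powi (k + 1))"
      using ptrunc_pgrid[of "int K" "int n" k, where ?'p='p] by simp
    have "1 \<le> real CARD('p) powi (k + 1)"
      using that less_imp_le[OF base_gt_1[where ?'p='p]] by (simp add: power_int_nonneg_exp)
    then show "?r < real CARD('p) powi (k + 1)"
      using r by linarith
  qed (use r ptrunc_nonneg ptrunc_less in auto)
  then show ?thesis
    by (simp add: Ip_iff_ptrunc)
qed

lemma Ip_grid_ex:
  assumes "a \<in> Ip" "a \<in> pball (int K) (0::'p::prime_card padic)"
  obtains n where "n < CARD('p) ^ K" "a = pgrid (int K) (int n)"
proof -
  \<comment> \<open>With H = 0 the two numbers share all negative digits, and elements of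
    \<open>Ip\<close> have no others.\<close>
  obtain n where n: "n < CARD('p) ^ nat (int K + 0)" "a \<in> pball (- 0) (pgrid (int K) (int n))"
      "ptrunc a (0 - 1) = real n * real CARD('p) powi (- int K)"
    using pball_grid_ex[OF assms(2), of 0] by auto
  have "a = pgrid (int K) (int n)"
    unfolding padic_eq_iff
  proof
    fix k
    show "digit a k = digit (pgrid (int K) (int n) :: 'p padic) k"
    proof (cases "k < 0")
      case True
      then show ?thesis
        using n(2) by (simp add: mem_pball)
    next
      case False
      then show ?thesis
        using assms(1) pgrid_in_Ip[of n K, where ?'p='p] n(1) by (simp add: Ip_def)
    qed
  qed
  then show ?thesis
    using n(1) that by simp
qed

lemma pball_exhaust: "\<exists>G::nat. x \<in> pball (int G) (0::'p::prime_card padic)"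
proof -
  obtain K where K: "\<forall>k<K. digit x k = 0"
    using digit_low by blast
  then show ?thesis
    by (intro exI[of _ "nat (- K)"]) (auto simp: mem_pball)
qed

text \<open>The bound p^(K-N) on n confines the digits of n / p^K to indices below -N. Adding k /
  p^N with k < p^N then causes no carry, and the sum stays in \<open>Ip\<close>.\<close>

lemma Ip_decomposition:
  fixes c :: "'p::prime_card padic"
  obtains K n where "N \<le> K" "n < CARD('p) ^ (K - N)" "c - pgrid (int K) (int n) \<in> pball (int N) 0"
proof -
  obtain G :: nat where G: "c \<in> pball (int G) 0"
    using pball_exhaust by blast
  define K where "K = max G N"
  have "c \<in> pball (int K) 0"
    using G pball_mono[of "int G" "int K"] by (auto simp: K_def)
  then obtain n where "n < CARD('p) ^ nat (int K + - int N)" "c \<in> pball (- (- int N)) (pgrid (int K) (int n))"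
    using pball_grid_ex[of c "int K" "- int N"] by (auto simp: K_def)
  moreover have "nat (int K + - int N) = K - N"
    by simp
  ultimately show ?thesis
    using that[of K n] by (simp add: K_def flip: mem_pball_iff_diff)
qed

lemma zero_in_Ip: "0 \<in> (Ip :: 'p::prime_card padic set)"
  by (simp add: Ip_def)

section \<open>Haar measure\<close>

definition pballs :: "'p::prime_card padic set set" where
  "pballs = range (\<lambda>(g, a). pball g a)"

lemma pball_in_pballs [simp]: "pball g a \<in> pballs"
  unfolding pballs_def by auto

lemma pballsE:
  assumes "A \<in> pballs"
  obtains g a where "A = pball g a"
  using assms unfolding pballs_def by auto

lemma Int_pballs:
  assumes "A \<in> pballs" "B \<in> pballs"
  shows "A \<inter> B = {} \<or> A \<inter> B \<in> (pballs :: 'p::prime_card padic set set)"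
proof -
  have *: "pball g a \<inter> pball h b = {} \<or> pball g a \<inter> pball h b \<in> pballs"
    if "g \<le> h" for g h and a b :: "'p padic"
  proof (cases "pball g a \<inter> pball h b = {}")
    case False
    then obtain x where "x \<in> pball g a" "x \<in> pball h b" by blast
    then have "pball g a \<subseteq> pball h b"
      using pball_eq pball_mono[OF that, of x] by blast
    then show ?thesis
      by (simp add: inf.absorb1)
  qed simp
  obtain g a h b where "A = pball g a" "B = pball h b"
    using assms by (auto elim!: pballsE)
  then show ?thesis
    using *[of g h a b] *[of h g b a] by (cases "g \<le> h") (auto simp: Int_commute)
qed

lemma Int_stable_pballs: "Int_stable (insert {} (pballs :: 'p::prime_card padic set set))"
  unfolding Int_stable_def using Int_pballs by fast

lemma sigma_sets_insert_empty: "sigma_sets UNIV (insert {} S) = sigma_sets UNIV S"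
proof (rule sigma_sets_eqI)
  fix A assume "A \<in> insert {} S"
  then show "A \<in> sigma_sets UNIV S"
    by (auto intro: sigma_sets.intros)
qed (auto intro: sigma_sets.intros)

text \<open>Balls together with the empty set are an intersection-stable generator, and the balls
  B_i(0) exhaust the space, so finite values on balls determine a measure.\<close>

lemma measure_eqI_pballs:
  assumes M: "space M = UNIV" "sets M = sigma_sets UNIV pballs"
    and N: "sets N = sets M"
    and eq: "\<And>g a. emeasure M (pball g a) = emeasure N (pball g (a::'p::prime_card padic))"
    and fin: "\<And>g a. emeasure M (pball g a) \<noteq> \<infinity>"
  shows "M = N"
proof (rule measure_eqI_generator_eq[where E="insert {} pballs" and \<Omega>=UNIV and A="\<lambda>i. pball (int i) 0"])
  show "Int_stable (insert {} (pballs :: 'p padic set set))"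
    by (rule Int_stable_pballs)
  show "sets M = sigma_sets UNIV (insert {} pballs)" "sets N = sigma_sets UNIV (insert {} pballs)"
    using M N by (simp_all add: sigma_sets_insert_empty)
  show "emeasure M X = emeasure N X" if "X \<in> insert {} pballs" for X
    using that eq by (auto elim!: pballsE)
  show "(\<Union>i. pball (int i) 0) = (UNIV :: 'p padic set)"
    using pball_exhaust by auto
qed (use fin in auto)

text \<open>The expansion of a nonnegative real in base p, with digits reflected at the radix point:
  this is the inverse of the Monna map, and it turns Lebesgue measure into Haar measure.\<close>
definition monna :: "real \<Rightarrow> 'p::prime_card padic" where
  "monna t = Abs_padic (\<lambda>k. nat (\<lfloor>t * real CARD('p) powi (k + 1)\<rfloor> mod int CARD('p)))"

lemma low_powi_less_1:
  fixes t :: real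
  shows "\<exists>K. \<forall>k<K. t * real CARD('p::prime_card) powi k < 1"
proof -
  obtain n where n: "t < real CARD('p) ^ n"
    using real_arch_pow[OF base_gt_1[where ?'p='p]] by blast
  have "t * real CARD('p) powi k < 1" if "k < - int n" for k
  proof -
    have "t * real CARD('p) powi k < real CARD('p) ^ n * real CARD('p) powi k"
      by (intro mult_strict_right_mono n) simp
    also have "\<dots> = real CARD('p) powi (int n + k)"
      by (simp only: base_powi_add power_int_of_nat)
    also have "\<dots> \<le> real CARD('p) powi 0"
      using that less_imp_le[OF base_gt_1[where ?'p='p]] by (intro power_int_increasing) auto
    finally show ?thesis by simp
  qed
  then show ?thesis by blast
qed

text \<open>Digit k of the image is the digit of t at weight p^(-(k+1)). The shift by one makes [0,
  1) the preimage of B_0(0), which gives the normalisation to 1.\<close>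

lemma digit_monna:
  assumes "0 \<le> t"
  shows "digit (monna t :: 'p::prime_card padic) k = nat (\<lfloor>t * real CARD('p) powi (k + 1)\<rfloor> mod int CARD('p))"
proof -
  obtain K where K: "\<forall>k<K. t * real CARD('p) powi k < 1"
    using low_powi_less_1 by blast
  show ?thesis
    unfolding monna_def
  proof (rule digit_Abs[where K="K - 1"])
    show "nat (\<lfloor>t * real CARD('p) powi (k + 1)\<rfloor> mod int CARD('p)) < CARD('p)" for k
      using card_gt_1[where ?'p='p] by (simp add: nat_less_iff)
    fix k assume "k < K - 1"
    then have "t * real CARD('p) powi (k + 1) < 1"
      using K by simp
    moreover have "0 \<le> t * real CARD('p) powi (k + 1)"
      using assms by simp
    ultimately have "\<lfloor>t * real CARD('p) powi (k + 1)\<rfloor> = 0"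
      by linarith
    then show "nat (\<lfloor>t * real CARD('p) powi (k + 1)\<rfloor> mod int CARD('p)) = 0"
      by simp
  qed
qed

lemma floor_powi_div:
  "\<lfloor>t * real CARD('p::prime_card) powi (k + 1)\<rfloor> div int CARD('p) = \<lfloor>t * real CARD('p) powi k\<rfloor>"
proof -
  have "t * real CARD('p) powi k = t * real CARD('p) powi (k + 1) / real_of_int (int CARD('p))"
    unfolding base_powi_Suc by simp
  then show ?thesis
    by (simp only: floor_divide_real_eq_div)
qed

text \<open>Prescribing one more digit d refines floor (t p^k) = n to floor (t p^(k+1)) = n p + d.
  Below all digits of \<open>a\<close> the condition is n = 0. Hence the preimage of a ball is a
  single half-open interval, as long as the radius of the ball.\<close>

lemma monna_digits_iff:
  "\<exists>n::nat. \<forall>t\<ge>0. (\<forall>j<k. digit (monna t :: 'p padic) j = digit a j)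
     \<longleftrightarrow> \<lfloor>t * real CARD('p) powi k\<rfloor> = int n"
  for a :: "'p::prime_card padic"
proof -
  obtain K where K: "\<forall>k<K. digit a k = 0"
    using digit_low by blast
  have p: "0 < int CARD('p)"
    using card_gt_1[where ?'p='p] by simp
  show ?thesis
  proof (induction k rule: int_induct_from_low[where K=K])
    case (1 k)
    have "(\<forall>j<k. digit (monna t :: 'p padic) j = digit a j) \<longleftrightarrow> \<lfloor>t * real CARD('p) powi k\<rfloor> = int 0" if "0 \<le> t" for t
    proof
      assume "\<forall>j<k. digit (monna t :: 'p padic) j = digit a j"
      then have "digit (monna t :: 'p padic) j = 0" if "j < k" for j
        using that 1 K by simp
      then have z: "\<lfloor>t * real CARD('p) powi (j + 1)\<rfloor> mod int CARD('p) = 0" if "j < k" for j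
        using that pos_mod_sign[OF p, of "\<lfloor>t * real CARD('p) powi (j + 1)\<rfloor>"]
        unfolding digit_monna[OF \<open>0 \<le> t\<close>] by (metis nat_0_iff order_antisym)
      obtain K' where K': "\<forall>k<K'. t * real CARD('p) powi k < 1"
        using low_powi_less_1 by blast
      have "i \<le> k \<Longrightarrow> \<lfloor>t * real CARD('p) powi i\<rfloor> = 0" for i
      proof (induction i rule: int_induct_from_low[where K=K'])
        case (1 i)
        have "0 \<le> t * real CARD('p) powi i" using \<open>0 \<le> t\<close> by simp
        then show ?case using K' 1 by (simp add: floor_eq_iff)
      next
        case (2 i)
        then show ?case
          using z[of i] floor_powi_div[of t i, where ?'p='p]
            div_mult_mod_eq[of "\<lfloor>t * real CARD('p) powi (i + 1)\<rfloor>" "int CARD('p)"] by simp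
      qed
      then show "\<lfloor>t * real CARD('p) powi k\<rfloor> = int 0" by simp
    next
      assume *: "\<lfloor>t * real CARD('p) powi k\<rfloor> = int 0"
      have "digit (monna t :: 'p padic) j = 0" if "j < k" for j
      proof -
        have "t * real CARD('p) powi (j + 1) \<le> t * real CARD('p) powi k"
          using that \<open>0 \<le> t\<close> less_imp_le[OF base_gt_1[where ?'p='p]]
          by (intro mult_left_mono power_int_increasing) auto
        moreover have "0 \<le> t * real CARD('p) powi (j + 1)" using \<open>0 \<le> t\<close> by simp
        ultimately have "\<lfloor>t * real CARD('p) powi (j + 1)\<rfloor> = 0"
          using * by linarith
        then show ?thesis
          using digit_monna[OF \<open>0 \<le> t\<close>, where ?'p='p] by simp
      qed
      then show "\<forall>j<k. digit (monna t :: 'p padic) j = digit a j"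
        using K 1 by auto
    qed
    then show ?case
      by (intro exI[of _ 0] allI impI)
  next
    case (2 k)
    then obtain n :: nat where n: "\<forall>t\<ge>0. (\<forall>j<k. digit (monna t :: 'p padic) j = digit a j)
        \<longleftrightarrow> \<lfloor>t * real CARD('p) powi k\<rfloor> = int n" by (elim exE) (rule that)
    have "(\<forall>j<k + 1. digit (monna t :: 'p padic) j = digit a j) \<longleftrightarrow>
        \<lfloor>t * real CARD('p) powi (k + 1)\<rfloor> = int (n * CARD('p) + digit a k)" if "0 \<le> t" for t
    proof -
      let ?f = "\<lfloor>t * real CARD('p) powi (k + 1)\<rfloor>"
      have "(\<forall>j<k + 1. digit (monna t :: 'p padic) j = digit a j) \<longleftrightarrow>
          (\<forall>j<k. digit (monna t :: 'p padic) j = digit a j) \<and> digit (monna t :: 'p padic) k = digit a k"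
        by (auto simp: order_le_less)
      also have "\<dots> \<longleftrightarrow> ?f div int CARD('p) = int n \<and> nat (?f mod int CARD('p)) = digit a k"
        using n that by (simp add: floor_powi_div digit_monna)
      also have "\<dots> \<longleftrightarrow> ?f div int CARD('p) = int n \<and> ?f mod int CARD('p) = int (digit a k)"
        using pos_mod_sign[OF p, of ?f] by (metis int_nat_eq nat_int)
      also have "\<dots> \<longleftrightarrow> ?f = int (n * CARD('p) + digit a k)"
      proof
        assume "?f div int CARD('p) = int n \<and> ?f mod int CARD('p) = int (digit a k)"
        then show "?f = int (n * CARD('p) + digit a k)"
          using div_mult_mod_eq[of ?f "int CARD('p)"] by simp
      next
        assume "?f = int (n * CARD('p) + digit a k)"
        then show "?f div int CARD('p) = int n \<and> ?f mod int CARD('p) = int (digit a k)"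
          using digit_less[of a k] p by simp
      qed
      finally show ?thesis .
    qed
    then show ?case
      by (intro exI[of _ "n * CARD('p) + digit a k"] allI impI)
  qed
qed

lemma monna_vimage_pball:
  "\<exists>n::nat. {t. 0 \<le> t \<and> monna t \<in> pball g (a::'p::prime_card padic)} =
     {real n * real CARD('p) powi g ..< (real n + 1) * real CARD('p) powi g}"
proof -
  obtain n :: nat where n: "\<forall>t\<ge>0. (\<forall>j < - g. digit (monna t :: 'p padic) j = digit a j)
     \<longleftrightarrow> \<lfloor>t * real CARD('p) powi (- g)\<rfloor> = int n"
    using monna_digits_iff[of "- g" a] by (rule exE)
  let ?q = "real CARD('p) powi g"
  have q: "0 < ?q" by simp
  have fl: "\<lfloor>t * real CARD('p) powi (- g)\<rfloor> = int n \<longleftrightarrow> real n * ?q \<le> t \<and> t < (real n + 1) * ?q" for t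
  proof -
    have "t * real CARD('p) powi (- g) = t / ?q"
      by (simp add: power_int_minus divide_inverse)
    then show ?thesis
      using q by (simp only: floor_eq_iff of_int_of_nat_eq pos_le_divide_eq pos_divide_less_eq)
  qed
  have "0 \<le> t" if "real n * ?q \<le> t" for t
    by (rule order_trans[OF _ that]) (intro mult_nonneg_nonneg less_imp_le[OF q], simp)
  then have "(0 \<le> t \<and> monna t \<in> pball g a) \<longleftrightarrow> t \<in> {real n * ?q ..< (real n + 1) * ?q}" for t
    using n[rule_format, of t] fl[of t] by (auto simp only: mem_pball atLeastLessThan_iff)
  then show ?thesis
    by (intro exI[of _ n]) blast
qed

text \<open>\<open>haar\<close> is a Hilbert choice, so nothing is known of it without a witness.
  The measure built here gives B_g(a) the value p^g whatever a is; it therefore agrees with its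
  translates on balls, and so everywhere.\<close>

lemma haar_exists:
  "\<exists>M :: 'p::prime_card padic measure. space M = UNIV
      \<and> sets M = sigma_sets UNIV (range (\<lambda>(g, a). pball g a))
      \<and> (\<forall>A\<in>sets M. \<forall>a. emeasure M ((\<lambda>x. padd x a) ` A) = emeasure M A)
      \<and> emeasure M (pball 0 pzero) = 1"
proof -
  let ?L = "restrict_space lborel {0::real..}" and ?S = "sigma (UNIV :: 'p padic set) pballs"
  define M where "M = distr ?L ?S monna"
  have vim: "monna -` pball g a \<inter> space ?L = {t. 0 \<le> t \<and> monna t \<in> pball g a}" for g and a :: "'p padic"
    by (auto simp: space_restrict_space)
  have meas: "monna \<in> measurable ?L ?S"
  proof (rule measurable_measure_of)
    fix A :: "'p padic set" assume "A \<in> pballs"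
    then obtain g a where A: "A = pball g a" by (rule pballsE)
    obtain n :: nat where n: "{t. 0 \<le> t \<and> monna t \<in> pball g a} =
       {real n * real CARD('p) powi g ..< (real n + 1) * real CARD('p) powi g}"
      using monna_vimage_pball by blast
    have "{t. 0 \<le> t \<and> monna t \<in> pball g a} \<in> sets lborel"
      unfolding n by simp
    then show "monna -` A \<inter> space ?L \<in> sets ?L"
      unfolding A vim by (subst sets_restrict_space_iff) auto
  qed auto
  have sets_M: "sets M = sigma_sets UNIV pballs" and space_M: "space M = UNIV"
    by (simp_all add: M_def)
  have ball_sets: "pball g a \<in> sets M" for g a
    unfolding sets_M by (intro sigma_sets.Basic) simp
  have ball: "emeasure M (pball g a) = ennreal (real CARD('p) powi g)" for g a
  proof -
    obtain n :: nat where n: "{t. 0 \<le> t \<and> monna t \<in> pball g a} =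
       {real n * real CARD('p) powi g ..< (real n + 1) * real CARD('p) powi g}"
      using monna_vimage_pball by blast
    have "emeasure M (pball g a) = emeasure ?L {t. 0 \<le> t \<and> monna t \<in> pball g a}"
      using emeasure_distr[OF meas, of "pball g a"] ball_sets[of g a] unfolding vim M_def by simp
    also have "\<dots> = emeasure lborel {t. 0 \<le> t \<and> monna t \<in> pball g a}"
      by (rule emeasure_restrict_space) auto
    also have "\<dots> = ennreal ((real n + 1) * real CARD('p) powi g - real n * real CARD('p) powi g)"
      unfolding n by (rule emeasure_lborel_Ico) (auto intro!: mult_right_mono less_imp_le)
    finally show ?thesis by (simp add: algebra_simps)
  qed
  have trans: "emeasure M ((\<lambda>x. padd x a) ` A) = emeasure M A" if "A \<in> sets M" for A a
  proof -
    have vim2: "(\<lambda>x. x - a) -` pball g b = pball g (b + a)" for g b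
      by (auto simp: pball_translate_diff)
    have meas2: "(\<lambda>x. x - a) \<in> measurable M M"
    proof (rule measurableI)
      fix B assume "B \<in> sets M"
      then show "(\<lambda>x. x - a) -` B \<inter> space M \<in> sets M"
        unfolding sets_M space_M Int_UNIV_right
      proof (induction rule: sigma_sets.induct)
        case (Basic B)
        then show ?case by (auto elim!: pballsE simp: vim2 intro!: sigma_sets.Basic)
      next
        case (Compl B)
        then show ?case by (auto simp: vimage_Diff Compl_eq_Diff_UNIV intro!: sigma_sets.Compl)
      qed (auto simp: vimage_UN intro!: sigma_sets.Empty sigma_sets.Union)
    qed (simp add: space_M)
    have "M = distr M M (\<lambda>x. x - a)"
    proof (rule measure_eqI_pballs[OF space_M sets_M])
      fix g b
      show "emeasure M (pball g b) = emeasure (distr M M (\<lambda>x. x - a)) (pball g b)"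
        using ball_sets meas2 by (subst emeasure_distr) (simp_all add: vim2 ball space_M)
      show "emeasure M (pball g b) \<noteq> \<infinity>"
        by (simp add: ball)
    qed simp
    then have "emeasure M A = emeasure (distr M M (\<lambda>x. x - a)) A"
      by simp
    also have "\<dots> = emeasure M ((\<lambda>x. x - a) -` A)"
      using that meas2 by (subst emeasure_distr) (simp_all add: space_M)
    also have "(\<lambda>x. x - a) -` A = (\<lambda>x. padd x a) ` A"
      by (auto simp: image_iff intro!: bexI[of _ "_ - a"])
    finally show ?thesis by simp
  qed
  show ?thesis
  proof (intro exI[of _ M] conjI ballI allI)
    show "sets M = sigma_sets UNIV (range (\<lambda>(g, a). pball g a))"
      using sets_M by (simp only: pballs_def)
  qed (use space_M trans ball[of 0 pzero] in auto)
qed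

section \<open>Measures of balls, translations and dilations of the measure\<close>

lemma
  shows space_haar [simp]: "space (haar :: 'p::prime_card padic measure) = UNIV"
    and sets_haar: "sets (haar :: 'p padic measure) = sigma_sets UNIV pballs"
    and emeasure_haar_translate:
      "A \<in> sets haar \<Longrightarrow> emeasure haar ((\<lambda>x. x + a) ` A) = emeasure haar (A :: 'p padic set)"
    and emeasure_haar_unit_ball: "emeasure haar (pball 0 (0 :: 'p padic)) = 1"
proof -
  have *: "space (haar :: 'p padic measure) = UNIV
      \<and> sets (haar :: 'p padic measure) = sigma_sets UNIV (range (\<lambda>(g, a). pball g a))
      \<and> (\<forall>A\<in>sets haar. \<forall>a. emeasure haar ((\<lambda>x. padd x a) ` A) = emeasure haar (A :: 'p padic set))
      \<and> emeasure haar (pball 0 pzero :: 'p padic set) = 1"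
    unfolding haar_def by (rule someI_ex[OF haar_exists])
  then show "space (haar :: 'p padic measure) = UNIV"
    "sets (haar :: 'p padic measure) = sigma_sets UNIV pballs"
    "emeasure haar (pball 0 (0 :: 'p padic)) = 1"
    by (simp_all add: pballs_def)
  show "emeasure haar ((\<lambda>x. x + a) ` A) = emeasure haar A" if "A \<in> sets haar" for a and A :: "'p padic set"
    using * that by simp
qed

lemma pball_in_sets [measurable, simp]: "pball g a \<in> sets haar"
  unfolding sets_haar by (intro sigma_sets.Basic) simp

lemma pball_partition:
  assumes "0 \<le> G + H"
  shows "(\<Union>n<CARD('p) ^ nat (G + H). pball (- H) (pgrid G (int n))) = pball G (0::'p::prime_card padic)"
    and "disjoint_family_on (\<lambda>n. pball (- H) (pgrid G (int n) :: 'p padic)) {..<CARD('p) ^ nat (G + H)}"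
proof -
  have "pball (- H) (pgrid G (int n)) \<subseteq> pball G (0::'p padic)" for n
    using pball_mono[of "- H" G "pgrid G (int n) :: 'p padic"] assms pball_eq[OF pgrid_in_pball[of G "int n", where ?'p='p]] by auto
  moreover have "x \<in> (\<Union>n<CARD('p) ^ nat (G + H). pball (- H) (pgrid G (int n)))"
    if "x \<in> pball G 0" for x :: "'p padic"
    by (rule pball_grid_ex[OF that assms]) blast
  ultimately show "(\<Union>n<CARD('p) ^ nat (G + H). pball (- H) (pgrid G (int n))) = pball G (0::'p padic)"
    by blast
  show "disjoint_family_on (\<lambda>n. pball (- H) (pgrid G (int n) :: 'p padic)) {..<CARD('p) ^ nat (G + H)}"
    unfolding disjoint_family_on_def
  proof (intro ballI impI, rule ccontr)
    fix m n assume mn: "m \<in> {..<CARD('p) ^ nat (G + H)}" "n \<in> {..<CARD('p) ^ nat (G + H)}" "m \<noteq> n"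
      "pball (- H) (pgrid G (int m) :: 'p padic) \<inter> pball (- H) (pgrid G (int n)) \<noteq> {}"
    then obtain x where "x \<in> pball (- H) (pgrid G (int m) :: 'p padic)" "x \<in> pball (- H) (pgrid G (int n) :: 'p padic)"
      by blast
    then have "pgrid G (int m) \<in> pball (- H) (pgrid G (int n) :: 'p padic)"
      using pball_eq pball_self by blast
    then have "pgrid (- H + int (nat (G + H))) (int m - int n) \<in> pball (- H) (0 :: 'p padic)"
      using assms by (subst (asm) mem_pball_iff_diff) (simp add: pgrid_diff)
    then have "int CARD('p) ^ nat (G + H) dvd int m - int n"
      unfolding pgrid_in_pball_iff .
    then have "int m mod int CARD('p) ^ nat (G + H) = int n mod int CARD('p) ^ nat (G + H)"
      by (simp add: mod_eq_dvd_iff)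
    then have "m mod CARD('p) ^ nat (G + H) = n mod CARD('p) ^ nat (G + H)"
      by (metis of_nat_eq_iff of_nat_power of_nat_mod)
    then show False
      using mn by simp
  qed
qed

lemma emeasure_pball_translate: "emeasure haar (pball g a) = emeasure haar (pball g (0 :: 'p padic))"
  for a :: "'p::prime_card padic"
proof -
  have "(\<lambda>x. x + a) ` pball g 0 = pball g a"
  proof (intro set_eqI iffI)
    fix x assume "x \<in> pball g a"
    then show "x \<in> (\<lambda>x. x + a) ` pball g 0"
      by (intro image_eqI[of _ _ "x - a"]) (auto simp: pball_translate_diff)
  next
    fix x assume "x \<in> (\<lambda>x. x + a) ` pball g 0"
    then show "x \<in> pball g a"
      using pball_translate[of _ a g 0] by auto
  qed
  then show ?thesis
    using emeasure_haar_translate[OF pball_in_sets, of a g 0] by simp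
qed

lemma emeasure_pball_scale:
  assumes "0 \<le> G + H"
  shows "emeasure haar (pball G (0::'p::prime_card padic)) =
     of_nat (CARD('p) ^ nat (G + H)) * emeasure haar (pball (- H) (0::'p padic))"
proof -
  have "emeasure haar (pball G (0::'p padic)) =
      (\<Sum>n<CARD('p) ^ nat (G + H). emeasure haar (pball (- H) (pgrid G (int n) :: 'p padic)))"
    unfolding pball_partition(1)[OF assms, symmetric]
    by (rule sum_emeasure[symmetric]) (use pball_partition(2)[OF assms] in auto)
  also have "\<dots> = (\<Sum>n<CARD('p) ^ nat (G + H). emeasure haar (pball (- H) (0 :: 'p padic)))"
    by (intro sum.cong refl emeasure_pball_translate)
  finally show ?thesis
    by simp
qed

text \<open>Derived from invariance and normalisation alone, since the chosen measure is not known
  to be the witness. Either B_g(0) consists of p^g translates of B_0(0), or B_0(0) of p^(-g)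
  translates of B_g(0); in the second case infinite measure is excluded before dividing.\<close>

lemma emeasure_pball: "emeasure haar (pball g (a::'p::prime_card padic)) = ennreal (real CARD('p) powi g)"
proof (cases "0 \<le> g")
  case True
  then show ?thesis
    using emeasure_pball_scale[of g 0, where ?'p='p]
    by (subst emeasure_pball_translate)
      (simp add: emeasure_haar_unit_ball power_int_nonneg_exp ennreal_of_nat_eq_real_of_nat)
next
  case False
  have *: "1 = of_nat (CARD('p) ^ nat (- g)) * emeasure haar (pball g (0::'p padic))"
    using emeasure_pball_scale[of 0 "- g", where ?'p='p] False by (simp add: emeasure_haar_unit_ball)
  have "emeasure haar (pball g (0::'p padic)) \<noteq> \<infinity>"
    using * card_gt_1[where ?'p='p] by (auto simp: ennreal_mult_top)
  then obtain r where r: "0 \<le> r" "emeasure haar (pball g (0::'p padic)) = ennreal r"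
    by (cases "emeasure haar (pball g (0::'p padic))") auto
  have "ennreal (real (CARD('p) ^ nat (- g)) * r) = 1"
    using * r by (simp add: ennreal_of_nat_eq_real_of_nat ennreal_mult)
  then have "real (CARD('p) ^ nat (- g)) * r = 1"
    by (simp only: ennreal_eq_1)
  moreover have "real (CARD('p) ^ nat (- g)) = inverse (real CARD('p) powi g)"
    using False by (simp flip: power_int_minus add: power_int_nonneg_exp)
  ultimately have "r = real CARD('p) powi g"
    by (metis inverse_unique inverse_inverse_eq)
  then show ?thesis
    using r emeasure_pball_translate by metis
qed

lemma measure_pball: "measure haar (pball g (a::'p::prime_card padic)) = real CARD('p) powi g"
  by (simp add: measure_def emeasure_pball less_imp_le)

lemma measurable_haar:
  assumes "\<And>g a. f -` pball g a \<in> sets haar"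
  shows "f \<in> measurable haar (haar :: 'p::prime_card padic measure)"
proof (rule measurableI)
  fix B :: "'p padic set" assume "B \<in> sets haar"
  then have "B \<in> sigma_sets UNIV pballs" by (simp add: sets_haar)
  then show "f -` B \<inter> space haar \<in> sets haar"
    unfolding space_haar Int_UNIV_right
  proof (induction rule: sigma_sets.induct)
    case (Basic B)
    then show ?case using assms by (auto elim!: pballsE)
  next
    case (Compl B)
    then show ?case using sets.compl_sets[of "f -` B" haar] by (simp add: vimage_Diff)
  qed (auto simp: vimage_UN)
qed simp

lemma vimage_diff_pball: "(\<lambda>x. x - a) -` pball g b = pball g (b + a::'p::prime_card padic)"
  by (auto simp: pball_translate_diff)

lemma vimage_pscale_pball: "pscale s -` pball g b = pball (g + s) (pscale (- s) (b::'p::prime_card padic))"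
  using pball_pscale[of s _ g "pscale (- s) b"] by auto

lemma measurable_diff_padic [measurable]:
  "(\<lambda>x. x - a) \<in> measurable haar (haar :: 'p::prime_card padic measure)"
  by (rule measurable_haar) (simp add: vimage_diff_pball)

lemma measurable_pscale [measurable]:
  "pscale s \<in> measurable haar (haar :: 'p::prime_card padic measure)"
  by (rule measurable_haar) (simp add: vimage_pscale_pball)

lemma distr_haar_diff: "distr haar haar (\<lambda>x. x - a) = (haar :: 'p::prime_card padic measure)"
  by (rule measure_eqI_pballs[symmetric])
    (simp_all add: sets_haar emeasure_distr vimage_diff_pball emeasure_pball)

text \<open>Multiplication by p^s divides norms by p^s, so the preimage of a ball of radius p^g has
  radius p^(g+s).\<close>

lemma distr_haar_pscale:
  "distr haar haar (pscale s) = density (haar :: 'p::prime_card padic measure) (\<lambda>_. ennreal (real CARD('p) powi s))"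
  by (rule measure_eqI_pballs)
    (simp_all add: sets_haar emeasure_distr vimage_pscale_pball emeasure_pball base_powi_add
      emeasure_density_const ennreal_mult ennreal_mult_eq_top_iff less_imp_le mult.commute)

section \<open>Square integrable functions\<close>

text \<open>With squared norms the bound |a + b|^2 \<le> 2 |a|^2 + 2 |b|^2 replaces the inequality
  of Minkowski. Its factors 2 are the source of the tolerances e / 4.\<close>

definition l2sq :: "('p::prime_card padic \<Rightarrow> complex) \<Rightarrow> real" where
  "l2sq f = (LINT x|haar. (cmod (f x))\<^sup>2)"

lemma l2sq_nonneg [simp]: "0 \<le> l2sq f"
  by (simp add: l2sq_def)

lemma l2norm_less_iff: "0 < e \<Longrightarrow> l2norm f < e \<longleftrightarrow> l2sq f < e\<^sup>2"
  unfolding l2norm_def l2sq_def[symmetric]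
  by (metis abs_of_pos real_sqrt_abs real_sqrt_less_iff)

lemma l2_closure_iff: "f \<in> l2_closure S \<longleftrightarrow> f \<in> L2 \<and> (\<forall>e>0. \<exists>g\<in>S. l2sq (\<lambda>x. f x - g x) < e)"
proof -
  have "(\<forall>e>0. \<exists>g\<in>S. l2norm (\<lambda>x. f x - g x) < e) \<longleftrightarrow> (\<forall>e>0. \<exists>g\<in>S. l2sq (\<lambda>x. f x - g x) < e)"
  proof (intro iffI allI impI)
    fix e :: real assume "\<forall>e>0. \<exists>g\<in>S. l2norm (\<lambda>x. f x - g x) < e" "0 < e"
    then obtain g where "g \<in> S" "l2norm (\<lambda>x. f x - g x) < sqrt e"
      by (meson real_sqrt_gt_zero)
    then show "\<exists>g\<in>S. l2sq (\<lambda>x. f x - g x) < e"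
      using \<open>0 < e\<close> by (intro bexI[of _ g]) (simp_all add: l2norm_less_iff)
  next
    fix e :: real assume *: "\<forall>e>0. \<exists>g\<in>S. l2sq (\<lambda>x. f x - g x) < e" "0 < e"
    then have "0 < e\<^sup>2" by simp
    then obtain g where "g \<in> S" "l2sq (\<lambda>x. f x - g x) < e\<^sup>2"
      using * by blast
    then show "\<exists>g\<in>S. l2norm (\<lambda>x. f x - g x) < e"
      using \<open>0 < e\<close> by (intro bexI[of _ g]) (simp_all add: l2norm_less_iff)
  qed
  then show ?thesis
    unfolding l2_closure_def by auto
qed

lemma L2D:
  assumes "f \<in> L2"
  shows "f \<in> borel_measurable haar" "integrable haar (\<lambda>x. (cmod (f x))\<^sup>2)"
  using assms by (simp_all add: L2_def)

lemma cmod_add_sq_le: "(cmod (a + b))\<^sup>2 \<le> 2 * (cmod a)\<^sup>2 + 2 * (cmod b)\<^sup>2"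
proof -
  have "(cmod (a + b))\<^sup>2 \<le> (cmod a + cmod b)\<^sup>2"
    by (intro power_mono norm_triangle_ineq) auto
  also have "\<dots> \<le> 2 * (cmod a)\<^sup>2 + 2 * (cmod b)\<^sup>2"
    using sum_squares_bound[of "cmod a" "cmod b"] by (simp add: power2_sum)
  finally show ?thesis .
qed

lemma L2_dominated:
  assumes "f \<in> borel_measurable haar" "integrable haar h" "\<And>x. (cmod (f x))\<^sup>2 \<le> h x"
  shows "f \<in> L2" "l2sq f \<le> integral\<^sup>L haar h"
proof -
  have [measurable]: "f \<in> borel_measurable haar" by fact
  have "integrable haar (\<lambda>x. (cmod (f x))\<^sup>2)"
    by (rule Bochner_Integration.integrable_bound[OF assms(2)])
      (use assms(3) in \<open>auto intro: order_trans[OF _ abs_ge_self]\<close>)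
  then show "f \<in> L2" "l2sq f \<le> integral\<^sup>L haar h"
    using assms by (auto simp: L2_def l2sq_def intro!: integral_mono)
qed

lemma
  assumes "f \<in> L2" "g \<in> L2"
  shows L2_add: "(\<lambda>x. f x + g x) \<in> L2"
    and l2sq_add_le: "l2sq (\<lambda>x. f x + g x) \<le> 2 * l2sq f + 2 * l2sq g"
proof -
  have h: "integrable haar (\<lambda>x. 2 * (cmod (f x))\<^sup>2 + 2 * (cmod (g x))\<^sup>2)"
    using assms by (intro Bochner_Integration.integrable_add integrable_mult_right L2D)
  have m: "(\<lambda>x. f x + g x) \<in> borel_measurable haar"
    using assms by (intro borel_measurable_add L2D)
  show "(\<lambda>x. f x + g x) \<in> L2"
    by (rule L2_dominated(1)[OF m h]) (rule cmod_add_sq_le)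
  have "l2sq (\<lambda>x. f x + g x) \<le> (LINT x|haar. 2 * (cmod (f x))\<^sup>2 + 2 * (cmod (g x))\<^sup>2)"
    by (rule L2_dominated(2)[OF m h]) (rule cmod_add_sq_le)
  also have "\<dots> = 2 * l2sq f + 2 * l2sq g"
    using L2D(2)[OF assms(1)] L2D(2)[OF assms(2)] by (simp add: l2sq_def)
  finally show "l2sq (\<lambda>x. f x + g x) \<le> 2 * l2sq f + 2 * l2sq g" .
qed

lemma L2_scale: "f \<in> L2 \<Longrightarrow> (\<lambda>x. c * f x) \<in> L2"
  by (auto simp: L2_def norm_mult power_mult_distrib)

lemma l2sq_scale: "l2sq (\<lambda>x. c * f x) = (cmod c)\<^sup>2 * l2sq f"
  by (simp add: l2sq_def norm_mult power_mult_distrib)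

lemma L2_zero [simp]: "(\<lambda>x. 0) \<in> L2"
  by (simp add: L2_def)

lemma l2sq_zero [simp]: "l2sq (\<lambda>x. 0) = 0"
  by (simp add: l2sq_def)

lemma L2_diff: "f \<in> L2 \<Longrightarrow> g \<in> L2 \<Longrightarrow> (\<lambda>x. f x - g x) \<in> L2"
  using L2_add[OF _ L2_scale[of g "-1"]] by simp

lemma l2sq_diff_commute: "l2sq (\<lambda>x. f x - g x) = l2sq (\<lambda>x. g x - f x)"
  by (simp add: l2sq_def norm_minus_commute)

lemma l2sq_diff_triangle:
  assumes "f \<in> L2" "g \<in> L2" "h \<in> L2"
  shows "l2sq (\<lambda>x. f x - h x) \<le> 2 * l2sq (\<lambda>x. f x - g x) + 2 * l2sq (\<lambda>x. g x - h x)"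
  using l2sq_add_le[OF L2_diff[OF assms(1,2)] L2_diff[OF assms(2,3)]] by simp

section \<open>Subspaces, spans and closures in L^2\<close>

definition csubspace :: "('a \<Rightarrow> complex) set \<Rightarrow> bool" where
  "csubspace V \<longleftrightarrow> (\<lambda>x. 0) \<in> V \<and> (\<forall>f\<in>V. \<forall>g\<in>V. (\<lambda>x. f x + g x) \<in> V)
     \<and> (\<forall>c. \<forall>f\<in>V. (\<lambda>x. c * f x) \<in> V)"

lemma csubspaceD:
  assumes "csubspace V"
  shows "(\<lambda>x. 0) \<in> V" "\<lbrakk>f \<in> V; g \<in> V\<rbrakk> \<Longrightarrow> (\<lambda>x. f x + g x) \<in> V" "f \<in> V \<Longrightarrow> (\<lambda>x. c * f x) \<in> V"
  using assms unfolding csubspace_def by auto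

lemma csubspace_diff: "csubspace V \<Longrightarrow> f \<in> V \<Longrightarrow> g \<in> V \<Longrightarrow> (\<lambda>x. f x - g x) \<in> V"
  using csubspaceD(2)[OF _ _ csubspaceD(3), of V f g "-1"] by simp

lemma csubspace_sum:
  assumes "csubspace V" "\<And>i. i \<in> I \<Longrightarrow> f i \<in> V"
  shows "(\<lambda>x. \<Sum>i\<in>I. c i * f i x) \<in> V"
  using assms(2)
proof (induction I rule: infinite_finite_induct)
  case (insert i I)
  then show ?case
    using csubspaceD(2)[OF assms(1) csubspaceD(3)[OF assms(1), of "f i" "c i"]] by simp
qed (use csubspaceD(1)[OF assms(1)] in auto)

lemma csubspace_fspan: "csubspace (fspan S)"
  unfolding csubspace_def
proof (intro conjI ballI allI)
  show "(\<lambda>x. 0) \<in> fspan S"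
    unfolding fspan_def by (auto intro!: exI[of _ "{}"])
next
  fix f g assume "f \<in> fspan S" "g \<in> fspan S"
  then obtain F c G d where *: "finite F" "F \<subseteq> S" "f = (\<lambda>x. \<Sum>g\<in>F. c g * g x)"
      "finite G" "G \<subseteq> S" "g = (\<lambda>x. \<Sum>g\<in>G. d g * g x)"
    unfolding fspan_def by blast
  have "(\<lambda>x. f x + g x) = (\<lambda>x. \<Sum>g\<in>F \<union> G. ((if g \<in> F then c g else 0) + (if g \<in> G then d g else 0)) * g x)"
  proof
    fix x
    have "(\<Sum>g\<in>F. c g * g x) = (\<Sum>g\<in>F \<union> G. (if g \<in> F then c g else 0) * g x)"
      using * by (intro sum.mono_neutral_cong_left) auto
    moreover have "(\<Sum>g\<in>G. d g * g x) = (\<Sum>g\<in>F \<union> G. (if g \<in> G then d g else 0) * g x)"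
      using * by (intro sum.mono_neutral_cong_left) auto
    ultimately show "f x + g x = (\<Sum>g\<in>F \<union> G. ((if g \<in> F then c g else 0) + (if g \<in> G then d g else 0)) * g x)"
      using * by (simp add: distrib_right sum.distrib)
  qed
  then show "(\<lambda>x. f x + g x) \<in> fspan S"
    unfolding fspan_def using *
    by (intro CollectI exI[of _ "F \<union> G"] exI[of _ "\<lambda>g. (if g \<in> F then c g else 0) + (if g \<in> G then d g else 0)"]) auto
next
  fix a f assume "f \<in> fspan S"
  then obtain F c where *: "finite F" "F \<subseteq> S" "f = (\<lambda>x. \<Sum>g\<in>F. c g * g x)"
    unfolding fspan_def by blast
  then show "(\<lambda>x. a * f x) \<in> fspan S"
    unfolding fspan_def
    by (intro CollectI exI[of _ F] exI[of _ "\<lambda>g. a * c g"]) (auto simp: sum_distrib_left mult.assoc)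
qed

lemma fspan_base: "f \<in> S \<Longrightarrow> f \<in> fspan S"
  unfolding fspan_def by (intro CollectI exI[of _ "{f}"] exI[of _ "\<lambda>_. 1"]) auto

lemma fspan_least:
  assumes "csubspace V" "S \<subseteq> V"
  shows "fspan S \<subseteq> V"
proof
  fix f assume "f \<in> fspan S"
  then obtain F c where "finite F" "F \<subseteq> S" "f = (\<lambda>x. \<Sum>g\<in>F. c g * g x)"
    unfolding fspan_def by blast
  then show "f \<in> V"
    using csubspace_sum[OF assms(1), of F "\<lambda>g. g" c] assms(2) by auto
qed

lemma csubspace_L2: "csubspace L2"
  unfolding csubspace_def by (auto intro: L2_add L2_scale)

lemma l2_closure_subset_L2: "l2_closure S \<subseteq> L2"
  by (auto simp: l2_closure_def)

lemma l2_closure_base: "S \<subseteq> L2 \<Longrightarrow> S \<subseteq> l2_closure S"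
  by (force simp: l2_closure_iff)

lemma l2_closure_mono: "S \<subseteq> T \<Longrightarrow> l2_closure S \<subseteq> l2_closure T"
  by (fastforce simp: l2_closure_def)

lemma l2_closure_idem:
  assumes "S \<subseteq> L2"
  shows "l2_closure (l2_closure S) = l2_closure S"
proof
  show "l2_closure (l2_closure S) \<subseteq> l2_closure S"
  proof
    fix f assume f: "f \<in> l2_closure (l2_closure S)"
    show "f \<in> l2_closure S"
      unfolding l2_closure_iff
    proof (intro conjI allI impI)
      show "f \<in> L2" using f by (simp add: l2_closure_iff)
      fix e :: real assume "0 < e"
      then have "0 < e / 4" by simp
      then obtain g where g: "g \<in> l2_closure S" "l2sq (\<lambda>x. f x - g x) < e / 4"
        using f unfolding l2_closure_iff[of f] by blast
      then obtain h where h: "h \<in> S" "l2sq (\<lambda>x. g x - h x) < e / 4"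
        using \<open>0 < e / 4\<close> unfolding l2_closure_iff[of g] by blast
      have "l2sq (\<lambda>x. f x - h x) \<le> 2 * l2sq (\<lambda>x. f x - g x) + 2 * l2sq (\<lambda>x. g x - h x)"
        using \<open>f \<in> L2\<close> g h assms l2_closure_subset_L2 by (intro l2sq_diff_triangle) auto
      also have "\<dots> < e"
        using g h by simp
      finally show "\<exists>h\<in>S. l2sq (\<lambda>x. f x - h x) < e"
        using h by blast
    qed
  qed
qed (rule l2_closure_base[OF l2_closure_subset_L2])

lemma csubspace_l2_closure:
  assumes "csubspace V" "V \<subseteq> L2"
  shows "csubspace (l2_closure V)"
  unfolding csubspace_def
proof (intro conjI ballI allI)
  show "(\<lambda>x. 0) \<in> l2_closure V"
    using l2_closure_base[OF assms(2)] csubspaceD(1)[OF assms(1)] by blast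
next
  fix f g assume fg: "f \<in> l2_closure V" "g \<in> l2_closure V"
  then have L2: "f \<in> L2" "g \<in> L2" by (simp_all add: l2_closure_iff)
  show "(\<lambda>x. f x + g x) \<in> l2_closure V"
    unfolding l2_closure_iff
  proof (intro conjI allI impI)
    show "(\<lambda>x. f x + g x) \<in> L2" using L2 by (rule L2_add)
    fix e :: real assume "0 < e"
    then have "0 < e / 4" by simp
    then obtain f' g' where *: "f' \<in> V" "l2sq (\<lambda>x. f x - f' x) < e / 4" "g' \<in> V" "l2sq (\<lambda>x. g x - g' x) < e / 4"
      using fg unfolding l2_closure_iff by blast
    have "l2sq (\<lambda>x. (f x - f' x) + (g x - g' x)) \<le> 2 * l2sq (\<lambda>x. f x - f' x) + 2 * l2sq (\<lambda>x. g x - g' x)"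
      using * L2 assms(2) by (intro l2sq_add_le L2_diff) auto
    also have "\<dots> < e" using * by simp
    finally have "l2sq (\<lambda>x. (f x + g x) - (f' x + g' x)) < e"
      by (simp add: algebra_simps)
    then show "\<exists>h\<in>V. l2sq (\<lambda>x. f x + g x - h x) < e"
      using csubspaceD(2)[OF assms(1) *(1,3)] by (intro bexI[of _ "\<lambda>x. f' x + g' x"])
  qed
next
  fix c f assume f: "f \<in> l2_closure V"
  show "(\<lambda>x. c * f x) \<in> l2_closure V"
    unfolding l2_closure_iff
  proof (intro conjI allI impI)
    show "(\<lambda>x. c * f x) \<in> L2" using f by (simp add: l2_closure_iff L2_scale)
    fix e :: real assume "0 < e"
    \<comment> \<open>The added 1 keeps the denominator positive for c = 0.\<close>
    define d where "d = e / ((cmod c)\<^sup>2 + 1)"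
    have c: "0 < (cmod c)\<^sup>2 + 1" by (simp add: add_nonneg_pos)
    then have "0 < d" using \<open>0 < e\<close> by (simp add: d_def)
    then obtain f' where *: "f' \<in> V" "l2sq (\<lambda>x. f x - f' x) < d"
      using f unfolding l2_closure_iff by blast
    have "l2sq (\<lambda>x. c * f x - c * f' x) = (cmod c)\<^sup>2 * l2sq (\<lambda>x. f x - f' x)"
      by (simp flip: l2sq_scale add: right_diff_distrib)
    also have "\<dots> \<le> ((cmod c)\<^sup>2 + 1) * l2sq (\<lambda>x. f x - f' x)"
      by (intro mult_right_mono) auto
    also have "\<dots> < ((cmod c)\<^sup>2 + 1) * d"
      using * c by (intro mult_strict_left_mono)
    also have "\<dots> = e"
      using c by (simp add: d_def)
    finally show "\<exists>h\<in>V. l2sq (\<lambda>x. c * f x - h x) < e"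
      using csubspaceD(3)[OF assms(1) *(1), of c] by (intro bexI[of _ "\<lambda>x. c * f' x"])
  qed
qed

lemma l2_closed_subspace_iff:
  "l2_closed_subspace V \<longleftrightarrow> V \<subseteq> L2 \<and> csubspace V \<and> l2_closure V = V"
  unfolding l2_closed_subspace_def csubspace_def by auto

lemma l2_closed_subspace_closure:
  assumes "csubspace V" "V \<subseteq> L2"
  shows "l2_closed_subspace (l2_closure V)"
  unfolding l2_closed_subspace_iff
  using csubspace_l2_closure[OF assms] l2_closure_idem[OF assms(2)] l2_closure_subset_L2 by blast

lemma l2_closure_least:
  assumes "S \<subseteq> V" "l2_closed_subspace V"
  shows "l2_closure S \<subseteq> V"
  using l2_closure_mono[OF assms(1)] assms(2) unfolding l2_closed_subspace_iff by blast

text \<open>Dominated convergence: |f - s i|^2 is at most 4 h^2. The density argument uses it for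
  disjoint unions, for exhaustion by balls and for simple functions.\<close>

lemma L2_limit:
  assumes V: "l2_closed_subspace V"
    and s: "\<And>i. s i \<in> V" "\<And>x. (\<lambda>i. s i x) \<longlonglongrightarrow> f x"
    and h: "integrable haar (\<lambda>x. (h x)\<^sup>2)" "\<And>i x. cmod (s i x) \<le> h x"
  shows "f \<in> V"
proof -
  have sm: "s i \<in> borel_measurable haar" for i
    using s(1) V L2D(1) unfolding l2_closed_subspace_iff by blast
  note [measurable] = sm
  have fm [measurable]: "f \<in> borel_measurable haar"
    by (rule borel_measurable_LIMSEQ_metric[of s]) (use s(2) in auto)
  have fh: "cmod (f x) \<le> h x" for x
    by (rule LIMSEQ_le_const2[OF tendsto_norm[OF s(2)]]) (use h(2) in auto)
  have h0: "0 \<le> h x" for x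
    using fh[of x] norm_ge_zero order_trans by blast
  have "f \<in> L2"
    by (rule L2_dominated(1)[OF fm h(1)]) (use fh in \<open>auto intro!: power_mono\<close>)
  have "(\<lambda>i. l2sq (\<lambda>x. f x - s i x)) \<longlonglongrightarrow> (LINT x|(haar::'a padic measure). 0)"
    unfolding l2sq_def
  proof (rule integral_dominated_convergence[where w="\<lambda>x. 4 * (h x)\<^sup>2"])
    show "integrable haar (\<lambda>x. 4 * (h x)\<^sup>2)"
      using h(1) by simp
    show "AE x in haar. (\<lambda>i. (cmod (f x - s i x))\<^sup>2) \<longlonglongrightarrow> 0"
    proof (rule AE_I2)
      fix x
      have "(\<lambda>i. (cmod (f x - s i x))\<^sup>2) \<longlonglongrightarrow> (cmod (f x - f x))\<^sup>2"
        by (intro tendsto_intros s(2))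
      then show "(\<lambda>i. (cmod (f x - s i x))\<^sup>2) \<longlonglongrightarrow> 0" by simp
    qed
    show "AE x in haar. norm ((cmod (f x - s i x))\<^sup>2) \<le> 4 * (h x)\<^sup>2" for i
    proof (rule AE_I2)
      fix x
      have "cmod (f x - s i x) \<le> 2 * h x"
        using norm_triangle_ineq4[of "f x" "s i x"] fh[of x] h(2)[of i x] by linarith
      then have "(cmod (f x - s i x))\<^sup>2 \<le> (2 * h x)\<^sup>2"
        by (intro power_mono) auto
      then show "norm ((cmod (f x - s i x))\<^sup>2) \<le> 4 * (h x)\<^sup>2"
        by (simp add: power_mult_distrib)
    qed
  qed measurable
  then have lim: "(\<lambda>i. l2sq (\<lambda>x. f x - s i x)) \<longlonglongrightarrow> 0" by simp
  have "f \<in> l2_closure V"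
    unfolding l2_closure_iff
  proof (intro conjI allI impI \<open>f \<in> L2\<close>)
    fix e :: real assume "0 < e"
    then have "\<forall>\<^sub>F i in sequentially. l2sq (\<lambda>x. f x - s i x) < e"
      using lim by (rule order_tendstoD(2)[rotated])
    then obtain i where "l2sq (\<lambda>x. f x - s i x) < e"
      by (meson eventually_happens trivial_limit_sequentially)
    then show "\<exists>g\<in>V. l2sq (\<lambda>x. f x - g x) < e"
      using s(1) by blast
  qed
  then show ?thesis
    using V unfolding l2_closed_subspace_iff by blast
qed

section \<open>Density of the span of the indicators of balls\<close>

lemma integrable_indicator_haar:
  "A \<in> sets haar \<Longrightarrow> emeasure haar A < \<infinity> \<Longrightarrow> integrable haar (indicator A :: _ \<Rightarrow> real)"
  by (simp add: integrable_indicator_iff)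

lemma indicator_sq: "(indicator A x :: real)\<^sup>2 = indicator A x"
  by (simp add: indicator_def)

lemma sum_indicator_disjoint:
  assumes "finite I" "disjoint_family_on A I"
  shows "(\<Sum>i\<in>I. indicator (A i) x) = (indicator (\<Union>i\<in>I. A i) x :: 'a::semiring_1)"
  using assms
proof (induction I rule: finite_induct)
  case (insert i I)
  then have "x \<notin> A i \<or> x \<notin> (\<Union>j\<in>I. A j)" "disjoint_family_on A I"
    by (auto simp: disjoint_family_on_def)
  then show ?case
    using insert by (auto simp: indicator_def)
qed simp

text \<open>Dynkin induction from the balls. Cutting with the fixed ball B_h(0) keeps everything of
  finite measure, so that a complement becomes a difference of two members of
  \<open>V\<close>.\<close>

lemma indicator_Int_pball_mem:
  assumes V: "l2_closed_subspace V"
    and balls: "\<And>g a. (indicator (pball g a) :: 'p::prime_card padic \<Rightarrow> complex) \<in> V"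
    and A: "A \<in> sets haar"
  shows "(indicator (A \<inter> pball h 0) :: 'p padic \<Rightarrow> complex) \<in> V"
proof -
  have sub: "csubspace V" using V by (simp add: l2_closed_subspace_iff)
  have A': "A \<in> sigma_sets UNIV (insert {} pballs)"
    using A by (simp add: sets_haar sigma_sets_insert_empty)
  have closed: "insert {} (pballs :: 'p padic set set) \<subseteq> Pow UNIV" by simp
  from Int_stable_pballs closed A' show ?thesis
  proof (induction rule: sigma_sets_induct_disjoint)
    case (basic A)
    then have "A \<inter> pball h 0 = {} \<or> A \<inter> pball h 0 \<in> pballs"
      using Int_pballs[of A "pball h 0"] by auto
    then show ?case
    proof
      assume "A \<inter> pball h 0 = {}"
      then show ?thesis using csubspaceD(1)[OF sub] by (simp add: indicator_def)
    next
      assume "A \<inter> pball h 0 \<in> pballs"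
      then obtain g a where "A \<inter> pball h 0 = pball g a" by (rule pballsE)
      then show ?thesis using balls by simp
    qed
  next
    case empty
    then show ?case using csubspaceD(1)[OF sub] by (simp add: indicator_def)
  next
    case (compl A)
    have eq: "(indicator ((UNIV - A) \<inter> pball h 0) :: 'p padic \<Rightarrow> complex)
        = (\<lambda>x. indicator (pball h 0) x - indicator (A \<inter> pball h 0) x)"
      by (auto simp: fun_eq_iff indicator_def)
    show ?case
      unfolding eq by (intro csubspace_diff[OF sub] balls compl)
  next
    case (union A)
    have sets: "A i \<in> sets haar" for i
      using union(2) by (auto simp: sets_haar sigma_sets_insert_empty)
    show ?case
    proof (rule L2_limit[OF V])
      show "(\<lambda>x. \<Sum>i\<in>{..<n}. 1 * indicator (A i \<inter> pball h 0) x) \<in> V" for n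
        by (intro csubspace_sum[OF sub] union)
      have eq: "(\<Sum>i\<in>{..<n}. 1 * indicator (A i \<inter> pball h 0) x :: complex)
          = indicator (\<Union>i<n. A i \<inter> pball h 0) x" for n x
        using sum_indicator_disjoint[of "{..<n}" "\<lambda>i. A i \<inter> pball h 0" x, where ?'a=complex] union(1)
        by (auto simp: disjoint_family_on_def)
      show "(\<lambda>n. \<Sum>i\<in>{..<n}. 1 * indicator (A i \<inter> pball h 0) x :: complex)
          \<longlonglongrightarrow> indicator ((\<Union>i. A i) \<inter> pball h 0) x" for x
        unfolding eq using LIMSEQ_indicator_UN[of "\<lambda>i. A i \<inter> pball h 0" x] by simp
      show "integrable haar (\<lambda>x. (indicator (pball h 0) x :: real)\<^sup>2)"
        unfolding indicator_sq by (intro integrable_indicator_haar) (auto simp: emeasure_pball)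
      show "cmod (\<Sum>i\<in>{..<n}. 1 * indicator (A i \<inter> pball h 0) x) \<le> indicator (pball h 0) x" for n x
        unfolding eq by (auto simp: indicator_def)
    qed
  qed
qed

lemma indicator_mem:
  assumes V: "l2_closed_subspace V"
    and balls: "\<And>g a. (indicator (pball g a) :: 'p::prime_card padic \<Rightarrow> complex) \<in> V"
    and A: "A \<in> sets haar" "emeasure haar A < \<infinity>"
  shows "(indicator A :: 'p padic \<Rightarrow> complex) \<in> V"
proof (rule L2_limit[OF V])
  show "(indicator (A \<inter> pball (int n) 0) :: 'p padic \<Rightarrow> complex) \<in> V" for n :: nat
    by (rule indicator_Int_pball_mem[OF V balls A(1)])
  show "(\<lambda>n. indicator (A \<inter> pball (int n) 0) x :: complex) \<longlonglongrightarrow> indicator A x" for x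
  proof -
    obtain G :: nat where G: "x \<in> pball (int G) 0"
      using pball_exhaust by blast
    have "\<forall>\<^sub>F n in sequentially. indicator (A \<inter> pball (int n) 0) x = (indicator A x :: complex)"
      using eventually_ge_at_top[of G]
    proof eventually_elim
      case (elim n)
      then have "x \<in> pball (int n) 0"
        using G pball_mono[of "int G" "int n" "0::'p padic"] by auto
      then show ?case by (simp add: indicator_def)
    qed
    then show ?thesis by (rule tendsto_eventually)
  qed
  show "integrable haar (\<lambda>x. (indicator A x :: real)\<^sup>2)"
    unfolding indicator_sq by (intro integrable_indicator_haar A)
qed (auto simp: indicator_def)

lemma l2_closed_subspace_eq_L2:
  assumes V: "l2_closed_subspace V"
    and balls: "\<And>g a. (indicator (pball g a) :: 'p::prime_card padic \<Rightarrow> complex) \<in> V"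
  shows "V = (L2 :: ('p padic \<Rightarrow> complex) set)"
proof
  show "V \<subseteq> L2" using V by (simp add: l2_closed_subspace_iff)
  have sub: "csubspace V" using V by (simp add: l2_closed_subspace_iff)
  show "L2 \<subseteq> V"
  proof
    fix f :: "'p padic \<Rightarrow> complex" assume f: "f \<in> L2"
    obtain s where s: "\<And>i. simple_function haar (s i)" "\<And>x. (\<lambda>i. s i x) \<longlonglongrightarrow> f x"
        "\<And>i x. dist (s i x) 0 \<le> 2 * dist (f x) 0"
      using borel_measurable_implies_sequence_metric[OF L2D(1)[OF f], of 0] by auto
    show "f \<in> V"
    proof (rule L2_limit[OF V _ s(2)])
      show int4: "integrable haar (\<lambda>x. (2 * cmod (f x))\<^sup>2)"
        using L2D(2)[OF f] by (simp add: power_mult_distrib)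
      show bound: "cmod (s i x) \<le> 2 * cmod (f x)" for i x
        using s(3)[of i x] by simp
      show "s i \<in> V" for i
      proof -
        \<comment> \<open>The value 0 is left out because its level set may have infinite measure.
          The other level sets have finite measure by comparison with 4 |f|^2 / |y|^2.\<close>
        let ?R = "range (s i) - {0}"
        have fin: "finite (range (s i))"
          using simple_functionD(1)[OF s(1)[of i]] by simp
        have ind: "indicator (s i -` {y}) \<in> V" if "y \<noteq> 0" for y
        proof (rule indicator_mem[OF V balls])
          show meas: "s i -` {y} \<in> sets haar"
            using simple_functionD(2)[OF s(1)[of i], of "{y}"] by simp
          have "integrable haar (indicator (s i -` {y}) :: _ \<Rightarrow> real)"
          proof (rule Bochner_Integration.integrable_bound)
            show "integrable haar (\<lambda>x. (2 * cmod (f x))\<^sup>2 / (cmod y)\<^sup>2)"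
              using int4 by simp
            show "AE x in haar. norm (indicator (s i -` {y}) x :: real) \<le> norm ((2 * cmod (f x))\<^sup>2 / (cmod y)\<^sup>2)"
            proof (rule AE_I2)
              fix x
              have "(cmod y)\<^sup>2 \<le> (2 * cmod (f x))\<^sup>2" if "s i x = y"
                using bound[of i x] that by (intro power_mono) auto
              then show "norm (indicator (s i -` {y}) x :: real) \<le> norm ((2 * cmod (f x))\<^sup>2 / (cmod y)\<^sup>2)"
                using \<open>y \<noteq> 0\<close> by (auto simp: indicator_def)
            qed
          qed (use meas in auto)
          then show "emeasure haar (s i -` {y}) < \<infinity>"
            by (simp add: integrable_indicator_iff)
        qed
        have "s i = (\<lambda>x. \<Sum>y\<in>?R. y * indicator (s i -` {y}) x)"
        proof
          fix x
          have "(\<Sum>y\<in>?R. y * indicator (s i -` {y}) x) = (\<Sum>y\<in>?R. if y = s i x then y else 0)"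
            by (intro sum.cong) (auto simp: indicator_def)
          then show "s i x = (\<Sum>y\<in>?R. y * indicator (s i -` {y}) x)"
            using fin by (simp add: sum.delta)
        qed
        moreover have "(\<lambda>x. \<Sum>y\<in>?R. y * indicator (s i -` {y}) x) \<in> V"
          by (intro csubspace_sum[OF sub] ind) auto
        ultimately show ?thesis by simp
      qed
    qed
  qed
qed

section \<open>Translations and dilations\<close>

lemma
  fixes f :: "'p::prime_card padic \<Rightarrow> 'b::{banach, second_countable_topology}"
  assumes "f \<in> borel_measurable haar"
  shows integral_haar_diff: "(LINT x|haar. f (x - a)) = integral\<^sup>L haar f"
    and integrable_haar_diff: "integrable haar (\<lambda>x. f (x - a)) \<longleftrightarrow> integrable haar f"
    and integral_haar_pscale: "(LINT x|haar. f (pscale s x)) = real CARD('p) powi s *\<^sub>R integral\<^sup>L haar f"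
    and integrable_haar_pscale: "integrable haar (\<lambda>x. f (pscale s x)) \<longleftrightarrow> integrable haar f"
proof -
  show "(LINT x|haar. f (x - a)) = integral\<^sup>L haar f"
    using integral_distr[OF measurable_diff_padic assms, of a] by (simp add: distr_haar_diff)
  show "integrable haar (\<lambda>x. f (x - a)) \<longleftrightarrow> integrable haar f"
    using integrable_distr_eq[OF measurable_diff_padic assms, of a] by (simp add: distr_haar_diff)
  have nn: "AE x in (haar :: 'p padic measure). 0 \<le> real CARD('p) powi s"
    by (simp add: less_imp_le)
  show "(LINT x|haar. f (pscale s x)) = real CARD('p) powi s *\<^sub>R integral\<^sup>L haar f"
    using integral_distr[OF measurable_pscale assms, of s] integral_density[OF assms _ nn]
    by (simp add: distr_haar_pscale)
  have "integrable haar (\<lambda>x. real CARD('p) powi s *\<^sub>R f x) \<longleftrightarrow> integrable haar f"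
    using integrable_scaleR_right[of "inverse (real CARD('p) powi s)" haar "\<lambda>x. real CARD('p) powi s *\<^sub>R f x"]
    by auto
  then show "integrable haar (\<lambda>x. f (pscale s x)) \<longleftrightarrow> integrable haar f"
    using integrable_distr_eq[OF measurable_pscale assms, of s] integrable_density[OF assms _ nn]
    by (simp add: distr_haar_pscale)
qed

lemma
  assumes "f \<in> L2"
  shows L2_translate: "(\<lambda>x. f (x - a)) \<in> L2"
    and l2sq_translate: "l2sq (\<lambda>x. f (x - a)) = l2sq f"
    and L2_pscale: "(\<lambda>x. f (pscale s x)) \<in> L2"
    and l2sq_pscale: "l2sq (\<lambda>x. f (pscale s (x::'p::prime_card padic))) = real CARD('p) powi s * l2sq f"
proof -
  note [measurable] = L2D(1)[OF assms]
  have m: "(\<lambda>x. (cmod (f x))\<^sup>2) \<in> borel_measurable haar" by measurable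
  show "(\<lambda>x. f (x - a)) \<in> L2" "(\<lambda>x. f (pscale s x)) \<in> L2"
    using assms integrable_haar_diff[OF m, of a] integrable_haar_pscale[OF m, of s] by (simp_all add: L2_def)
  show "l2sq (\<lambda>x. f (x - a)) = l2sq f"
    "l2sq (\<lambda>x. f (pscale s x)) = real CARD('p) powi s * l2sq f"
    using integral_haar_diff[OF m, of a] integral_haar_pscale[OF m, of s] by (simp_all add: l2sq_def)
qed

lemma l2_closure_pscale_mem:
  assumes "S \<subseteq> L2" "f \<in> l2_closure S"
  shows "(\<lambda>x. f (pscale s x)) \<in> l2_closure ((\<lambda>g x. g (pscale s x)) ` S)"
  unfolding l2_closure_iff
proof (intro conjI allI impI)
  have f: "f \<in> L2" using assms(2) by (simp add: l2_closure_iff)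
  then show "(\<lambda>x. f (pscale s x)) \<in> L2" by (rule L2_pscale)
  fix e :: real assume "0 < e"
  then have "0 < e / real CARD('a) powi s"
    by (intro divide_pos_pos base_powi_pos)
  then obtain g where g: "g \<in> S" "l2sq (\<lambda>x. f x - g x) < e / real CARD('a) powi s"
    using assms(2) unfolding l2_closure_iff by blast
  have "l2sq (\<lambda>x. f (pscale s x) - g (pscale s x)) = real CARD('a) powi s * l2sq (\<lambda>x. f x - g x)"
    using f g assms(1) by (intro l2sq_pscale L2_diff) auto
  also have "\<dots> < e"
    using g(2) base_powi_pos[of s, where ?'p='a] by (simp add: pos_less_divide_eq mult.commute)
  finally show "\<exists>g\<in>(\<lambda>g x. g (pscale s x)) ` S. l2sq (\<lambda>x. f (pscale s x) - g x) < e"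
    by (intro bexI[OF _ imageI[OF g(1)]])
qed

lemma l2_closure_pscale_iff:
  assumes "S \<subseteq> L2"
  shows "(\<lambda>x. f (pscale s x)) \<in> l2_closure ((\<lambda>g x. g (pscale s x)) ` S) \<longleftrightarrow> f \<in> l2_closure S"
proof
  assume *: "(\<lambda>x. f (pscale s x)) \<in> l2_closure ((\<lambda>g x. g (pscale s x)) ` S)"
  have "(\<lambda>g x. g (pscale s x)) ` S \<subseteq> L2"
    using assms L2_pscale by blast
  from l2_closure_pscale_mem[OF this *, of "- s"] show "f \<in> l2_closure S"
    by (simp add: image_image)
qed (rule l2_closure_pscale_mem[OF assms])

lemma l2sq_eq_0_iff: "f \<in> L2 \<Longrightarrow> l2sq f = 0 \<longleftrightarrow> (AE x in haar. f x = 0)"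
  unfolding l2sq_def by (subst integral_nonneg_eq_0_iff_AE) (auto dest: L2D)

text \<open>A ball has infinitely many disjoint translates, so a translation invariant function
  with positive norm on it cannot be square integrable.\<close>
lemma L2_translation_invariant_eq_0:
  fixes f :: "'p::prime_card padic \<Rightarrow> complex"
  assumes f: "f \<in> L2" and inv: "\<And>u. AE x in haar. f (x - u) = f x"
  shows "AE x in haar. f x = 0"
proof -
  note [measurable] = L2D(1)[OF f]
  have *: "AE x in haar. indicator (pball g 0) x * (cmod (f x))\<^sup>2 = 0" for g
  proof -
    define h where "h = (\<lambda>x. (cmod (f x))\<^sup>2)"
    have h: "integrable haar h" "\<And>x. 0 \<le> h x"
      using L2D(2)[OF f] by (simp_all add: h_def)
    have hm [measurable]: "h \<in> borel_measurable haar" unfolding h_def by measurable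
    have int_ball: "integrable haar (\<lambda>x. indicator (pball k a) x * h x)" for k a
      using integrable_mult_indicator[OF pball_in_sets h(1), of k a] by simp
    define I where "I = (LINT x|haar. indicator (pball g 0) x * h x)"
    have I: "(LINT x|haar. indicator (pball g u) x * h x) = I" for u
    proof -
      have "(LINT x|haar. indicator (pball g u) x * h x) = (LINT x|haar. indicator (pball g 0) (x - u) * h (x - u))"
      proof (rule integral_cong_AE)
        show "AE x in haar. indicator (pball g u) x * h x = indicator (pball g 0) (x - u) * h (x - u)"
          using inv[of u]
        proof eventually_elim
          case (elim x)
          then show ?case
            by (simp add: h_def indicator_def pball_translate_diff)
        qed
      qed measurable
      also have "\<dots> = I"
        unfolding I_def by (rule integral_haar_diff[of "\<lambda>x. indicator (pball g 0) x * h x" u]) measurable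
      finally show ?thesis .
    qed
    \<comment> \<open>The centre p^(-(g+1+m)) has its only nonzero digit at an index below -g, among
      those that a ball of radius p^g compares. Distinct m therefore give disjoint balls.\<close>
    define B where "B m = pball g (pgrid (g + 1 + int m) 1 :: 'p padic)" for m :: nat
    have digB: "digit (pgrid K 1 :: 'p padic) k = (if k = - K then 1 else 0)" for K k
    proof -
      have "digit (pnat 1 :: 'p padic) j = (if j = 0 then 1 else 0)" for j
      proof -
        have "1 div CARD('p) ^ nat j = 0" if "0 < j"
          using one_less_power[OF card_gt_1[where ?'p='p], of "nat j"] that by simp
        then show ?thesis
          unfolding pnat_def
          by (subst digit_Abs[where K=0]) (use card_gt_1[where ?'p='p] in auto)
      qed
      moreover have "(pgrid K 1 :: 'p padic) = pscale (- K) (pnat 1)"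
        by (simp add: pnat_eq_pgrid)
      ultimately show ?thesis by simp
    qed
    have disj: "B m \<inter> B n = {}" if "m \<noteq> n" for m n
    proof (rule ccontr)
      assume "B m \<inter> B n \<noteq> {}"
      then obtain x where x: "x \<in> B m" "x \<in> B n" by blast
      have "- (g + 1 + int m) < - g" by simp
      then have "digit (pgrid (g + 1 + int m) 1 :: 'p padic) (- (g + 1 + int m))
          = digit (pgrid (g + 1 + int n) 1 :: 'p padic) (- (g + 1 + int m))"
        using x unfolding B_def mem_pball by metis
      then show False
        using that by (simp add: digB)
    qed
    have le: "real n * I \<le> integral\<^sup>L haar h" for n
    proof -
      have "real n * I = (\<Sum>m<n. LINT x|haar. indicator (B m) x * h x)"
        by (simp add: B_def I)
      also have "\<dots> = (LINT x|haar. (\<Sum>m<n. indicator (B m) x * h x))"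
        unfolding B_def by (intro Bochner_Integration.integral_sum[symmetric] int_ball)
      also have "\<dots> \<le> integral\<^sup>L haar h"
      proof (rule integral_mono)
        show "integrable haar (\<lambda>x. \<Sum>m<n. indicator (B m) x * h x)"
          unfolding B_def by (intro Bochner_Integration.integrable_sum int_ball)
        show "(\<Sum>m<n. indicator (B m) x * h x) \<le> h x" for x
        proof -
          have "(\<Sum>m<n. indicator (B m) x :: real) = indicator (\<Union>m<n. B m) x"
            using disj by (intro sum_indicator_disjoint) (auto simp: disjoint_family_on_def)
          also have "\<dots> \<le> 1" by (simp add: indicator_def)
          finally have "(\<Sum>m<n. indicator (B m) x :: real) * h x \<le> 1 * h x"
            using h(2) by (intro mult_right_mono)
          then show ?thesis by (simp add: sum_distrib_right)
        qed
      qed (rule h(1))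
      finally show ?thesis .
    qed
    have "0 \<le> I" unfolding I_def using h(2) by simp
    moreover have "\<not> 0 < I"
      using le reals_Archimedean3[of I] by (meson not_less)
    ultimately have "I = 0" by simp
    then show ?thesis
      unfolding I_def h_def[symmetric]
      by (subst (asm) integral_nonneg_eq_0_iff_AE[OF int_ball]) (use h(2) in \<open>simp_all add: h_def\<close>)
  qed
  \<comment> \<open>Countably many balls exhaust the space, so the exceptional null sets can be
    united.\<close>
  have "AE x in haar. \<forall>G::nat. indicator (pball (int G) 0) x * (cmod (f x))\<^sup>2 = 0"
    unfolding AE_all_countable using * by blast
  then show ?thesis
  proof eventually_elim
    case (elim x)
    then show ?case using pball_exhaust[of x] by (auto simp: indicator_def)
  qed
qed

section \<open>Finite Fourier analysis\<close>

definition unity_root :: "nat \<Rightarrow> int \<Rightarrow> complex" where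
  "unity_root P a = cis (2 * pi * of_int a / real P)"

lemma unity_root_add: "unity_root P (a + b) = unity_root P a * unity_root P b"
  by (simp add: unity_root_def cis_mult distrib_left add_divide_distrib)

lemma unity_root_0 [simp]: "unity_root P 0 = 1"
  by (simp add: unity_root_def)

lemma unity_root_neq_0 [simp]: "unity_root P a \<noteq> 0"
  by (simp add: unity_root_def)

lemma unity_root_power: "unity_root P a ^ n = unity_root P (a * int n)"
  by (simp add: unity_root_def Complex.DeMoivre mult_ac)

lemma unity_root_eq_1_iff:
  assumes "0 < P"
  shows "unity_root P a = 1 \<longleftrightarrow> int P dvd a"
proof
  assume "unity_root P a = 1"
  then obtain n where "2 * pi * of_int a / real P = of_int n * (2 * pi)"
    unfolding unity_root_def cis_eq_1_iff by blast
  then have "real_of_int a = of_int (n * int P)"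
    using assms by (simp add: field_simps)
  then show "int P dvd a"
    by (simp only: of_int_eq_iff) simp
next
  assume "int P dvd a"
  then obtain n where "a = int P * n" ..
  then show "unity_root P a = 1"
    unfolding unity_root_def cis_eq_1_iff using assms by (intro exI[of _ n]) simp
qed

lemma unity_root_eq_iff:
  assumes "0 < P"
  shows "unity_root P a = unity_root P b \<longleftrightarrow> int P dvd a - b"
proof -
  have "unity_root P a = unity_root P (a - b) * unity_root P b"
    by (simp flip: unity_root_add)
  then show ?thesis
    using unity_root_eq_1_iff[OF assms, of "a - b"] by simp
qed

lemma unity_root_refine: "0 < K \<Longrightarrow> unity_root (K * P) (int K * a) = unity_root P a"
  by (simp add: unity_root_def mult.assoc)

lemma sum_unity_root:
  assumes "0 < P"
  shows "(\<Sum>m<P. unity_root P (a * int m)) = (if int P dvd a then of_nat P else 0)"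
proof (cases "int P dvd a")
  case True
  then have "unity_root P (a * int m) = 1" for m
    using unity_root_eq_1_iff[OF assms, of "a * int m"] by simp
  then show ?thesis using True by simp
next
  case False
  have "(\<Sum>m<P. unity_root P a ^ m) = (unity_root P a ^ P - 1) / (unity_root P a - 1)"
    by (rule geometric_sum) (use False unity_root_eq_1_iff[OF assms] in auto)
  moreover have "unity_root P a ^ P = 1"
    using unity_root_eq_1_iff[OF assms, of "a * int P"] by (simp add: unity_root_power)
  ultimately show ?thesis
    using False by (simp add: unity_root_power)
qed

section \<open>The discrete Fourier transform\<close>

definition dft :: "nat \<Rightarrow> (int \<Rightarrow> complex) \<Rightarrow> int \<Rightarrow> complex" where
  "dft P c l = (\<Sum>m<P. unity_root P (l * int m) * c (int m))"

text \<open>Fourier inversion: pairing the transform with the conjugate roots recovers P c(m), by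
  orthogonality of the roots of unity.\<close>

lemma dft_inj:
  assumes "\<And>l. l < P \<Longrightarrow> dft P c (int l) = 0" "m < P"
  shows "c (int m) = 0"
proof -
  have P: "0 < P" using assms(2) by simp
  have "0 = (\<Sum>l<P. unity_root P (- (int l * int m)) * dft P c (int l))"
    using assms(1) by simp
  also have "\<dots> = (\<Sum>l<P. \<Sum>n<P. unity_root P ((int n - int m) * int l) * c (int n))"
  proof -
    have "unity_root P (- (int l * int m)) * unity_root P (int l * int n)
        = unity_root P ((int n - int m) * int l)" for l n
      unfolding unity_root_add[symmetric] by (simp add: algebra_simps)
    then show ?thesis
      unfolding dft_def sum_distrib_left mult.assoc[symmetric] by simp
  qed
  also have "\<dots> = (\<Sum>n<P. \<Sum>l<P. unity_root P ((int n - int m) * int l) * c (int n))"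
    by (rule sum.swap)
  also have "\<dots> = (\<Sum>n<P. (if int P dvd int n - int m then of_nat P else 0) * c (int n))"
    by (simp only: sum_distrib_right[symmetric] sum_unity_root[OF P])
  also have "\<dots> = (\<Sum>n<P. if n = m then of_nat P * c (int n) else 0)"
  proof (intro sum.cong refl)
    fix n assume "n \<in> {..<P}"
    then have "int P dvd int n - int m \<longleftrightarrow> n = m"
      using assms(2) by (simp flip: mod_eq_dvd_iff)
    then show "(if int P dvd int n - int m then of_nat P else 0) * c (int n) = (if n = m then of_nat P * c (int n) else 0)"
      by simp
  qed
  also have "\<dots> = of_nat P * c (int m)"
    using assms(2) by simp
  finally show ?thesis
    using P by simp
qed

lemma sum_periodic_shift:
  fixes g :: "int \<Rightarrow> complex"
  assumes "\<And>m. g (m + int P) = g m"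
  shows "(\<Sum>m<P. g (int m - k)) = (\<Sum>m<P. g (int m))"
proof -
  have up: "(\<Sum>m<P. g (int m - (k + 1))) = (\<Sum>m<P. g (int m - k))" for k
  proof (cases P)
    case (Suc n)
    have "(\<Sum>m<Suc n. g (int m - (k + 1))) = g (- 1 - k) + (\<Sum>m<n. g (int m - k))"
      by (subst sum.lessThan_Suc_shift) (simp add: algebra_simps)
    also have "g (- 1 - k) = g (int n - k)"
      using assms[of "- 1 - k"] Suc by (simp add: algebra_simps)
    also have "g (int n - k) + (\<Sum>m<n. g (int m - k)) = (\<Sum>m<Suc n. g (int m - k))"
      by simp
    finally show ?thesis using Suc by simp
  qed simp
  show ?thesis
  proof (induction k rule: int_induct[where k=0])
    case (step2 i)
    then show ?case using up[of "i - 1"] by simp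
  qed (use up in auto)
qed

lemma periodic_mult:
  fixes c :: "int \<Rightarrow> complex"
  assumes "\<And>m. c (m + int P) = c m"
  shows "c (m + int P * t) = c m"
proof (induction t rule: int_induct[where k=0])
  case (step1 i)
  then show ?case using assms[of "m + int P * i"] by (simp add: algebra_simps)
next
  case (step2 i)
  then show ?case using assms[of "m + int P * (i - 1)"] by (simp add: algebra_simps)
qed simp

lemma dft_shift:
  assumes "0 < P" "\<And>m. c (m + int P) = c m"
  shows "dft P (\<lambda>m. c (m - k)) l = unity_root P (l * k) * dft P c l"
proof -
  define g where "g m = unity_root P (l * (m + k)) * c m" for m
  have per: "g (m + int P) = g m" for m
  proof -
    have "unity_root P (l * (m + int P + k)) = unity_root P (l * (m + k))"
      unfolding unity_root_eq_iff[OF assms(1)] by (simp add: algebra_simps)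
    then show ?thesis by (simp add: g_def assms(2))
  qed
  have "dft P (\<lambda>m. c (m - k)) l = (\<Sum>m<P. g (int m - k))"
    by (simp add: dft_def g_def)
  also have "\<dots> = (\<Sum>m<P. g (int m))"
    by (rule sum_periodic_shift[of g P, OF per])
  also have "\<dots> = unity_root P (l * k) * dft P c l"
    unfolding dft_def g_def sum_distrib_left
    by (intro sum.cong refl) (simp add: distrib_left unity_root_add mult_ac)
  finally show ?thesis .
qed

lemma dft_sum: "dft P (\<lambda>m. \<Sum>i\<in>I. b i * c i m) l = (\<Sum>i\<in>I. b i * dft P (c i) l)"
  unfolding dft_def sum_distrib_left
  by (subst sum.swap) (simp add: mult_ac)

lemma dft_diff: "dft P (\<lambda>m. c m - d m) l = dft P c l - dft P d l"
  by (simp add: dft_def right_diff_distrib sum_subtractf)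

text \<open>Each new node is served by a multiple of the product over the old nodes, which leaves
  the old values alone. The degree bound is phrased by vanishing coefficients so that it has a
  meaning for empty \<open>A\<close>, where q must be zero.\<close>

lemma interpolation_exists:
  fixes f :: "'a::field \<Rightarrow> 'a"
  assumes "finite A"
  shows "\<exists>q. (\<forall>i\<ge>card A. coeff q i = 0) \<and> (\<forall>a\<in>A. poly q a = f a)"
  using assms
proof (induction A rule: finite_induct)
  case empty
  then show ?case by (intro exI[of _ 0]) simp
next
  case (insert a A)
  then obtain q where q: "\<forall>i\<ge>card A. coeff q i = 0" "\<forall>a\<in>A. poly q a = f a" by blast
  define r where "r = (\<Prod>b\<in>A. [:- b, 1:])"
  have r0: "poly r b = 0 \<longleftrightarrow> b \<in> A" for b
    using insert(1) by (auto simp: r_def poly_prod)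
  have deg: "degree r = card A"
    unfolding r_def by (subst degree_prod_eq_sum_degree) auto
  define q' where "q' = q + smult ((f a - poly q a) / poly r a) r"
  have "coeff q' i = 0" if "i \<ge> card (insert a A)" for i
    using that insert(1,2) q(1) coeff_eq_0[of r i] deg by (simp add: q'_def)
  moreover have "poly q' b = f b" if "b \<in> insert a A" for b
    using that insert(2) q(2) r0[of b] by (auto simp: q'_def)
  ultimately show ?case by blast
qed

text \<open>Shifting by k multiplies the transform by a k-th power, so a polynomial of degree less than n
  that interpolates the quotient of the two transforms gives the coefficients.\<close>
lemma dft_support_span:
  assumes P: "0 < P" and c: "\<And>m. c (m + int P) = c m"
    and card: "card {l. l < P \<and> dft P c (int l) \<noteq> 0} \<le> n"
    and h: "\<And>l. l < P \<Longrightarrow> dft P c (int l) = 0 \<Longrightarrow> dft P h (int l) = 0"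
  shows "\<exists>b. \<forall>m<P. h (int m) = (\<Sum>k<n. b k * c (int m - int k))"
proof -
  define L where "L = {l. l < P \<and> dft P c (int l) \<noteq> 0}"
  have inj: "inj_on (\<lambda>l. unity_root P (int l)) {..<P}"
  proof (rule inj_onI)
    fix l k assume "l \<in> {..<P}" "k \<in> {..<P}" "unity_root P (int l) = unity_root P (int k)"
    then show "l = k"
      by (simp add: unity_root_eq_iff[OF P] flip: mod_eq_dvd_iff)
  qed
  have injL: "inj_on (\<lambda>l. unity_root P (int l)) L"
    by (rule inj_on_subset[OF inj]) (auto simp: L_def)
  define A where "A = (\<lambda>l. unity_root P (int l)) ` L"
  have cardA: "card A \<le> n" "finite A"
    using card card_image[OF injL] by (simp_all add: A_def L_def)
  \<comment> \<open>The prescribed value at the root of index l is the quotient of the two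
    transforms at l. The index can be read back from the root, as distinct frequencies below P have
    distinct roots.\<close>
  define f where "f z = dft P h (int (the_inv_into L (\<lambda>l. unity_root P (int l)) z))
      / dft P c (int (the_inv_into L (\<lambda>l. unity_root P (int l)) z))" for z
  obtain q where q: "\<forall>i\<ge>card A. coeff q i = 0" "\<forall>a\<in>A. poly q a = f a"
    using interpolation_exists[OF cardA(2)] by blast
  have pq: "poly q z = (\<Sum>k<n. coeff q k * z ^ k)" for z
    unfolding poly_altdef
  proof (rule sum.mono_neutral_cong)
    show "coeff q i * z ^ i = 0" if "i \<in> {..degree q} - {..<n}" for i
      using that q(1) cardA(1) by simp
    show "coeff q i * z ^ i = 0" if "i \<in> {..<n} - {..degree q}" for i
      using that by (simp add: coeff_eq_0)
  qed auto
  have "dft P (\<lambda>m. h m - (\<Sum>k<n. coeff q k * c (m - int k))) (int l) = 0" if "l < P" for l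
  proof -
    have "dft P (\<lambda>m. h m - (\<Sum>k<n. coeff q k * c (m - int k))) (int l)
        = dft P h (int l) - (\<Sum>k<n. coeff q k * (unity_root P (int l * int k) * dft P c (int l)))"
      unfolding dft_diff dft_sum by (simp only: dft_shift[of P c, OF P c])
    also have "\<dots> = dft P h (int l) - poly q (unity_root P (int l)) * dft P c (int l)"
      unfolding pq sum_distrib_right by (simp add: unity_root_power mult_ac)
    also have "\<dots> = 0"
    proof (cases "l \<in> L")
      case True
      then have "poly q (unity_root P (int l)) = dft P h (int l) / dft P c (int l)"
        using q(2) the_inv_into_f_f[OF injL True] by (simp add: A_def f_def)
      then show ?thesis using True by (simp add: L_def)
    next
      case False
      then show ?thesis using that h[OF that] by (simp add: L_def)
    qed
    finally show ?thesis .
  qed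
  from dft_inj[of P, OF this] show ?thesis
    by (intro exI[of _ "coeff q"]) auto
qed

lemma sum_mult_index:
  fixes f :: "nat \<Rightarrow> complex"
  assumes "0 < P"
  shows "(\<Sum>n<P * T. f n) = (\<Sum>m<P. \<Sum>t<T. f (m + P * t))"
proof -
  have "(\<Sum>n<P * T. f n) = (\<Sum>(m, t)\<in>{..<P} \<times> {..<T}. f (m + P * t))"
  proof (rule sum.reindex_bij_witness[of _ "\<lambda>(m, t). m + P * t" "\<lambda>n. (n mod P, n div P)"])
    fix n assume "n \<in> {..<P * T}"
    then show "(n mod P, n div P) \<in> {..<P} \<times> {..<T}"
      using assms by (simp add: less_mult_imp_div_less mult.commute)
  next
    fix x assume "x \<in> {..<P} \<times> {..<T}"
    then obtain m t where x: "x = (m, t)" "m < P" "t < T" by auto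
    have "m + P * t < P * (t + 1)" using x by simp
    also have "\<dots> \<le> P * T" using x by (intro mult_left_mono) auto
    finally show "(case x of (m, t) \<Rightarrow> m + P * t) \<in> {..<P * T}" using x by simp
  qed (use assms in auto)
  then show ?thesis
    by (simp add: sum.cartesian_product)
qed

text \<open>Comparing transforms of length P * P exhibits, for each nonzero frequency r in the support of
  the transform of c, the P roots of unity of order P * P with index congruent to r modulo P as zeros
  of the nonzero polynomial with coefficients a, whose degree is less than R * P.\<close>
lemma dft_support_card_le:
  assumes P: "0 < P" and c: "\<And>m. c (m + int P) = c m"
    and refine: "\<And>n. c n = (\<Sum>k<R * P. a k * (if int P dvd n - int k then c ((n - int k) div int P) else 0))"
    and nz: "dft P c 0 \<noteq> 0"
  shows "card {l. l < P \<and> dft P c (int l) \<noteq> 0} \<le> R"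
proof -
  define Q where "Q = P * P"
  have Q: "0 < Q" using P by (simp add: Q_def)
  define L where "L = {l. l < P \<and> dft P c (int l) \<noteq> 0}"
  \<comment> \<open>The values of \<open>c\<close> spread out, with P - 1 zeros after each of them:
    the samples of the dilated function. The period P of \<open>c\<close> becomes Q.\<close>
  define e where "e n = (if int P dvd n then c (n div int P) else 0)" for n
  have e_per: "e (n + int Q) = e n" for n
  proof (cases "int P dvd n")
    case True
    then obtain i where "n = int P * i" ..
    then have "n + int Q = int P * (i + int P)" "n div int P = i"
      using P by (simp_all add: Q_def algebra_simps)
    then show ?thesis using P True by (simp add: e_def c)
  next
    case False
    then have "\<not> int P dvd n + int Q" by (simp add: Q_def dvd_add_left_iff)
    then show ?thesis using False by (simp add: e_def)
  qed
  \<comment> \<open>Only indices P t contribute, and there the roots of order Q are roots of order P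
    with index t.\<close>
  have dft_e: "dft Q e l = dft P c l" for l
  proof -
    have "dft Q e l = (\<Sum>m<P. \<Sum>t<P. unity_root Q (l * int (m + P * t)) * e (int (m + P * t)))"
      unfolding dft_def Q_def by (rule sum_mult_index[OF P])
    also have "\<dots> = (\<Sum>m<P. if m = 0 then dft P c l else 0)"
    proof (rule sum.cong[OF refl])
      fix m assume "m \<in> {..<P}"
      then have m: "int P dvd int (m + P * t) \<longleftrightarrow> m = 0" for t
        by (metis dvd_add_left_iff dvd_triv_left int_dvd_int_iff lessThan_iff nat_dvd_not_less neq0_conv dvd_0_right)
      have "unity_root Q (l * int (P * t)) = unity_root P (l * int t)" for t
        using unity_root_refine[OF P, of P "l * int t"] by (simp add: Q_def mult_ac)
      then show "(\<Sum>t<P. unity_root Q (l * int (m + P * t)) * e (int (m + P * t)))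
          = (if m = 0 then dft P c l else 0)"
        using P m unfolding e_def dft_def by simp
    qed
    also have "\<dots> = dft P c l" using P by simp
    finally show ?thesis .
  qed
  define A where "A = (\<Sum>k<R * P. monom (a k) k)"
  have poly_A: "poly A z = (\<Sum>k<R * P. a k * z ^ k)" for z
    by (simp add: A_def poly_sum poly_monom)
  have D: "dft Q c l = poly A (unity_root Q l) * dft P c l" for l
  proof -
    have "dft Q c l = dft Q (\<lambda>n. \<Sum>k<R * P. a k * e (n - int k)) l"
      unfolding e_def using refine by (intro arg_cong[where f="\<lambda>c. dft Q c l"] ext)
    also have "\<dots> = (\<Sum>k<R * P. a k * (unity_root Q (l * int k) * dft Q e l))"
      unfolding dft_sum by (simp only: dft_shift[of Q e, OF Q e_per])
    finally show ?thesis
      by (simp add: poly_A dft_e sum_distrib_right sum_distrib_left unity_root_power mult_ac)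
  qed
  \<comment> \<open>Over the length Q the sequence \<open>c\<close> runs through P equal periods.
    Summing over these periods gives a full sum of roots of unity of order P, which vanishes unless
    P divides l.\<close>
  have D': "dft Q c l = (if int P dvd l then of_nat P * (\<Sum>m<P. unity_root Q (l * int m) * c (int m)) else 0)" for l
  proof -
    have root: "unity_root Q (l * int (m + P * t)) = unity_root Q (l * int m) * unity_root P (l * int t)" for m t
      using unity_root_refine[OF P, of P "l * int t"]
      by (simp add: Q_def distrib_left unity_root_add mult_ac)
    have "dft Q c l = (\<Sum>m<P. \<Sum>t<P. unity_root Q (l * int (m + P * t)) * c (int (m + P * t)))"
      unfolding dft_def Q_def by (rule sum_mult_index[OF P])
    also have "\<dots> = (\<Sum>m<P. unity_root Q (l * int m) * c (int m) * (\<Sum>t<P. unity_root P (l * int t)))"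
      using periodic_mult[of c P, OF c] unfolding root sum_distrib_left by (simp add: mult_ac)
    finally show ?thesis
      unfolding sum_unity_root[OF P] by (auto simp: sum_distrib_right sum_distrib_left mult_ac)
  qed
  \<comment> \<open>The nonzero value at frequency 0 shows that \<open>A\<close> is not the zero
    polynomial, so its zeros can be counted.\<close>
  have "dft Q c 0 \<noteq> 0"
    using nz P unfolding D' by (simp add: dft_def)
  then have A0: "A \<noteq> 0" using D[of 0] by auto
  then have RP: "0 < R * P" by (auto simp: A_def intro!: Nat.gr0I)
  have degA: "degree A < R * P"
    using RP by (intro degree_lessI) (auto simp: A_def coeff_sum)
  define Z where "Z = (\<lambda>(r, t). unity_root Q (int (r + P * t))) ` ((L - {0}) \<times> {..<P})"
  have Z_roots: "Z \<subseteq> {z. poly A z = 0}"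
  proof
    fix z assume "z \<in> Z"
    then obtain r t where z: "z = unity_root Q (int (r + P * t))" "r \<in> L" "r \<noteq> 0" "t < P"
      by (auto simp: Z_def)
    \<comment> \<open>At the index r + P t with 0 < r < P, the left side of \<open>D\<close>
      vanishes by \<open>D'\<close>, whereas the transform of \<open>c\<close> has its nonzero value
      at r; so the polynomial vanishes. For r = 0 the left side need not vanish, and this frequency
      yields no zeros.\<close>
    have "\<not> P dvd r" using z by (auto simp: L_def dest: dvd_imp_le)
    then have ndvd: "\<not> int P dvd int (r + P * t)"
      unfolding int_dvd_int_iff by (simp add: dvd_add_left_iff)
    have "unity_root P (int (r + P * t) * int m) = unity_root P (int r * int m)" for m
      unfolding unity_root_eq_iff[OF P] by (simp add: algebra_simps)
    then have "dft P c (int (r + P * t)) = dft P c (int r)"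
      unfolding dft_def by simp
    then have "dft P c (int (r + P * t)) \<noteq> 0" using z by (simp add: L_def)
    then show "z \<in> {z. poly A z = 0}"
      using D[of "int (r + P * t)"] D'[of "int (r + P * t)"] ndvd z by simp
  qed
  have "inj_on (\<lambda>(r, t). unity_root Q (int (r + P * t))) ((L - {0}) \<times> {..<P})"
  proof (rule inj_onI)
    fix x y
    assume xy: "x \<in> (L - {0}) \<times> {..<P}" "y \<in> (L - {0}) \<times> {..<P}"
      "(case x of (r, t) \<Rightarrow> unity_root Q (int (r + P * t))) = (case y of (r, t) \<Rightarrow> unity_root Q (int (r + P * t)))"
    obtain r t s u where rs: "x = (r, t)" "y = (s, u)" by fastforce
    then have lt: "r < P" "s < P" "t < P" "u < P" using xy by (auto simp: L_def)
    have less: "i + P * j < Q" if "i < P" "j < P" for i j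
    proof -
      have "i + P * j < P * (j + 1)" using that by simp
      also have "\<dots> \<le> P * P" using that by (intro mult_left_mono) auto
      finally show ?thesis by (simp add: Q_def)
    qed
    have "int Q dvd int (r + P * t) - int (s + P * u)"
      using xy(3) rs unity_root_eq_iff[OF Q] by simp
    then have "int (r + P * t) mod int Q = int (s + P * u) mod int Q"
      by (simp only: mod_eq_dvd_iff)
    then have eq: "r + P * t = s + P * u"
      using less lt by (simp flip: of_nat_mod del: of_nat_add of_nat_mult)
    then have "(r + P * t) mod P = (s + P * u) mod P" "(r + P * t) div P = (s + P * u) div P" by simp_all
    then show "x = y" using lt rs by simp
  qed
  then have "card Z = card (L - {0}) * P"
    by (simp add: Z_def card_image card_cartesian_product)
  also have "card (L - {0}) = card L - 1"
    using nz P by (subst card_Diff_singleton) (auto simp: L_def)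
  finally have "card Z = (card L - 1) * P" .
  moreover have "card Z \<le> degree A"
    using card_mono[OF poly_roots_finite[OF A0] Z_roots] card_poly_roots_bound[OF A0] by linarith
  ultimately have "(card L - 1) * P < R * P" using degA by linarith
  then show ?thesis unfolding L_def[symmetric] by auto
qed

text \<open>The induction on the points of evaluation replaces an argument by dimension.\<close>
lemma csubspace_finite_closed:
  assumes "finite X" "csubspace V"
    and "\<And>e. 0 < e \<Longrightarrow> \<exists>g\<in>V. \<forall>x\<in>X. cmod (f x - g x) < e"
  shows "\<exists>g\<in>V. \<forall>x\<in>X. f x = g x"
  using assms
proof (induction X arbitrary: V f rule: finite_induct)
  case empty
  then show ?case using csubspaceD(1) by blast
next
  case (insert x0 X)
  show ?case
  proof (cases "\<forall>g\<in>V. g x0 = 0")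
    case True
    have "cmod (f x0) < e" if "0 < e" for e
      using insert.prems(2)[OF that] True by auto
    then have "f x0 = 0"
      by (metis norm_le_zero_iff not_less order_less_irrefl)
    moreover have "\<exists>g\<in>V. \<forall>x\<in>X. f x = g x"
      by (rule insert.IH[OF insert.prems(1)]) (use insert.prems(2) in blast)
    ultimately show ?thesis using True by auto
  next
    case False
    then obtain h0 where h0: "h0 \<in> V" "h0 x0 \<noteq> 0" by blast
    \<comment> \<open>A member of \<open>V\<close> with value 1 at x0 splits off the value there:
      what remains after subtracting its multiple vanishes at x0, and the induction hypothesis
      applies to the subspace of such functions.\<close>
    define h where "h x = inverse (h0 x0) * h0 x" for x
    have h: "h \<in> V" "h x0 = 1"
      using csubspaceD(3)[OF insert.prems(1) h0(1), of "inverse (h0 x0)"] h0 by (simp_all add: h_def[abs_def])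
    define W where "W = {g \<in> V. g x0 = 0}"
    have W: "csubspace W"
      using insert.prems(1) by (auto simp: csubspace_def W_def)
    have red: "(\<lambda>x. g x - g x0 * h x) \<in> W" if "g \<in> V" for g
      using csubspace_diff[OF insert.prems(1) that csubspaceD(3)[OF insert.prems(1) h(1)]] h(2)
      by (simp add: W_def)
    \<comment> \<open>The constant makes the errors add up: e / B at x, and e / B at x0 multiplied
      by |h x| \<le> B - 1.\<close>
    define B where "B = 1 + (\<Sum>x\<in>X. cmod (h x))"
    have B: "cmod (h x) \<le> B - 1" if "x \<in> X" for x
      unfolding B_def using insert.hyps(1) that by (auto intro!: member_le_sum[where f="\<lambda>x. cmod (h x)"])
    have B1: "1 \<le> B" by (simp add: B_def sum_nonneg)
    have "\<exists>g\<in>W. \<forall>x\<in>X. f x - f x0 * h x = g x"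
    proof (rule insert.IH[OF W])
      fix e :: real assume "0 < e"
      then have "0 < e / B" using B1 by simp
      then obtain g where g: "g \<in> V" "\<forall>x\<in>insert x0 X. cmod (f x - g x) < e / B"
        using insert.prems(2) by blast
      have "cmod (f x - f x0 * h x - (g x - g x0 * h x)) < e" if "x \<in> X" for x
      proof -
        have "cmod (f x - f x0 * h x - (g x - g x0 * h x)) = cmod ((f x - g x) - (f x0 - g x0) * h x)"
          by (simp add: algebra_simps)
        also have "\<dots> \<le> cmod (f x - g x) + cmod (f x0 - g x0) * cmod (h x)"
          by (metis norm_triangle_ineq4 norm_mult)
        also have "\<dots> \<le> cmod (f x - g x) + e / B * (B - 1)"
          using g(2) B[OF that] B1 \<open>0 < e / B\<close> by (intro add_left_mono mult_mono) (auto intro: less_imp_le)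
        also have "\<dots> < e / B + e / B * (B - 1)" using g(2) that by simp
        also have "\<dots> = e / B * B" by (simp add: right_diff_distrib)
        also have "\<dots> = e" using B1 by simp
        finally show ?thesis .
      qed
      then show "\<exists>g\<in>W. \<forall>x\<in>X. cmod (f x - f x0 * h x - g x) < e"
        by (intro bexI[OF _ red[OF g(1)]] ballI)
    qed
    then obtain g where g: "g \<in> W" "\<forall>x\<in>X. f x - f x0 * h x = g x" by blast
    have "(\<lambda>x. g x + f x0 * h x) \<in> V"
      using g(1) by (intro csubspaceD(2)[OF insert.prems(1)] csubspaceD(3)[OF insert.prems(1)] h(1)) (simp add: W_def)
    moreover have "\<forall>x\<in>insert x0 X. f x = g x + f x0 * h x"
      using g h(2) by (auto simp: W_def algebra_simps)
    ultimately show ?thesis by (intro bexI[of _ "\<lambda>x. g x + f x0 * h x"])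
  qed
qed

section \<open>Test functions\<close>

text \<open>The working form of D_N^M, with invariance under the whole subgroup B_(-M)(0) in place
  of one period. It reduces a function to one value on each of the p^(N+M) balls of radius p^(-M) in
  B_N(0).\<close>

definition step_function :: "nat \<Rightarrow> nat \<Rightarrow> ('p::prime_card padic \<Rightarrow> complex) \<Rightarrow> bool" where
  "step_function N M f \<longleftrightarrow> (\<forall>x. \<forall>y\<in>pball (- int M) 0. f (x + y) = f x)
     \<and> (\<forall>x. x \<notin> pball (int N) 0 \<longrightarrow> f x = 0)"

lemma step_functionD:
  assumes "step_function N M f"
  shows "y \<in> pball (- int M) 0 \<Longrightarrow> f (x + y) = f x" "x \<notin> pball (int N) 0 \<Longrightarrow> f x = 0"
    "x \<in> pball (- int M) z \<Longrightarrow> f x = f z"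
proof -
  show *: "y \<in> pball (- int M) 0 \<Longrightarrow> f (x + y) = f x" for x y
    using assms by (simp add: step_function_def)
  show "x \<notin> pball (int N) 0 \<Longrightarrow> f x = 0"
    using assms by (simp add: step_function_def)
  show "x \<in> pball (- int M) z \<Longrightarrow> f x = f z"
    using *[of "x - z" z] by (subst (asm) mem_pball_iff_diff) simp
qed

text \<open>The multiples n p^M are dense in B_(-M)(0). One of them is so close to y that x + n p^M
  falls into the ball around x + y on which f is constant, and periodicity carries the value back to
  x.\<close>

lemma DNM_step_function:
  fixes f :: "'p::prime_card padic \<Rightarrow> complex"
  assumes "f \<in> DNM N M"
  shows "step_function N M f"
  unfolding step_function_def
proof (intro conjI allI ballI impI)
  fix x y :: "'p padic" assume y: "y \<in> pball (- int M) 0"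
  have per: "f (z + pgrid (- int M) 1) = f z" for z
  proof -
    have "pnat (CARD('p) ^ M) = (pgrid (- int M) 1 :: 'p padic)"
      using pgrid_refine[of "- int M" M 1, where ?'p='p] by (simp add: pnat_eq_pgrid)
    then show ?thesis using assms by (simp add: DNM_def)
  qed
  have per_n: "f (x + pgrid (- int M) (int n)) = f x" for n
  proof (induction n)
    case (Suc n)
    have "x + pgrid (- int M) (int (Suc n)) = (x + pgrid (- int M) (int n)) + pgrid (- int M) 1"
      using pgrid_add[of "- int M" "int n" 1, where ?'p='p] by (simp add: algebra_simps)
    then show ?case using per[of "x + pgrid (- int M) (int n)"] Suc by (simp add: add.assoc)
  qed simp
  obtain g where g: "\<forall>z\<in>pball g (x + y). f z = f (x + y)"
    using assms unfolding DNM_def test_function_def by blast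
  define H where "H = max 0 (- (g + int M))"
  have "pscale (- int M) y \<in> pball 0 0" "0 \<le> 0 + H"
    using y by (simp_all add: H_def)
  then obtain n where n: "pscale (- int M) y \<in> pball (- H) (pgrid 0 (int n))"
    by (rule pball_grid_ex)
  have "pscale (- int M) y \<in> pball (g + int M) (pgrid 0 (int n))"
  proof (rule subsetD[OF pball_mono n])
    show "- H \<le> g + int M" unfolding H_def by linarith
  qed
  then have "y \<in> pball g (pgrid (- int M) (int n))"
    by (subst (asm) pball_pscale[of "int M", symmetric]) simp
  then have "x + pgrid (- int M) (int n) \<in> pball g (x + y)"
    using pball_translate[of "pgrid (- int M) (int n)" x g y] pball_sym[of y] by (simp add: add.commute)
  then show "f (x + y) = f x"
    using g per_n by metis
next
  show "f x = 0" if "x \<notin> pball (int N) 0" for x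
    using assms that by (simp add: DNM_def)
qed

text \<open>The values \<open>d\<close> are separate from f so that the formula covers a step
  function and also its product with a character.\<close>

lemma sum_grid_indicator:
  fixes f :: "'p::prime_card padic \<Rightarrow> complex"
  assumes "\<And>x n. n < CARD('p) ^ (N + M) \<Longrightarrow> x \<in> pball (- int M) (pgrid (int N) (int n)) \<Longrightarrow> f x = d n"
    and "\<And>x. x \<notin> pball (int N) 0 \<Longrightarrow> f x = 0"
  shows "f x = (\<Sum>n<CARD('p) ^ (N + M). d n * indicator (pball (- int M) (pgrid (int N) (int n))) x)"
proof -
  have nat: "nat (int N + int M) = N + M" by simp
  note part = pball_partition[of "int N" "int M", where ?'p='p, unfolded nat]
  show ?thesis
  proof (cases "x \<in> pball (int N) 0")
    case True
    then obtain n where n: "n < CARD('p) ^ (N + M)" "x \<in> pball (- int M) (pgrid (int N) (int n))"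
      using part(1) by force
    have "(\<Sum>m<CARD('p) ^ (N + M). d m * indicator (pball (- int M) (pgrid (int N) (int m))) x)
        = (\<Sum>m<CARD('p) ^ (N + M). if m = n then d m else 0)"
    proof (intro sum.cong refl)
      fix m assume "m \<in> {..<CARD('p) ^ (N + M)}"
      then have "x \<notin> pball (- int M) (pgrid (int N) (int m))" if "m \<noteq> n"
        using part(2) n that by (auto simp: disjoint_family_on_def)
      then show "d m * indicator (pball (- int M) (pgrid (int N) (int m))) x = (if m = n then d m else 0)"
        using n by (auto simp: indicator_def)
    qed
    also have "\<dots> = f x" using n assms(1) by simp
    finally show ?thesis by simp
  next
    case False
    then have "\<forall>n<CARD('p) ^ (N + M). x \<notin> pball (- int M) (pgrid (int N) (int n))"
      using part(1) by force
    then show ?thesis using assms(2)[OF False] by (simp add: indicator_def)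
  qed
qed

lemma step_function_L2:
  fixes f :: "'p::prime_card padic \<Rightarrow> complex"
  assumes "step_function N M f"
  shows "f \<in> L2"
proof -
  have eq: "f = (\<lambda>x. \<Sum>n<CARD('p) ^ (N + M). f (pgrid (int N) (int n)) * indicator (pball (- int M) (pgrid (int N) (int n))) x)"
    by (intro ext sum_grid_indicator) (use step_functionD[OF assms] in auto)
  have "(indicator (pball g a) :: 'p padic \<Rightarrow> complex) \<in> L2" for g a
  proof (rule L2_dominated(1))
    show "integrable haar (indicator (pball g a) :: 'p padic \<Rightarrow> real)"
      by (intro integrable_indicator_haar) (simp_all add: emeasure_pball)
  qed (auto simp: indicator_def)
  then show ?thesis
    by (subst eq) (intro csubspace_sum[OF csubspace_L2])
qed

lemma step_function_translate:
  assumes "step_function N M f" "u \<in> pball (int N) 0"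
  shows "step_function N M (\<lambda>x. f (x - u))"
  unfolding step_function_def
proof (intro conjI allI ballI impI)
  show "f (x + y - u) = f (x - u)" if "y \<in> pball (- int M) 0" for x y
    using step_functionD(1)[OF assms(1) that, of "x - u"] by (simp add: algebra_simps)
  show "f (x - u) = 0" if "x \<notin> pball (int N) 0" for x
  proof -
    have "x - u \<notin> pball (int N) 0"
      using that pball_zero_add[OF _ assms(2), of "x - u"] by auto
    then show ?thesis by (rule step_functionD(2)[OF assms(1)])
  qed
qed

lemma step_function_sum:
  "(\<And>i. i \<in> I \<Longrightarrow> step_function N M (f i)) \<Longrightarrow> step_function N M (\<lambda>x. \<Sum>i\<in>I. b i * f i x)"
  unfolding step_function_def by (simp cong: sum.cong)

lemma step_function_eqI:
  fixes f g :: "'p::prime_card padic \<Rightarrow> complex"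
  assumes "step_function N M f" "step_function N M g"
    and "\<And>n. n < CARD('p) ^ (N + M) \<Longrightarrow> f (pgrid (int N) (int n)) = g (pgrid (int N) (int n))"
  shows "f x = g x"
proof (cases "x \<in> pball (int N) 0")
  case True
  then obtain n where "n < CARD('p) ^ nat (int N + int M)" "x \<in> pball (- int M) (pgrid (int N) (int n))"
    by (rule pball_grid_ex) auto
  moreover have "nat (int N + int M) = N + M" by simp
  ultimately show ?thesis
    using assms(3) step_functionD(3)[OF assms(1)] step_functionD(3)[OF assms(2)] by metis
qed (use step_functionD(2)[OF assms(1)] step_functionD(2)[OF assms(2)] in auto)

lemma step_function_grid_periodic:
  fixes f :: "'p::prime_card padic \<Rightarrow> complex"
  assumes "step_function N M f"
  shows "f (pgrid (int N) (m + int (CARD('p) ^ (N + M)))) = f (pgrid (int N) m)"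
proof -
  have "pgrid (int N) (int CARD('p) ^ (N + M) * 1) = (pgrid (- int M) 1 :: 'p padic)"
    using pgrid_refine[of "- int M" "N + M" 1, where ?'p='p] by simp
  then show ?thesis
    using step_functionD(1)[OF assms pgrid_in_pball[of "- int M" 1]] by (simp add: pgrid_add)
qed

section \<open>The character on products and the Fourier transform of a step function\<close>

lemma
  assumes "x \<noteq> (0::'p::prime_card padic)"
  shows digit_pval: "digit x (pval x) \<noteq> 0"
    and digit_less_pval: "k < pval x \<Longrightarrow> digit x k = 0"
proof -
  obtain K where K: "\<forall>k<K. digit x k = 0"
    using digit_low by blast
  obtain j where j: "digit x j \<noteq> 0"
    using assms(1) by (auto simp: padic_eq_iff)
  then have "K \<le> j" using K by (meson not_less)
  then have ex: "\<exists>n::nat. digit x (K + int n) \<noteq> 0"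
    using j by (intro exI[of _ "nat (j - K)"]) simp
  \<comment> \<open>\<open>LEAST\<close> over the integers needs a lower bound. Counted from K,
    below which all digits vanish, the least index becomes a natural number.\<close>
  define n where "n = (LEAST n::nat. digit x (K + int n) \<noteq> 0)"
  have n: "digit x (K + int n) \<noteq> 0" "\<And>m. m < n \<Longrightarrow> digit x (K + int m) = 0"
    unfolding n_def using LeastI_ex[OF ex] not_less_Least by auto
  have low: "digit x i = 0" if "i < K + int n" for i
    using K n(2)[of "nat (i - K)"] that by (cases "i < K") auto
  have "pval x = K + int n"
    unfolding pval_def
  proof (rule Least_equality)
    show "K + int n \<le> i" if "digit x i \<noteq> 0" for i
      using low[of i] that by (meson not_less)
  qed (rule n(1))
  then show "digit x (pval x) \<noteq> 0" "k < pval x \<Longrightarrow> digit x k = 0"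
    using low n(1) by simp_all
qed

text \<open>The fractional part is the truncation at index -1, and the character ignores integers.
  The member of the family at -1 thus gives the value without any computation of digits.\<close>

lemma pchi_pmk:
  assumes "coherent TYPE('p::prime_card) f"
  shows "pchi (pmk f :: 'p padic) = cis (2 * pi * f (-1))"
proof -
  let ?x = "pmk f :: 'p padic"
  have "pfrac ?x = ptrunc ?x (-1)"
    unfolding pfrac_def ptrunc_def by (intro sum.cong) auto
  moreover have "[ptrunc ?x (-1) = f (-1)] (rmod 1)"
    using ptrunc_pmk[OF assms, of "-1"] by simp
  then obtain z where "f (-1) = ptrunc ?x (-1) + of_int z"
    unfolding rcong_altdef by auto
  moreover have "cis (2 * pi * (ptrunc ?x (-1) + of_int z)) = cis (2 * pi * ptrunc ?x (-1)) * cis (of_int z * (2 * pi))"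
    by (simp add: cis_mult algebra_simps)
  moreover have "cis (of_int z * (2 * pi)) = 1" for z
    using cis_eq_1_iff by blast
  ultimately show ?thesis
    unfolding pchi_def by simp
qed

lemma rcong_mult_multiple:
  assumes "[a = b] (rmod m)"
  shows "[a * (of_int n * r) = b * (of_int n * r)] (rmod (m * r))"
proof -
  obtain z where "b = a + of_int z * m"
    using assms unfolding rcong_altdef by blast
  then have "b * (of_int n * r) = a * (of_int n * r) + of_int (z * n) * (m * r)"
    by (simp add: algebra_simps)
  then show ?thesis
    unfolding rcong_altdef by blast
qed

text \<open>Truncating x at k - pval y leaves an error divisible by p^(k - pval y + 1). As y is
  divisible by p^(pval y), the product is right modulo p^(k+1); likewise with x and y exchanged. For
  zero arguments \<open>pval\<close> would be unspecified.\<close>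

lemma coherent_pmul:
  fixes x y :: "'p::prime_card padic"
  assumes "x \<noteq> 0" "y \<noteq> 0"
  shows "coherent TYPE('p) (\<lambda>k. ptrunc x (k - pval y) * ptrunc y (k - pval x))"
  unfolding coherent_def
proof (intro conjI allI exI[of _ "pval x + pval y"] impI)
  fix k assume "k < pval x + pval y"
  then have "ptrunc x (k - pval y) = 0"
    by (intro ptrunc_low digit_less_pval[OF assms(1)]) auto
  then show "[ptrunc x (k - pval y) * ptrunc y (k - pval x) = 0] (rmod real CARD('p) powi (k + 1))"
    by simp
next
  fix k
  let ?q = "\<lambda>k. real CARD('p) powi k"
  have step: "[ptrunc z (k + 1 - v) = ptrunc z (k - v)] (rmod ?q (k - v + 1))" for z :: "'p padic" and v
  proof -
    have "[ptrunc z (k - v + 1) = ptrunc z (k - v)] (rmod ?q (k - v + 1))"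
      using coherent_ptrunc[of z] unfolding coherent_def by blast
    then show ?thesis by (simp add: algebra_simps)
  qed
  have mult: "\<exists>n::int. ptrunc z j = of_int n * ?q (pval z)" if "z \<noteq> 0" for z :: "'p padic" and j
    using ptrunc_eq_multiple[of "pval z" z j] digit_less_pval[OF that] by (metis of_int_of_nat_eq)
  obtain n where n: "ptrunc y (k + 1 - pval x) = of_int n * ?q (pval y)"
    using mult[OF assms(2)] by blast
  obtain m where m: "ptrunc x (k - pval y) = of_int m * ?q (pval x)"
    using mult[OF assms(1)] by blast
  have qq: "?q (k - pval y + 1) * ?q (pval y) = ?q (k + 1)" "?q (k - pval x + 1) * ?q (pval x) = ?q (k + 1)"
    by (simp_all flip: base_powi_add)
  have "[ptrunc x (k + 1 - pval y) * ptrunc y (k + 1 - pval x)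
      = ptrunc x (k - pval y) * ptrunc y (k + 1 - pval x)] (rmod ?q (k + 1))"
    using rcong_mult_multiple[OF step[of x "pval y"], of n "?q (pval y)"] unfolding n qq by simp
  also have "[ptrunc x (k - pval y) * ptrunc y (k + 1 - pval x)
      = ptrunc x (k - pval y) * ptrunc y (k - pval x)] (rmod ?q (k + 1))"
    using rcong_mult_multiple[OF step[of y "pval x"], of m "?q (pval x)"] unfolding m qq by (simp add: mult.commute)
  finally show "[ptrunc x (k + 1 - pval y) * ptrunc y (k + 1 - pval x)
      = ptrunc x (k - pval y) * ptrunc y (k - pval x)] (rmod ?q (k + 1))" .
qed

text \<open>In the product of the truncations the factors are replaced in turn by the rationals l /
  p^M and m / p^N. Each time the other factor is divisible by the power of p that makes the change
  an integer, which the character ignores.\<close>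

lemma pchi_pmul_grid:
  fixes x :: "'p::prime_card padic"
  assumes "x \<in> pball (- int M) (pgrid (int N) m)"
  shows "pchi (pmul (pgrid (int M) l) x) = unity_root (CARD('p) ^ (N + M)) (l * m)"
proof (cases "pgrid (int M) l = (0 :: 'p padic) \<or> x = 0")
  case True
  let ?P = "CARD('p) ^ (N + M)"
  have P: "0 < ?P" using card_gt_1[where ?'p='p] by simp
  \<comment> \<open>All truncations of a zero factor are 0, so the family is 0 whatever
    \<open>pval\<close> returns.\<close>
  have "pmul (pgrid (int M) l) x = pmk (\<lambda>_. 0)"
    unfolding pmul_def using True by (auto simp: fun_eq_iff)
  moreover have "coherent TYPE('p) (\<lambda>_. 0)"
    by (simp add: coherent_def)
  ultimately have 1: "pchi (pmul (pgrid (int M) l) x) = 1"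
    by (simp add: pchi_pmk)
  have "int ?P dvd l * m"
    using True
  proof
    assume "pgrid (int M) l = (0 :: 'p padic)"
    then have "pgrid (- int N + int (N + M)) l \<in> pball (- int N) (0 :: 'p padic)" by simp
    then show ?thesis unfolding pgrid_in_pball_iff by simp
  next
    assume "x = 0"
    then have "pgrid (- int M + int (N + M)) m \<in> pball (- int M) (0 :: 'p padic)"
      using assms pball_sym[of x] by simp
    then show ?thesis unfolding pgrid_in_pball_iff by simp
  qed
  then show ?thesis
    using 1 unity_root_eq_1_iff[OF P] by simp
next
  case False
  let ?q = "\<lambda>k. real CARD('p) powi k"
  let ?\<xi> = "pgrid (int M) l :: 'p padic"
  have nz: "?\<xi> \<noteq> 0" "x \<noteq> 0" using False by auto
  let ?L = "of_int l * ?q (- int M)" and ?X = "of_int m * ?q (- int N)"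
  obtain n where n: "ptrunc x (- 1 - pval ?\<xi>) = real n * ?q (pval x)"
    using ptrunc_eq_multiple[of "pval x" x] digit_less_pval[OF nz(2)] by blast
  have "ptrunc ?\<xi> (pval ?\<xi> - 1) = 0"
    by (rule ptrunc_low) (simp add: digit_less_pval[OF nz(1)])
  then have "[0 = ?L] (rmod ?q (pval ?\<xi>))"
    using ptrunc_pgrid[of "int M" l "pval ?\<xi> - 1", where ?'p='p] by simp
  then obtain z where z: "?L = of_int z * ?q (pval ?\<xi>)"
    unfolding rcong_altdef by auto
  \<comment> \<open>Consequently only digits of x at indices up to M - 1 enter, and there x agrees
    with m / p^N.\<close>
  have "\<not> pval ?\<xi> < - int M"
    using digit_pval[OF nz(1)] pgrid_in_pball[of "int M" l, where ?'p='p] by (auto simp: mem_pball)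
  then have "ptrunc x (- 1 - pval ?\<xi>) = ptrunc (pgrid (int N) m :: 'p padic) (- 1 - pval ?\<xi>)"
    using assms unfolding ptrunc_eq_iff_digit mem_pball by auto
  then have X: "[ptrunc x (- 1 - pval ?\<xi>) = ?X] (rmod ?q (- pval ?\<xi>))"
    using ptrunc_pgrid[of "int N" m "- 1 - pval ?\<xi>", where ?'p='p] by simp
  have qq: "?q (- k) * ?q k = 1" for k
    by (simp flip: base_powi_add)
  have "[ptrunc ?\<xi> (- 1 - pval x) * ptrunc x (- 1 - pval ?\<xi>) = ?L * ptrunc x (- 1 - pval ?\<xi>)] (rmod 1)"
    using rcong_mult_multiple[OF ptrunc_pgrid[of "int M" l "- 1 - pval x", where ?'p='p], of "int n" "?q (pval x)"]
    unfolding n by (simp add: qq)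
  also have "[?L * ptrunc x (- 1 - pval ?\<xi>) = ?L * ?X] (rmod 1)"
    using rcong_mult_multiple[OF X, of z "?q (pval ?\<xi>)"] unfolding z qq by (simp add: mult.commute)
  finally obtain w where w: "?L * ?X = ptrunc ?\<xi> (- 1 - pval x) * ptrunc x (- 1 - pval ?\<xi>) + of_int w"
    unfolding rcong_altdef by auto
  have LX: "?L * ?X = of_int (l * m) / real (CARD('p) ^ (N + M))"
    by (simp add: power_int_minus power_add field_simps)
  have "unity_root (CARD('p) ^ (N + M)) (l * m) = cis (2 * pi * (?L * ?X))"
    unfolding LX unity_root_def by simp
  also have "\<dots> = cis (2 * pi * (ptrunc ?\<xi> (- 1 - pval x) * ptrunc x (- 1 - pval ?\<xi>))) * cis (of_int w * (2 * pi))"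
    unfolding w cis_mult distrib_left by (simp add: mult_ac)
  also have "\<dots> = pchi (pmul ?\<xi> x)"
    unfolding pmul_def pchi_pmk[OF coherent_pmul[OF nz]] using cis_eq_1_iff[of "of_int w * (2 * pi)"] by auto
  finally show ?thesis by (rule sym)
qed

text \<open>The integrand is constant on every grid ball, and p^(-M) is the measure of such a
  ball.\<close>

lemma pfourier_step_function:
  fixes f :: "'p::prime_card padic \<Rightarrow> complex"
  assumes "step_function N M f"
  shows "pfourier f (pgrid (int M) l) =
    of_real (real CARD('p) powi (- int M)) * dft (CARD('p) ^ (N + M)) (\<lambda>n. f (pgrid (int N) n)) l"
proof -
  let ?P = "CARD('p) ^ (N + M)"
  let ?B = "\<lambda>n. pball (- int M) (pgrid (int N) (int n)) :: 'p padic set"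
  define d where "d n = unity_root ?P (l * int n) * f (pgrid (int N) (int n))" for n
  have "pchi (pmul (pgrid (int M) l) x) * f x = (\<Sum>n<?P. d n * indicator (?B n) x)" for x
    by (rule sum_grid_indicator)
      (auto simp: d_def pchi_pmul_grid step_functionD(2)[OF assms] intro: step_functionD(3)[OF assms])
  then have "pfourier f (pgrid (int M) l) = (LINT x|haar. (\<Sum>n<?P. d n * indicator (?B n) x))"
    unfolding pfourier_def by simp
  also have "\<dots> = (\<Sum>n<?P. LINT x|haar. d n * indicator (?B n) x)"
  proof (intro Bochner_Integration.integral_sum integrable_mult_right)
    fix n
    have "integrable haar (\<lambda>x. complex_of_real (indicator (?B n) x))"
      by (intro integrable_of_real integrable_indicator_haar) (simp_all add: emeasure_pball)
    then show "integrable haar (indicator (?B n) :: 'p padic \<Rightarrow> complex)"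
      by (simp add: of_real_indicator)
  qed
  also have "\<dots> = (\<Sum>n<?P. d n * of_real (real CARD('p) powi (- int M)))"
  proof (intro sum.cong refl)
    fix n
    have "(LINT x|haar. indicator (?B n) x :: complex) = (LINT x|haar. complex_of_real (indicator (?B n) x))"
      by (simp add: of_real_indicator)
    also have "\<dots> = of_real (LINT x|haar. indicator (?B n) x)"
      by (rule integral_complex_of_real)
    also have "\<dots> = of_real (real CARD('p) powi (- int M))"
      by (simp add: measure_pball)
    finally show "(LINT x|haar. d n * indicator (?B n) x) = d n * of_real (real CARD('p) powi (- int M))"
      by simp
  qed
  finally show ?thesis
    by (simp add: d_def dft_def sum_distrib_left mult_ac)
qed

section \<open>The spaces generated by a test function\<close>

definition translates :: "('p::prime_card padic \<Rightarrow> complex) \<Rightarrow> ('p padic \<Rightarrow> complex) set" where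
  "translates f = (\<lambda>a x. f (x - a)) ` Ip"

lemma fspan_compose: "fspan ((\<lambda>g x. g (h x)) ` S) = (\<lambda>g x. g (h x)) ` fspan S"
proof
  show "fspan ((\<lambda>g x. g (h x)) ` S) \<subseteq> (\<lambda>g x. g (h x)) ` fspan S"
  proof (rule fspan_least)
    note sub = csubspaceD[OF csubspace_fspan[of S]]
    show "csubspace ((\<lambda>g x. g (h x)) ` fspan S)"
      unfolding csubspace_def
    proof (intro conjI ballI allI)
      show "(\<lambda>x. 0) \<in> (\<lambda>g x. g (h x)) ` fspan S"
        using sub(1) by (rule rev_image_eqI) simp
      fix f assume "f \<in> (\<lambda>g x. g (h x)) ` fspan S"
      then obtain f' where f: "f' \<in> fspan S" "f = (\<lambda>x. f' (h x))" by blast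
      show "(\<lambda>x. c * f x) \<in> (\<lambda>g x. g (h x)) ` fspan S" for c
        using sub(3)[OF f(1), of c] by (rule rev_image_eqI) (simp add: f)
      fix g assume "g \<in> (\<lambda>g x. g (h x)) ` fspan S"
      then obtain g' where g: "g' \<in> fspan S" "g = (\<lambda>x. g' (h x))" by blast
      show "(\<lambda>x. f x + g x) \<in> (\<lambda>g x. g (h x)) ` fspan S"
        using sub(2)[OF f(1) g(1)] by (rule rev_image_eqI) (simp add: f g)
    qed
    show "(\<lambda>g x. g (h x)) ` S \<subseteq> (\<lambda>g x. g (h x)) ` fspan S"
      using fspan_base by blast
  qed
  have "fspan S \<subseteq> {g. (\<lambda>x. g (h x)) \<in> fspan ((\<lambda>g x. g (h x)) ` S)}"
  proof (rule fspan_least)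
    show "csubspace {g. (\<lambda>x. g (h x)) \<in> fspan ((\<lambda>g x. g (h x)) ` S)}"
      by (auto simp: csubspace_def intro!: csubspaceD[OF csubspace_fspan])
  qed (auto intro!: fspan_base)
  then show "(\<lambda>g x. g (h x)) ` fspan S \<subseteq> fspan ((\<lambda>g x. g (h x)) ` S)"
    by blast
qed

text \<open>\<open>fspan\<close> sums over functions rather than indices, and different indices may
  give the same function. A set of representatives on which \<open>t\<close> is injective translates
  one kind of sum into the other.\<close>

lemma fspan_image_sum:
  assumes "g \<in> fspan (t ` I)"
  shows "\<exists>A c. finite A \<and> A \<subseteq> I \<and> g = (\<lambda>x. \<Sum>a\<in>A. c a * t a x)"
proof -
  obtain F c where F: "finite F" "F \<subseteq> t ` I" "g = (\<lambda>x. \<Sum>h\<in>F. c h * h x)"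
    using assms unfolding fspan_def by blast
  obtain A where A: "A \<subseteq> I" "inj_on t A" "F = t ` A"
    using F(2) by (auto simp: subset_image_inj)
  have "finite A"
    using F(1) A by (simp add: finite_image_iff)
  moreover have "g = (\<lambda>x. \<Sum>a\<in>A. c (t a) * t a x)"
    unfolding F(3) A(3) using A(2) by (simp add: sum.reindex)
  ultimately show ?thesis
    using A(1) by (intro exI[of _ A] exI[of _ "c \<circ> t"]) simp
qed

context
  fixes \<phi> :: "'p::prime_card padic \<Rightarrow> complex" and M N :: nat
  assumes step: "step_function N M \<phi>"
begin

lemma phi_L2: "(\<lambda>x. \<phi> (x - a)) \<in> L2"
  by (rule L2_translate[OF step_function_L2[OF step]])

lemma translates_L2: "translates \<phi> \<subseteq> L2"
  unfolding translates_def using phi_L2 by blast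

lemma fspan_translates_L2: "fspan (translates \<phi>) \<subseteq> L2"
  by (rule fspan_least[OF csubspace_L2 translates_L2])

lemma Vgen_eq: "Vgen \<phi> j = l2_closure ((\<lambda>g x. g (pscale (- j) x)) ` fspan (translates \<phi>))"
proof -
  have "{(\<lambda>x. \<phi> (psub (pscale (-j) x) a)) | a. a \<in> Ip} = (\<lambda>g x. g (pscale (- j) x)) ` translates \<phi>"
    by (auto simp: translates_def)
  then show ?thesis
    unfolding Vgen_def by (simp only: fspan_compose)
qed

lemma Vgen_0: "Vgen \<phi> 0 = l2_closure (fspan (translates \<phi>))"
  unfolding Vgen_eq by simp

text \<open>Every V_j is a dilate of V_0, so nesting and membership need to be examined at one scale
  only.\<close>

lemma Vgen_iff: "f \<in> Vgen \<phi> j \<longleftrightarrow> (\<lambda>x. f (pscale j x)) \<in> Vgen \<phi> 0"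
  using l2_closure_pscale_iff[OF fspan_translates_L2, of "\<lambda>x. f (pscale j x)" "- j"]
  unfolding Vgen_0 by (simp add: Vgen_eq)

lemma Vgen_shift: "f \<in> Vgen \<phi> j \<longleftrightarrow> (\<lambda>x. f (pscale i x)) \<in> Vgen \<phi> (j - i)"
  by (subst (1 2) Vgen_iff) simp

lemma Vgen_closed: "l2_closed_subspace (Vgen \<phi> j)"
proof -
  have *: "Vgen \<phi> j = l2_closure (fspan ((\<lambda>g x. g (pscale (- j) x)) ` translates \<phi>))"
    by (simp only: Vgen_eq fspan_compose)
  show ?thesis
    unfolding * by (intro l2_closed_subspace_closure csubspace_fspan fspan_least csubspace_L2)
      (use translates_L2 L2_pscale in blast)
qed

lemma phi_in_Vgen_0: "\<phi> \<in> Vgen \<phi> 0"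
proof -
  have "\<phi> \<in> translates \<phi>"
    unfolding translates_def using zero_in_Ip by (rule rev_image_eqI) simp
  then show ?thesis
    unfolding Vgen_0 using fspan_base l2_closure_base[OF fspan_translates_L2] by blast
qed

lemma Vgen_mono_iff: "(\<forall>j. Vgen \<phi> j \<subseteq> Vgen \<phi> (j + 1)) \<longleftrightarrow> Vgen \<phi> 0 \<subseteq> Vgen \<phi> 1"
proof
  assume sub: "Vgen \<phi> 0 \<subseteq> Vgen \<phi> 1"
  show "\<forall>j. Vgen \<phi> j \<subseteq> Vgen \<phi> (j + 1)"
  proof (intro allI subsetI)
    fix j f assume "f \<in> Vgen \<phi> j"
    then have "(\<lambda>x. f (pscale j x)) \<in> Vgen \<phi> 1"
      using sub by (subst (asm) Vgen_iff) blast
    then show "f \<in> Vgen \<phi> (j + 1)"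
      using Vgen_shift[of f "j + 1" j] by simp
  qed
next
  assume "\<forall>j. Vgen \<phi> j \<subseteq> Vgen \<phi> (j + 1)"
  from spec[OF this, of 0] show "Vgen \<phi> 0 \<subseteq> Vgen \<phi> 1" by simp
qed

lemma Vgen_mono:
  assumes "Vgen \<phi> 0 \<subseteq> Vgen \<phi> 1" "i \<le> j"
  shows "Vgen \<phi> i \<subseteq> Vgen \<phi> j"
  using assms(2)
proof (induction j rule: int_ge_induct)
  case (step j)
  then show ?case using Vgen_mono_iff assms(1) by blast
qed simp

text \<open>A generator phi(p^j x - a) does not notice a shift by u, since p^j u lies in B_(-M)(0).
  On the span the invariance is exact; in the closure it persists almost everywhere because
  translation is an isometry. As j grows, the admissible u fill the whole field.\<close>

lemma Vgen_nearly_periodic: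
  assumes f: "f \<in> Vgen \<phi> (- int j)" and u: "u \<in> pball (int j - int M) 0"
  shows "AE x in haar. f (x - u) = f x"
proof -
  have fL2: "f \<in> L2"
    using f Vgen_closed unfolding l2_closed_subspace_iff by blast
  have per: "g (x - u) = g x"
    if "g \<in> (\<lambda>g x. g (pscale (- (- int j)) x)) ` fspan (translates \<phi>)" for g x
  proof -
    have "csubspace {g. g (x - u) = g x}"
      by (auto simp: csubspace_def)
    moreover have "(\<lambda>g x. g (pscale (- (- int j)) x)) ` translates \<phi> \<subseteq> {g. g (x - u) = g x}"
    proof (clarsimp simp: translates_def)
      fix a
      have "pscale (int j) (- u) \<in> pball (- int M) 0"
        using u by (simp add: pball_zero_uminus)
      from step_functionD(1)[OF step this, of "pscale (int j) x - a"]
      have "\<phi> (pscale (int j) (x - u) - a) = \<phi> (pscale (int j) x - a)"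
        using pscale_add[of "int j" x "- u"] by (simp add: algebra_simps)
      then show "\<phi> (pscale (int j) (x - u) - a) = \<phi> (pscale (int j) x - a)" .
    qed
    ultimately have "fspan ((\<lambda>g x. g (pscale (- (- int j)) x)) ` translates \<phi>) \<subseteq> {g. g (x - u) = g x}"
      by (rule fspan_least)
    then show ?thesis using that unfolding fspan_compose by blast
  qed
  define d where "d x = f (x - u) - f x" for x
  have dL2: "d \<in> L2"
    unfolding d_def by (intro L2_diff L2_translate fL2)
  have "l2sq d \<le> 4 * e" if "0 < e" for e
  proof -
    obtain g where g: "g \<in> (\<lambda>g x. g (pscale (- (- int j)) x)) ` fspan (translates \<phi>)" "l2sq (\<lambda>x. f x - g x) < e"
      using f \<open>0 < e\<close> unfolding Vgen_eq l2_closure_iff by blast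
    have gL2: "g \<in> L2" using g(1) fspan_translates_L2 L2_pscale by blast
    have fg: "(\<lambda>x. f x - g x) \<in> L2" by (intro L2_diff fL2 gL2)
    have "d = (\<lambda>x. (f (x - u) - g (x - u)) + (g x - f x))"
      by (simp add: d_def fun_eq_iff per[OF g(1)])
    then have "l2sq d \<le> 2 * l2sq (\<lambda>x. f (x - u) - g (x - u)) + 2 * l2sq (\<lambda>x. g x - f x)"
      using l2sq_add_le[OF L2_translate[OF fg, of u] L2_diff[OF gL2 fL2]] by simp
    also have "l2sq (\<lambda>x. f (x - u) - g (x - u)) = l2sq (\<lambda>x. f x - g x)"
      by (rule l2sq_translate[OF fg])
    also have "l2sq (\<lambda>x. g x - f x) = l2sq (\<lambda>x. f x - g x)"
      by (rule l2sq_diff_commute)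
    finally show ?thesis using g(2) by simp
  qed
  then have "l2sq d \<le> 0 + e" if "0 < e" for e
    using that[THEN half_gt_zero, THEN half_gt_zero] by fastforce
  then have "l2sq d \<le> 0"
    by (rule field_le_epsilon)
  then have "l2sq d = 0"
    using l2sq_nonneg[of d] by linarith
  then have "AE x in haar. d x = 0"
    using l2sq_eq_0_iff[OF dL2] by simp
  then show ?thesis
    by eventually_elim (simp add: d_def)
qed

lemma Inter_Vgen: "(\<Inter>j. Vgen \<phi> j) = {f \<in> L2. AE x in haar. f x = 0}"
proof (intro set_eqI iffI)
  fix f assume "f \<in> (\<Inter>j. Vgen \<phi> j)"
  then have f: "f \<in> Vgen \<phi> j" for j by blast
  have "f \<in> L2"
    using f Vgen_closed unfolding l2_closed_subspace_iff by blast
  moreover have "AE x in haar. f (x - u) = f x" for u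
  proof -
    obtain G :: nat where "u \<in> pball (int G) 0"
      using pball_exhaust by blast
    then show ?thesis
      using Vgen_nearly_periodic[OF f, of u "G + M"] by simp
  qed
  ultimately show "f \<in> {f \<in> L2. AE x in haar. f x = 0}"
    using L2_translation_invariant_eq_0[of f] by blast
next
  fix f :: "'p padic \<Rightarrow> complex" assume "f \<in> {f \<in> L2. AE x in haar. f x = 0}"
  then have f: "f \<in> L2" "l2sq f = 0"
    using l2sq_eq_0_iff by auto
  have "f \<in> Vgen \<phi> j" for j
  proof -
    have sub: "Vgen \<phi> j \<subseteq> L2" "csubspace (Vgen \<phi> j)" "l2_closure (Vgen \<phi> j) = Vgen \<phi> j"
      using Vgen_closed unfolding l2_closed_subspace_iff by blast+
    have "f \<in> l2_closure (Vgen \<phi> j)"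
      unfolding l2_closure_iff
      using f csubspaceD(1)[OF sub(2)] by (auto intro!: bexI[of _ "\<lambda>x. 0"])
    then show ?thesis using sub(3) by simp
  qed
  then show "f \<in> (\<Inter>j. Vgen \<phi> j)" by blast
qed

abbreviation "samples n \<equiv> \<phi> (pgrid (int N) n)"
abbreviation "spectrum \<equiv> {l. l < CARD('p) ^ (N + M) \<and> dft (CARD('p) ^ (N + M)) samples (int l) \<noteq> 0}"

lemma grid_size_pos: "0 < CARD('p) ^ (N + M)"
  using card_gt_1[where ?'p='p] by simp

lemma samples_periodic: "samples (m + int (CARD('p) ^ (N + M))) = samples m"
  by (rule step_function_grid_periodic[OF step])

lemma pfourier_support:
  "{l. l < CARD('p) ^ (M + N) \<and> pfourier \<phi> (pscale (- int M) (pnat l)) \<noteq> 0}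
     = spectrum"
proof -
  have "pfourier \<phi> (pscale (- int M) (pnat l)) \<noteq> 0 \<longleftrightarrow> dft (CARD('p) ^ (N + M)) samples (int l) \<noteq> 0" for l
    using pfourier_step_function[OF step, of "int l"] by (simp add: pnat_eq_pgrid)
  then show ?thesis by (simp add: add.commute)
qed

lemma pfourier_zero: "pfourier \<phi> pzero \<noteq> 0 \<longleftrightarrow> dft (CARD('p) ^ (N + M)) samples 0 \<noteq> 0"
  using pfourier_step_function[OF step, of 0] by simp

section \<open>Sufficiency\<close>

text \<open>Translations by k / p^N stay inside B_N(0), so both sides are step functions and agree
  once their samples do. The fractions used are exactly the elements of I_p in B_N(0), and their
  number is the bound p^N.\<close>

lemma span_of_support:
  assumes card: "card spectrum \<le> CARD('p) ^ N"
    and h: "step_function N M h"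
    and supp: "\<And>l. l < CARD('p) ^ (N + M) \<Longrightarrow> dft (CARD('p) ^ (N + M)) samples (int l) = 0 \<Longrightarrow>
        dft (CARD('p) ^ (N + M)) (\<lambda>n. h (pgrid (int N) n)) (int l) = 0"
  shows "\<exists>b. \<forall>x. h x = (\<Sum>k<CARD('p) ^ N. b k * \<phi> (x - pgrid (int N) (int k)))"
proof -
  obtain b where b: "\<forall>m<CARD('p) ^ (N + M). h (pgrid (int N) (int m)) = (\<Sum>k<CARD('p) ^ N. b k * samples (int m - int k))"
    using dft_support_span[of "CARD('p) ^ (N + M)" samples, OF grid_size_pos samples_periodic card, of "\<lambda>n. h (pgrid (int N) n)"] supp
    by blast
  have "h x = (\<Sum>k<CARD('p) ^ N. b k * \<phi> (x - pgrid (int N) (int k)))" for x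
  proof (rule step_function_eqI[OF h])
    show "step_function N M (\<lambda>x. \<Sum>k<CARD('p) ^ N. b k * \<phi> (x - pgrid (int N) (int k)))"
      by (intro step_function_sum step_function_translate[OF step]) simp
    show "h (pgrid (int N) (int n)) = (\<Sum>k<CARD('p) ^ N. b k * \<phi> (pgrid (int N) (int n) - pgrid (int N) (int k)))"
      if "n < CARD('p) ^ (N + M)" for n
      using b that by (simp add: pgrid_diff)
  qed
  then show ?thesis by blast
qed

lemma translate_in_fspan:
  assumes card: "card spectrum \<le> CARD('p) ^ N"
  shows "(\<lambda>x. \<phi> (x - c)) \<in> fspan (translates \<phi>)"
proof -
  obtain K n where K: "N \<le> K" "n < CARD('p) ^ (K - N)" "c - pgrid (int K) (int n) \<in> pball (int N) 0"
    by (rule Ip_decomposition)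
  define u where "u = c - pgrid (int K) (int n)"
  have u: "u \<in> pball (int N) 0" using K by (simp add: u_def)
  \<comment> \<open>Since phi is constant on balls of radius p^(-M), translation by u acts on the
    samples as the integer shift by m. It multiplies the transform by roots of unity and leaves its
    zeros in place.\<close>
  then obtain m where m: "u \<in> pball (- int M) (pgrid (int N) (int m))"
    by (rule pball_grid_ex[where H="int M"]) auto
  have "\<exists>b. \<forall>x. \<phi> (x - u) = (\<Sum>k<CARD('p) ^ N. b k * \<phi> (x - pgrid (int N) (int k)))"
  proof (rule span_of_support[OF card])
    show "step_function N M (\<lambda>x. \<phi> (x - u))"
      by (rule step_function_translate[OF step u])
    fix l assume "l < CARD('p) ^ (N + M)" "dft (CARD('p) ^ (N + M)) samples (int l) = 0"
    have "\<phi> (pgrid (int N) i - u) = samples (i - int m)" for i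
    proof -
      have "pgrid (int N) i - u \<in> pball (- int M) (pgrid (int N) i - pgrid (int N) (int m))"
        using m pball_zero_uminus[of "u - pgrid (int N) (int m)" "- int M"]
        by (subst (asm) mem_pball_iff_diff, subst mem_pball_iff_diff) simp
      then show ?thesis
        using step_functionD(3)[OF step] by (metis pgrid_diff)
    qed
    then have "dft (CARD('p) ^ (N + M)) (\<lambda>i. \<phi> (pgrid (int N) i - u)) (int l) = dft (CARD('p) ^ (N + M)) (\<lambda>i. samples (i - int m)) (int l)"
      by simp
    also have "\<dots> = 0"
      using \<open>dft (CARD('p) ^ (N + M)) samples (int l) = 0\<close> by (simp add: dft_shift[of "CARD('p) ^ (N + M)" samples, OF grid_size_pos samples_periodic])
    finally show "dft (CARD('p) ^ (N + M)) (\<lambda>i. \<phi> (pgrid (int N) i - u)) (int l) = 0" .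
  qed
  then obtain b where b: "\<And>x. \<phi> (x - u) = (\<Sum>k<CARD('p) ^ N. b k * \<phi> (x - pgrid (int N) (int k)))"
    by blast
  \<comment> \<open>The translations n / p^K + k / p^N over a common denominator. Their numerators
    stay below p^K, which keeps them in \<open>Ip\<close>.\<close>
  let ?a = "\<lambda>k. pgrid (int K) (int (n + CARD('p) ^ (K - N) * k)) :: 'p padic"
  have a: "?a k = pgrid (int K) (int n) + pgrid (int N) (int k)" for k
    using pgrid_refine[of "int N" "K - N" "int k", where ?'p='p] K(1) by (simp add: pgrid_add)
  have "?a k \<in> Ip" if "k < CARD('p) ^ N" for k
  proof (rule pgrid_in_Ip)
    have "n + CARD('p) ^ (K - N) * k < CARD('p) ^ (K - N) * (k + 1)"
      using K(2) by simp
    also have "\<dots> \<le> CARD('p) ^ (K - N) * CARD('p) ^ N"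
      using that by (intro mult_left_mono) auto
    also have "\<dots> = CARD('p) ^ K"
      using K(1) by (simp flip: power_add)
    finally show "n + CARD('p) ^ (K - N) * k < CARD('p) ^ K" .
  qed
  then have "(\<lambda>x. \<Sum>k<CARD('p) ^ N. b k * \<phi> (x - ?a k)) \<in> fspan (translates \<phi>)"
    by (intro csubspace_sum csubspace_fspan fspan_base) (auto simp: translates_def)
  moreover have "\<phi> (x - c) = (\<Sum>k<CARD('p) ^ N. b k * \<phi> (x - ?a k))" for x
    using b[of "x - pgrid (int K) (int n)"] unfolding a u_def by (simp add: algebra_simps)
  ultimately show ?thesis by simp
qed

lemma fspan_translates_invariant:
  assumes card: "card spectrum \<le> CARD('p) ^ N"
    and g: "g \<in> fspan (translates \<phi>)"
  shows "(\<lambda>x. g (x - c)) \<in> fspan (translates \<phi>)"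
proof -
  have "fspan (translates \<phi>) \<subseteq> {g. (\<lambda>x. g (x - c)) \<in> fspan (translates \<phi>)}"
  proof (rule fspan_least)
    show "csubspace {g. (\<lambda>x. g (x - c)) \<in> fspan (translates \<phi>)}"
      by (auto simp: csubspace_def intro!: csubspaceD[OF csubspace_fspan])
    show "translates \<phi> \<subseteq> {g. (\<lambda>x. g (x - c)) \<in> fspan (translates \<phi>)}"
      using translate_in_fspan[OF card, of "_ + c"] by (auto simp: translates_def diff_diff_eq add.commute)
  qed
  then show ?thesis using g by blast
qed

lemma Vgen_0_invariant:
  assumes card: "card spectrum \<le> CARD('p) ^ N"
    and f: "f \<in> Vgen \<phi> 0"
  shows "(\<lambda>x. f (x - c)) \<in> Vgen \<phi> 0"
  unfolding Vgen_0 l2_closure_iff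
proof (intro conjI allI impI)
  have fL2: "f \<in> L2" using f by (simp add: Vgen_0 l2_closure_iff)
  then show "(\<lambda>x. f (x - c)) \<in> L2" by (rule L2_translate)
  fix e :: real assume "0 < e"
  then obtain g where g: "g \<in> fspan (translates \<phi>)" "l2sq (\<lambda>x. f x - g x) < e"
    using f unfolding Vgen_0 l2_closure_iff by blast
  have "l2sq (\<lambda>x. f (x - c) - g (x - c)) < e"
    using l2sq_translate[OF L2_diff[OF fL2, of g], of c] g fspan_translates_L2 by auto
  then show "\<exists>g\<in>fspan (translates \<phi>). l2sq (\<lambda>x. f (x - c) - g x) < e"
    by (intro bexI[OF _ fspan_translates_invariant[OF card g(1), of c]])
qed

lemma ball_indicator_in_Vgen:
  assumes card: "card spectrum \<le> CARD('p) ^ N"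
    and nz: "dft (CARD('p) ^ (N + M)) samples 0 \<noteq> 0"
  shows "indicator (pball g c) \<in> Vgen \<phi> (int N - g)"
proof -
  have "\<exists>b. \<forall>x. indicator (pball (int N) 0) x = (\<Sum>k<CARD('p) ^ N. b k * \<phi> (x - pgrid (int N) (int k)))"
  proof (rule span_of_support[OF card])
    have "x + y \<in> pball (int N) 0 \<longleftrightarrow> x \<in> pball (int N) 0" if "y \<in> pball (- int M) 0" for x y :: "'p padic"
    proof -
      have "y \<in> pball (int N) 0"
        using that pball_mono[of "- int M" "int N" "0::'p padic"] by auto
      then show ?thesis
        using pball_zero_add[of x "int N" y] pball_zero_diff[of "x + y" "int N" y] by auto
    qed
    then show "step_function N M (indicator (pball (int N) (0 :: 'p padic)))"
      by (auto simp: step_function_def indicator_def)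
    fix l assume l: "l < CARD('p) ^ (N + M)" "dft (CARD('p) ^ (N + M)) samples (int l) = 0"
    \<comment> \<open>The samples of the indicator are constantly 1, with transform 0 away from
      frequency 0, and \<open>nz\<close> puts frequency 0 into the spectrum.\<close>
    then have "l \<noteq> 0" using nz by (metis of_nat_0)
    then have "\<not> int (CARD('p) ^ (N + M)) dvd int l"
      using l(1) unfolding int_dvd_int_iff by (auto dest: dvd_imp_le)
    then show "dft (CARD('p) ^ (N + M)) (\<lambda>n. indicator (pball (int N) 0) (pgrid (int N) n :: 'p padic)) (int l) = 0"
      using sum_unity_root[OF grid_size_pos, of "int l"] by (simp add: dft_def)
  qed
  then obtain b where b: "\<And>x. indicator (pball (int N) 0) x = (\<Sum>k<CARD('p) ^ N. b k * \<phi> (x - pgrid (int N) (int k)))"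
    by blast
  have "(\<lambda>x. \<Sum>k<CARD('p) ^ N. b k * \<phi> (x - pgrid (int N) (int k))) \<in> fspan (translates \<phi>)"
    by (intro csubspace_sum csubspace_fspan fspan_base)
      (auto simp: translates_def intro!: imageI pgrid_in_Ip)
  then have "indicator (pball (int N) 0) \<in> fspan (translates \<phi>)"
    by (subst ext[OF b])
  \<comment> \<open>This translation becomes the centre c after the dilation that brings the radius
    from p^N to p^g. It need not lie in I_p, so the full invariance of the span is used.\<close>
  then have "(\<lambda>x. indicator (pball (int N) 0) (x - pscale (g - int N) c)) \<in> Vgen \<phi> 0"
    unfolding Vgen_0 using l2_closure_base[OF fspan_translates_L2] fspan_translates_invariant[OF card] by blast
  moreover have "(\<lambda>x. indicator (pball (int N) 0) (x - pscale (g - int N) c))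
      = (\<lambda>x. indicator (pball g c) (pscale (int N - g) x) :: complex)"
    using vimage_pscale_pball[of "int N - g" g c] by (auto simp: fun_eq_iff indicator_def pball_translate_diff)
  ultimately show ?thesis
    by (subst Vgen_iff) simp
qed

lemma refinable_in_Vgen:
  assumes "refinable \<phi>"
  shows "\<phi> \<in> Vgen \<phi> 1"
proof -
  let ?S = "(\<lambda>g x. g (pscale (- 1) x)) ` fspan (translates \<phi>)"
  obtain \<alpha> where \<alpha>: "\<forall>e>0. \<exists>F0. finite F0 \<and> F0 \<subseteq> Ip \<and>
      (\<forall>F. finite F \<and> F0 \<subseteq> F \<and> F \<subseteq> Ip \<longrightarrow>
         l2norm (\<lambda>x. \<phi> x - (\<Sum>a\<in>F. \<alpha> a * \<phi> (psub (pscale (-1) x) a))) < e)"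
    using assms unfolding refinable_def by blast
  show ?thesis
    unfolding Vgen_eq l2_closure_def
  proof (intro CollectI conjI allI impI)
    show "\<phi> \<in> L2" by (rule step_function_L2[OF step])
    fix e :: real assume "0 < e"
    then obtain F where F: "F \<subseteq> Ip"
        "l2norm (\<lambda>x. \<phi> x - (\<Sum>a\<in>F. \<alpha> a * \<phi> (psub (pscale (-1) x) a))) < e"
      using \<alpha> by blast
    have "(\<lambda>x. \<Sum>a\<in>F. \<alpha> a * \<phi> (x - a)) \<in> fspan (translates \<phi>)"
      using F(1) by (intro csubspace_sum csubspace_fspan fspan_base) (auto simp: translates_def)
    then have "(\<lambda>x. \<Sum>a\<in>F. \<alpha> a * \<phi> (pscale (- 1) x - a)) \<in> ?S"
      by (rule rev_image_eqI) simp
    then show "\<exists>g\<in>?S. l2norm (\<lambda>x. \<phi> x - g x) < e"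
      using F(2) by (intro bexI[of _ "\<lambda>x. \<Sum>a\<in>F. \<alpha> a * \<phi> (pscale (- 1) x - a)"]) simp_all
  qed
qed

lemma is_MRA_Vgen:
  assumes card: "card spectrum \<le> CARD('p) ^ N"
    and nz: "dft (CARD('p) ^ (N + M)) samples 0 \<noteq> 0"
    and ref: "refinable \<phi>"
  shows "is_MRA (Vgen \<phi>)"
proof -
  have "(\<lambda>x. \<phi> (x - a)) \<in> Vgen \<phi> 1" for a
  proof -
    have "(\<lambda>x. \<phi> (pscale 1 x)) \<in> Vgen \<phi> 0"
      using refinable_in_Vgen[OF ref] Vgen_iff[of \<phi> 1] by simp
    \<comment> \<open>Seen from V_0, the translate phi(x - a) is phi(p x) shifted by a / p.
      Invariance under all shifts extends refinability from phi to its translates.\<close>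
    from Vgen_0_invariant[OF card this, of "pscale (- 1) a"]
    have "(\<lambda>x. \<phi> (pscale 1 x - a)) \<in> Vgen \<phi> 0"
      by (simp add: pscale_diff)
    then show ?thesis
      by (subst Vgen_iff)
  qed
  then have "fspan (translates \<phi>) \<subseteq> Vgen \<phi> 1"
    using Vgen_closed[of 1] unfolding l2_closed_subspace_iff
    by (intro fspan_least) (auto simp: translates_def)
  then have sub: "Vgen \<phi> 0 \<subseteq> Vgen \<phi> 1"
    unfolding Vgen_0 by (rule l2_closure_least) (rule Vgen_closed)
  have L2: "Vgen \<phi> j \<subseteq> L2" and csub: "csubspace (Vgen \<phi> j)" for j
    using Vgen_closed unfolding l2_closed_subspace_iff by blast+
  have union: "csubspace (\<Union>j. Vgen \<phi> j)"
    unfolding csubspace_def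
  proof (intro conjI ballI allI)
    show "(\<lambda>x. 0) \<in> (\<Union>j. Vgen \<phi> j)" using csubspaceD(1)[OF csub] by blast
    fix f assume "f \<in> (\<Union>j. Vgen \<phi> j)"
    then obtain i where f: "f \<in> Vgen \<phi> i" by blast
    then show "(\<lambda>x. c * f x) \<in> (\<Union>j. Vgen \<phi> j)" for c using csubspaceD(3)[OF csub] by blast
    fix g assume "g \<in> (\<Union>j. Vgen \<phi> j)"
    then obtain j where g: "g \<in> Vgen \<phi> j" by blast
    have "f \<in> Vgen \<phi> (max i j)" "g \<in> Vgen \<phi> (max i j)"
      using f g Vgen_mono[OF sub, of i "max i j"] Vgen_mono[OF sub, of j "max i j"] by auto
    then show "(\<lambda>x. f x + g x) \<in> (\<Union>j. Vgen \<phi> j)"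
      using csubspaceD(2)[OF csub] by blast
  qed
  have "(\<Union>j. Vgen \<phi> j) \<subseteq> L2" using L2 by blast
  then have "l2_closure (\<Union>j. Vgen \<phi> j) = L2"
    using ball_indicator_in_Vgen[OF card nz] l2_closure_base[of "\<Union>j. Vgen \<phi> j"]
    by (intro l2_closed_subspace_eq_L2 l2_closed_subspace_closure union) blast+
  moreover have "f \<in> Vgen \<phi> j \<longleftrightarrow> (\<lambda>x. f (pscale (-1) x)) \<in> Vgen \<phi> (j + 1)" for j f
    using Vgen_shift[of f j "- 1"] by simp
  moreover have "Vgen \<phi> 0 = l2_closure (fspan {(\<lambda>x. \<phi> (psub x a)) | a. a \<in> Ip})"
    unfolding Vgen_def by simp
  ultimately show ?thesis
    unfolding is_MRA_def
    using Vgen_closed sub Vgen_mono_iff Inter_Vgen phi_in_Vgen_0 by blast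
qed

end

section \<open>Necessity\<close>

text \<open>On the ball of radius p^g around x, of measure p^g, |d|^2 is constant; its integral
  there is at most the whole integral. So a small norm forces small values.\<close>

lemma L2_fine_periodic_bound:
  fixes d :: "'p::prime_card padic \<Rightarrow> complex"
  assumes d: "d \<in> L2" and per: "\<And>y. y \<in> pball g 0 \<Longrightarrow> d (x + y) = d x"
  shows "(cmod (d x))\<^sup>2 * real CARD('p) powi g \<le> l2sq d"
proof -
  have "(cmod (d x))\<^sup>2 * real CARD('p) powi g = (LINT y|haar. (cmod (d x))\<^sup>2 * indicator (pball g x) y)"
    by (simp add: measure_pball)
  also have "\<dots> \<le> l2sq d"
    unfolding l2sq_def
  proof (rule integral_mono)
    show "integrable haar (\<lambda>y. (cmod (d x))\<^sup>2 * indicator (pball g x) y)"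
      by (intro integrable_mult_right integrable_indicator_haar) (simp_all add: emeasure_pball)
    show "(cmod (d x))\<^sup>2 * indicator (pball g x) y \<le> (cmod (d y))\<^sup>2" for y
    proof (cases "y \<in> pball g x")
      case True
      then have "d y = d x"
        using per[of "y - x"] by (subst (asm) mem_pball_iff_diff) simp
      then show ?thesis using True by simp
    qed simp
  qed (rule L2D(2)[OF d])
  finally show ?thesis .
qed

text \<open>Approximation in norm by functions constant on small balls is approximation on a finite grid,
  and spans are closed there.\<close>
lemma exact_refinement:
  fixes \<phi> :: "'p::prime_card padic \<Rightarrow> complex"
  assumes step: "step_function N M \<phi>" and mem: "\<phi> \<in> Vgen \<phi> (int j)"
  shows "\<exists>A c. finite A \<and> A \<subseteq> Ip \<inter> pball (int (N + j)) 0 \<and>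
    (\<forall>x. \<phi> x = (\<Sum>a\<in>A. c a * \<phi> (pscale (- int j) x - a)))"
proof -
  define V where "V = fspan ((\<lambda>a x. \<phi> (pscale (- int j) x - a)) ` Ip)"
  have V_eq: "V = (\<lambda>g x. g (pscale (- int j) x)) ` fspan (translates \<phi>)"
    by (simp add: V_def translates_def image_image flip: fspan_compose)
  have VL2: "V \<subseteq> L2"
    unfolding V_eq using fspan_translates_L2[OF step] L2_pscale by blast
  have per_gen: "\<phi> (pscale (- int j) (x + y) - a) = \<phi> (pscale (- int j) x - a)"
    if "y \<in> pball (- int (M + j)) 0" for x y a
  proof -
    have "pscale (- int j) y \<in> pball (- int M) 0"
      using that by simp
    from step_functionD(1)[OF step this, of "pscale (- int j) x - a"] show ?thesis
      by (simp add: pscale_add algebra_simps)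
  qed
  have per: "g (x + y) = g x" if "g \<in> V" "y \<in> pball (- int (M + j)) 0" for g x y
  proof -
    have "V \<subseteq> {g. g (x + y) = g x}"
      unfolding V_def
      by (rule fspan_least) (use per_gen[OF that(2)] in \<open>auto simp: csubspace_def\<close>)
    then show ?thesis using that by blast
  qed
  \<comment> \<open>At the finer resolution M + j, phi and all members of \<open>V\<close> are
    constant on the same balls, so one finite grid tests them together.\<close>
  have step': "step_function N (M + j) \<phi>"
    using step pball_mono[of "- int (M + j)" "- int M" "0 :: 'p padic"]
    by (auto simp: step_function_def)
  define X where "X = (\<lambda>n. pgrid (int N) (int n) :: 'p padic) ` {..<CARD('p) ^ (N + (M + j))}"
  have "\<exists>g\<in>V. \<forall>x\<in>X. \<phi> x = g x"
  proof (rule csubspace_finite_closed)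
    show "finite X" by (simp add: X_def)
    show "csubspace V" unfolding V_def by (rule csubspace_fspan)
    fix e :: real assume "0 < e"
    then have "0 < e\<^sup>2 * real CARD('p) powi (- int (M + j))" by simp
    then obtain g where g: "g \<in> V" "l2sq (\<lambda>x. \<phi> x - g x) < e\<^sup>2 * real CARD('p) powi (- int (M + j))"
      using mem unfolding Vgen_eq[OF step] l2_closure_iff V_eq[symmetric] by blast
    have "cmod (\<phi> x - g x) < e" for x
    proof -
      have "(cmod (\<phi> x - g x))\<^sup>2 * real CARD('p) powi (- int (M + j)) \<le> l2sq (\<lambda>x. \<phi> x - g x)"
      proof (rule L2_fine_periodic_bound)
        show "(\<lambda>x. \<phi> x - g x) \<in> L2"
          using g(1) VL2 step_function_L2[OF step] by (intro L2_diff) auto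
        show "\<phi> (x + y) - g (x + y) = \<phi> x - g x" if "y \<in> pball (- int (M + j)) 0" for y
          using per[OF g(1) that] step_functionD(1)[OF step' that] by simp
      qed
      also note g(2)
      finally have "(cmod (\<phi> x - g x))\<^sup>2 < e\<^sup>2"
        by (subst (asm) mult_less_cancel_right_pos) auto
      then show ?thesis
        using \<open>0 < e\<close> by (simp add: power_less_imp_less_base)
    qed
    then show "\<exists>g\<in>V. \<forall>x\<in>X. cmod (\<phi> x - g x) < e"
      using g(1) by blast
  qed
  then obtain g where g: "g \<in> V" "\<forall>x\<in>X. \<phi> x = g x" by blast
  obtain A c where A: "finite A" "A \<subseteq> Ip" "g = (\<lambda>x. \<Sum>a\<in>A. c a * \<phi> (pscale (- int j) x - a))"
    using fspan_image_sum[OF g(1)[unfolded V_def]] by blast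
  \<comment> \<open>For x in B_N(0) the point p^(-j) x lies in B_(N+j)(0), and a term with a outside
    this ball vanishes. Dropping such terms changes no grid value and leaves a sum supported in
    B_N(0), which its grid values determine.\<close>
  define A' where "A' = A \<inter> pball (int (N + j)) 0"
  have zero: "\<phi> z = 0" if "z \<notin> pball (int (N + j)) 0" for z
    using step_functionD(2)[OF step, of z] that pball_mono[of "int N" "int (N + j)" "0 :: 'p padic"] by auto
  have "\<phi> x = (\<Sum>a\<in>A'. c a * \<phi> (pscale (- int j) x - a))" for x
  proof (rule step_function_eqI[OF step'])
    show "step_function N (M + j) (\<lambda>x. \<Sum>a\<in>A'. c a * \<phi> (pscale (- int j) x - a))"
    proof (rule step_function_sum)
      fix a assume a: "a \<in> A'"
      show "step_function N (M + j) (\<lambda>x. \<phi> (pscale (- int j) x - a))"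
        unfolding step_function_def
      proof (intro conjI allI ballI impI)
        fix x :: "'p padic" assume "x \<notin> pball (int N) 0"
        then have "pscale (- int j) x \<notin> pball (int (N + j)) 0" by simp
        then have "pscale (- int j) x - a \<notin> pball (int (N + j)) 0"
          using a pball_zero_add[of "pscale (- int j) x - a" "int (N + j)" a] by (auto simp: A'_def)
        then show "\<phi> (pscale (- int j) x - a) = 0" by (rule zero)
      qed (rule per_gen)
    qed
    fix n assume n: "n < CARD('p) ^ (N + (M + j))"
    let ?x = "pgrid (int N) (int n) :: 'p padic"
    have "\<phi> ?x = (\<Sum>a\<in>A. c a * \<phi> (pscale (- int j) ?x - a))"
      using g(2) n by (simp add: X_def A(3))
    also have "\<dots> = (\<Sum>a\<in>A'. c a * \<phi> (pscale (- int j) ?x - a))"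
    proof (rule sum.mono_neutral_right[OF A(1)])
      show "\<forall>a\<in>A - A'. c a * \<phi> (pscale (- int j) ?x - a) = 0"
      proof
        fix a assume "a \<in> A - A'"
        then have a: "a \<notin> pball (int (N + j)) 0" by (simp add: A'_def)
        have "pscale (- int j) ?x \<in> pball (int (N + j)) 0" by simp
        then have "pscale (- int j) ?x - a \<notin> pball (int (N + j)) 0"
          using a pball_zero_diff[of "pscale (- int j) ?x" "int (N + j)" "pscale (- int j) ?x - a"] by auto
        then show "c a * \<phi> (pscale (- int j) ?x - a) = 0" using zero by simp
      qed
    qed (simp add: A'_def)
    finally show "\<phi> ?x = (\<Sum>a\<in>A'. c a * \<phi> (pscale (- int j) ?x - a))" .
  qed
  moreover have "finite A'" "A' \<subseteq> Ip \<inter> pball (int (N + j)) 0"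
    using A(1,2) by (auto simp: A'_def)
  ultimately show ?thesis
    by blast
qed

lemma refinable_if_in_Vgen_1:
  fixes \<phi> :: "'p::prime_card padic \<Rightarrow> complex"
  assumes step: "step_function N M \<phi>" and mem: "\<phi> \<in> Vgen \<phi> 1"
  shows "refinable \<phi>"
proof -
  obtain A c where A: "finite A" "A \<subseteq> Ip" "\<And>x. \<phi> x = (\<Sum>a\<in>A. c a * \<phi> (pscale (- 1) x - a))"
    using exact_refinement[OF step, of 1] mem by auto
  \<comment> \<open>The relation is finite and exact. With coefficients 0 off \<open>A\<close>,
    every finite set containing \<open>A\<close> gives error 0, as unconditional convergence
    demands.\<close>
  define \<alpha> where "\<alpha> a = (if a \<in> A then c a else 0)" for a
  have "l2norm (\<lambda>x. \<phi> x - (\<Sum>a\<in>F. \<alpha> a * \<phi> (psub (pscale (- 1) x) a))) < e"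
    if "0 < e" "finite F" "A \<subseteq> F" for e F
  proof -
    have "\<phi> x = (\<Sum>a\<in>F. \<alpha> a * \<phi> (pscale (- 1) x - a))" for x
    proof -
      have "(\<Sum>a\<in>A. c a * \<phi> (pscale (- 1) x - a)) = (\<Sum>a\<in>F. \<alpha> a * \<phi> (pscale (- 1) x - a))"
        using that by (intro sum.mono_neutral_cong_left) (auto simp: \<alpha>_def)
      with A(3)[of x] show ?thesis by (rule trans)
    qed
    then have "(\<lambda>x. \<phi> x - (\<Sum>a\<in>F. \<alpha> a * \<phi> (psub (pscale (- 1) x) a))) = (\<lambda>x. 0)"
      unfolding padic_group_folds by (metis right_minus_eq)
    then show ?thesis
      using that(1) by (simp only: l2norm_less_iff) simp
  qed
  then show ?thesis
    unfolding refinable_def using step_function_L2[OF step] A(1,2) by blast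
qed

lemma card_support_le:
  fixes \<phi> :: "'p::prime_card padic \<Rightarrow> complex"
  assumes step: "step_function N M \<phi>" and mem: "\<phi> \<in> Vgen \<phi> (int (N + M))"
    and nz: "dft (CARD('p) ^ (N + M)) (\<lambda>n. \<phi> (pgrid (int N) n)) 0 \<noteq> 0"
  shows "card {l. l < CARD('p) ^ (N + M) \<and> dft (CARD('p) ^ (N + M)) (\<lambda>n. \<phi> (pgrid (int N) n)) (int l) \<noteq> 0}
    \<le> CARD('p) ^ N"
proof -
  let ?j = "N + M"
  let ?P = "CARD('p) ^ ?j"
  let ?K = "N + ?j"
  have P: "0 < ?P" using card_gt_1[where ?'p='p] by simp
  obtain A c where A: "finite A" "A \<subseteq> Ip \<inter> pball (int ?K) 0"
      "\<And>x. \<phi> x = (\<Sum>a\<in>A. c a * \<phi> (pscale (- int ?j) x - a))"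
    using exact_refinement[OF step mem] by blast
  let ?t = "\<lambda>k. pgrid (int ?K) (int k) :: 'p padic"
  \<comment> \<open>The numerators k < p^(N+j) enumerate the elements of I_p in B_(N+j)(0).
    Extension by 0 yields p^N P coefficients, the range R P with R = p^N.\<close>
  define a where "a k = (if ?t k \<in> A then c (?t k) else 0)" for k
  have inj: "inj_on ?t {..<CARD('p) ^ ?K}"
  proof (rule inj_onI)
    fix k l assume kl: "k \<in> {..<CARD('p) ^ ?K}" "l \<in> {..<CARD('p) ^ ?K}" "?t k = ?t l"
    then have "pgrid (0 + int ?K) (int k - int l) \<in> pball 0 (0 :: 'p padic)"
      by (simp add: pgrid_diff)
    then have "int k mod int (CARD('p) ^ ?K) = int l mod int (CARD('p) ^ ?K)"
      unfolding pgrid_in_pball_iff by (simp add: mod_eq_dvd_iff)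
    then show "k = l"
      using kl by (simp flip: of_nat_mod del: of_nat_power)
  qed
  have sub: "A \<subseteq> ?t ` {..<CARD('p) ^ ?K}"
  proof
    fix z assume "z \<in> A"
    then have "z \<in> Ip" "z \<in> pball (int ?K) 0" using A(2) by auto
    then obtain n where "n < CARD('p) ^ ?K" "z = ?t n" by (rule Ip_grid_ex)
    then show "z \<in> ?t ` {..<CARD('p) ^ ?K}" by blast
  qed
  have sum: "\<phi> x = (\<Sum>k<CARD('p) ^ ?K. a k * \<phi> (pscale (- int ?j) x - ?t k))" for x
  proof -
    have "(\<Sum>a\<in>A. c a * \<phi> (pscale (- int ?j) x - a))
        = (\<Sum>z\<in>?t ` {..<CARD('p) ^ ?K}. (if z \<in> A then c z else 0) * \<phi> (pscale (- int ?j) x - z))"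
      using sub by (intro sum.mono_neutral_cong_left) auto
    also have "\<dots> = (\<Sum>k<CARD('p) ^ ?K. a k * \<phi> (pscale (- int ?j) x - ?t k))"
      unfolding a_def by (simp only: sum.reindex[OF inj] o_def)
    finally show ?thesis
      by (rule trans[OF A(3)])
  qed
  show ?thesis
  proof (rule dft_support_card_le[OF P _ _ nz])
    show "\<phi> (pgrid (int N) (m + int ?P)) = \<phi> (pgrid (int N) m)" for m
      by (rule step_function_grid_periodic[OF step])
    show "\<phi> (pgrid (int N) n) = (\<Sum>k<CARD('p) ^ N * ?P. a k *
        (if int ?P dvd n - int k then \<phi> (pgrid (int N) ((n - int k) div int ?P)) else 0))" for n
    proof -
      \<comment> \<open>The argument is (n - k) / p^(N+j). If p^j = P divides n - k it is again a
        sample point; otherwise it lies outside B_N(0) and phi vanishes.\<close>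
      have "\<phi> (pscale (- int ?j) (pgrid (int N) n) - ?t k)
          = (if int ?P dvd n - int k then \<phi> (pgrid (int N) ((n - int k) div int ?P)) else 0)" for k
      proof -
        have eq: "pscale (- int ?j) (pgrid (int N) n) - ?t k = pgrid (int N + int ?j) (n - int k)"
          by (simp add: pgrid_diff)
        show ?thesis
        proof (cases "int ?P dvd n - int k")
          case True
          then obtain i where i: "n - int k = int ?P * i" ..
          then have "pgrid (int N + int ?j) (n - int k) = (pgrid (int N) i :: 'p padic)"
            using pgrid_refine[of "int N" ?j i, where ?'p='p] by simp
          moreover have "(n - int k) div int ?P = i" using i P by simp
          ultimately show ?thesis unfolding eq using True by simp
        next
          case False
          then have "pgrid (int N + int ?j) (n - int k) \<notin> pball (int N) (0 :: 'p padic)"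
            unfolding pgrid_in_pball_iff by simp
          then show ?thesis unfolding eq using False step_functionD(2)[OF step] by simp
        qed
      qed
      then show ?thesis
        using sum[of "pgrid (int N) n"] by (simp only: power_add)
    qed
  qed
qed

theorem theorem6:
  fixes \<phi> :: "'p::prime_card padic \<Rightarrow> complex" and M N :: nat
  assumes "\<phi> \<in> DNM N M"
    and "pfourier \<phi> pzero \<noteq> 0"
  shows "is_MRA (Vgen \<phi>) \<longleftrightarrow>
           refinable \<phi> \<and>
           card {l::nat. l < CARD('p) ^ (M + N) \<and>
                   pfourier \<phi> (pscale (- int M) (pnat l)) \<noteq> 0} \<le> CARD('p) ^ N"
proof -
  have step: "step_function N M \<phi>"
    by (rule DNM_step_function[OF assms(1)])
  have nz: "dft (CARD('p) ^ (N + M)) (\<lambda>n. \<phi> (pgrid (int N) n)) 0 \<noteq> 0"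
    using assms(2) pfourier_zero[OF step] by blast
  show ?thesis
    unfolding pfourier_support[OF step]
  proof
    assume mra: "is_MRA (Vgen \<phi>)"
    then have "\<forall>j. Vgen \<phi> j \<subseteq> Vgen \<phi> (j + 1)"
      by (simp add: is_MRA_def)
    then have "Vgen \<phi> 0 \<subseteq> Vgen \<phi> 1"
      using Vgen_mono_iff[OF step] by blast
    then have "\<phi> \<in> Vgen \<phi> (int j)" for j
      using phi_in_Vgen_0[OF step] Vgen_mono[OF step, of 0 "int j"] by auto
    from this[of 1] this[of "N + M"]
    show "refinable \<phi> \<and> card {l. l < CARD('p) ^ (N + M) \<and>
        dft (CARD('p) ^ (N + M)) (\<lambda>n. \<phi> (pgrid (int N) n)) (int l) \<noteq> 0} \<le> CARD('p) ^ N"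
      using refinable_if_in_Vgen_1[OF step] card_support_le[OF step _ nz] by simp
  next
    assume "refinable \<phi> \<and> card {l. l < CARD('p) ^ (N + M) \<and>
        dft (CARD('p) ^ (N + M)) (\<lambda>n. \<phi> (pgrid (int N) n)) (int l) \<noteq> 0} \<le> CARD('p) ^ N"
    then show "is_MRA (Vgen \<phi>)"
      using is_MRA_Vgen[OF step _ nz] by blast
  qed
qed

end
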